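(* Let $X$ be a geodesic, locally compact, semi-locally simply connected space and let $G$ be an Abelian group with a fixed non-zero element $1_G$. Assume $\alpha$ is a geodesic circle in $X$ satisfying the following properties: (i) $\alpha$ is a bottleneck loop; (ii) $\alpha$ is homologous to a non-trivial $G$-combination of loops $\beta_1,\dots,\beta_k$ in $X$ of length at most $|\alpha|$, none of which equals $\alpha$ as a subset of $X$; that is, $[\alpha]_G=\sum_{i=1}^k g_i[\beta_i]$ in the singular homology group $H_1(X;G)$ for some $g_i\in G$; (iii) $\alpha$ has arbitrarily small geodesically convex neighborhoods. Then there exist bounds $B_1>|\alpha|/3$ and $B_2>0$ such that for all increasing bijections $a,b\colon(0,\infty)\to(0,\infty)$ with $a\ge b$ pointwise, and for all $r>0$ such that $B_1>a(r)>|\alpha|/3$ and $B_2>b(r)$, there exists a non-trivial class $$Q_r\in H_2(\mathrm{sRips}(X;a(r),2,b(r));G)$$ such that the following hold: (1) for all $r_1<r_2$ with $B_1>a(r_i)>|\alpha|/3$ and $b(r_i)<B_2$ for $i=1,2$, we have $i^G_{r_1,r_2}(Q_{r_1})=Q_{r_2}$, where $i^G_{r_1,r_2}\colon H_2(\mathrm{sRips}(X;a(r_1),2,b(r_1));G)\to H_2(\mathrm{sRips}(X;a(r_2),2,b(r_2));G)$ is the map induced by the natural inclusion; (2) for every $q>0$ with $a(q)\le|\alpha|/3$ (and every $r>0$ with $B_1>a(r)>|\alpha|/3$ and $B_2>b(r)$) there exists no $Q_q\in H_2(\mathrm{sRips}(X;a(q),2,b(q));G)$ with $i^G_{q,r}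(Q_q)=Q_r$.
   Context: A metric space $X$ is geodesic if any $x,y\in X$ are joined by a geodesic, i.e. an isometric embedding $\gamma\colon[0,d(x,y)]\to X$ with $\gamma(0)=x$, $\gamma(d(x,y))=y$. A subset $A\subseteq X$ is geodesically convex if for all $x,y\in A$ all geodesics in $X$ from $x$ to $y$ lie in $A$. $X$ is semi-locally simply connected if for all $x\in X$ and $\varepsilon>0$ there is $\delta>0$ such that each loop in the open ball $N(x,\delta)$ is contractible in $N(x,\varepsilon)$. A loop is a continuous map from $S^1$ to $X$; loops are also identified with their images; $|\alpha|$ is the length of $\alpha$ and $\alpha^-$ the reversed loop. A geodesic circle in $X$ is an isometrically embedded $S^1_c$ for some $c>0$, where $S^1_c$ is the circle of circumference $c$ with its geodesic metric. A loop $\alpha$ of finite length is a bottleneck loop if there is a neighborhood $U$ of $\alpha$ in which $\alpha$ is the shortest representative of its free unoriented homotopy class: every loop in $U$ freely homotopic in $U$ to $\alpha$ or $\alpha^-$ that is of length at most $|\alpha|$ coincides with $\alpha$ up to reparameterization and orientation. "Arbitrarily small geodesically convex neighborhoods" means that every neighborhood of $\alpha$ contains a geodesically convex neighborhood of $\alpha$. $[\alpha]_G$ is the class of the singular cycle $1_G\cdot\alpha$, and $g_i[\beta_i]$ is the class of the cycle $g_i\cdot\beta_i$. A combination is non-trivial if not all $g_i$ are zero. For a metric space $Y$, reals $r_1\ge r_2>0$ and $n\in\mathbb N$, the selective Rips complex $\mathrm{sRips}(Y;r_1,n,r_2)$ is the abstract simplicial complex on vertex set $Y$ in which a finite non-empty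 subset $\sigma\subset Y$ is a simplex iff (1) $\mathrm{Diam}(\sigma)<r_1$ and (2) there exist subsets $U_0,\dots,U_n\subset Y$ of diameter less than $r_2$ with $\sigma\subset U_0\cup\dots\cup U_n$. *)

theory Defs
  imports "HOL-Analysis.Analysis" "HOL-Homology.Homology"
begin

definition geodesic_from_to :: "(real \<Rightarrow> 'a::metric_space) \<Rightarrow> 'a \<Rightarrow> 'a \<Rightarrow> bool" where
  "geodesic_from_to \<gamma> x y \<longleftrightarrow>
     \<gamma> 0 = x \<and> \<gamma> (dist x y) = y \<and>
     (\<forall>s\<in>{0..dist x y}. \<forall>t\<in>{0..dist x y}. dist (\<gamma> s) (\<gamma> t) = \<bar>s - t\<bar>)"

definition geodesic_space :: "'a::metric_space itself \<Rightarrow> bool" where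
  "geodesic_space _ \<longleftrightarrow> (\<forall>x y :: 'a. \<exists>\<gamma>. geodesic_from_to \<gamma> x y)"

definition geodesically_convex :: "'a::metric_space set \<Rightarrow> bool" where
  "geodesically_convex A \<longleftrightarrow>
     (\<forall>x\<in>A. \<forall>y\<in>A. \<forall>\<gamma>. geodesic_from_to \<gamma> x y \<longrightarrow> \<gamma> ` {0..dist x y} \<subseteq> A)"

definition neighbourhood_of :: "'a::topological_space set \<Rightarrow> 'a set \<Rightarrow> bool" where
  "neighbourhood_of U A \<longleftrightarrow> A \<subseteq> interior U"

text \<open>The circle is \<open>[0,1]\<close> with its endpoints identified, so that a loop is a closed path in the
  sense of the library, and \<^const>\<open>homotopic_loops\<close> is free homotopy of loops.\<close>

definition is_loop :: "(real \<Rightarrow> 'a::topological_space) \<Rightarrow> bool" where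
  "is_loop p \<longleftrightarrow> path p \<and> pathfinish p = pathstart p"

definition semilocally_simply_connected :: "'a::metric_space itself \<Rightarrow> bool" where
  "semilocally_simply_connected _ \<longleftrightarrow>
     (\<forall>x :: 'a. \<forall>\<epsilon>>0. \<exists>\<delta>>0. \<forall>p. is_loop p \<and> path_image p \<subseteq> ball x \<delta> \<longrightarrow>
        (\<exists>y. homotopic_loops (ball x \<epsilon>) p (\<lambda>_. y)))"

definition curve_length :: "(real \<Rightarrow> 'a::metric_space) \<Rightarrow> ereal" where
  "curve_length p =
     (SUP ts\<in>{ts. sorted ts \<and> set ts \<subseteq> {0..1}}.
        ereal (\<Sum>i<length ts - 1. dist (p (ts ! i)) (p (ts ! Suc i))))"

text \<open>The distance of \<open>s\<close> and \<open>t\<close> on the circle of circumference 1 is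
  \<open>min \<bar>s - t\<bar> (1 - \<bar>s - t\<bar>)\<close>; parameters are scaled by the circumference \<open>c\<close>.\<close>

definition geodesic_circle :: "(real \<Rightarrow> 'a::metric_space) \<Rightarrow> bool" where
  "geodesic_circle p \<longleftrightarrow>
     (\<exists>c>0. \<forall>s\<in>{0..1}. \<forall>t\<in>{0..1}. dist (p s) (p t) = c * min \<bar>s - t\<bar> (1 - \<bar>s - t\<bar>))"

text \<open>Lift to the real line of a weakly monotone degree one self-map of the circle. Intervals of
  constancy have to be allowed: a loop may pause without changing its length, so with strictly
  monotone reparameterizations there would be no bottleneck loops at all.\<close>

definition circle_reparam :: "(real \<Rightarrow> real) \<Rightarrow> bool" where
  "circle_reparam \<phi> \<longleftrightarrow> continuous_on UNIV \<phi> \<and> mono \<phi> \<and> (\<forall>t. \<phi> (t + 1) = \<phi> t + 1)"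

definition same_up_to_reparam :: "(real \<Rightarrow> 'a) \<Rightarrow> (real \<Rightarrow> 'a) \<Rightarrow> bool" where
  "same_up_to_reparam p q \<longleftrightarrow>
     (\<exists>\<phi> \<psi>. circle_reparam \<phi> \<and> circle_reparam \<psi> \<and> (\<forall>t. p (frac (\<phi> t)) = q (frac (\<psi> t))))"

definition bottleneck_loop :: "(real \<Rightarrow> 'a::metric_space) \<Rightarrow> bool" where
  "bottleneck_loop p \<longleftrightarrow>
     is_loop p \<and> curve_length p < \<infinity> \<and>
     (\<exists>U. neighbourhood_of U (path_image p) \<and>
        (\<forall>q. is_loop q \<and> path_image q \<subseteq> U \<and>
             (homotopic_loops U q p \<or> homotopic_loops U q (reversepath p)) \<and>
             curve_length q \<le> curve_length p \<longrightarrow>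
             same_up_to_reparam q p \<or> same_up_to_reparam q (reversepath p)))"

text \<open>The library treats integral singular homology only. For coefficients in an Abelian group
  \<open>'g\<close>, a chain is a finitely supported function into \<open>'g\<close>. As in the library, homology
  groups are quotients in the sense of HOL-Algebra, hence written multiplicatively.\<close>

definition additive_group :: "'c::ab_group_add set \<Rightarrow> 'c monoid" where
  "additive_group A = \<lparr>carrier = A, monoid.mult = (+), one = 0\<rparr>"

type_synonym ('a, 'g) singular_gchain = "((nat \<Rightarrow> real) \<Rightarrow> 'a) \<Rightarrow>\<^sub>0 'g"

definition singular_gchains ::
    "nat \<Rightarrow> 'a topology \<Rightarrow> ('a, 'g::ab_group_add) singular_gchain set" where
  "singular_gchains p X = {c. Poly_Mapping.keys c \<subseteq> singular_simplex_set p X}"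

definition singular_gboundary ::
    "nat \<Rightarrow> ('a, 'g::ab_group_add) singular_gchain \<Rightarrow> ('a, 'g) singular_gchain" where
  "singular_gboundary p c =
     (if p = 0 then 0
      else \<Sum>f\<in>Poly_Mapping.keys c. \<Sum>k\<le>p.
             Poly_Mapping.single (singular_face p k f)
               (if even k then Poly_Mapping.lookup c f else - Poly_Mapping.lookup c f))"

definition singular_gcycle_group ::
    "nat \<Rightarrow> 'a topology \<Rightarrow> ('a, 'g::ab_group_add) singular_gchain monoid" where
  "singular_gcycle_group p X =
     additive_group {c \<in> singular_gchains p X. singular_gboundary p c = 0}"

definition singular_gboundaries ::
    "nat \<Rightarrow> 'a topology \<Rightarrow> ('a, 'g::ab_group_add) singular_gchain set" where
  "singular_gboundaries p X = singular_gboundary (Suc p) ` singular_gchains (Suc p) X"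

definition singular_ghomology ::
    "nat \<Rightarrow> 'a topology \<Rightarrow> ('a, 'g::ab_group_add) singular_gchain set monoid" where
  "singular_ghomology p X = singular_gcycle_group p X Mod singular_gboundaries p X"

definition singular_gclass ::
    "nat \<Rightarrow> 'a topology \<Rightarrow> ('a, 'g::ab_group_add) singular_gchain \<Rightarrow> ('a, 'g) singular_gchain set"
  where
  "singular_gclass p X z = singular_gboundaries p X #>\<^bsub>singular_gcycle_group p X\<^esub> z"

text \<open>A path as a singular 1-simplex; the barycentric coordinate \<open>x 1\<close> is the path parameter.\<close>

definition path_simplex :: "(real \<Rightarrow> 'a) \<Rightarrow> (nat \<Rightarrow> real) \<Rightarrow> 'a" where
  "path_simplex p = restrict (\<lambda>x. p (x 1)) (standard_simplex 1)"

definition loop_class :: "'g::ab_group_add \<Rightarrow> (real \<Rightarrow> 'a::topological_space) \<Rightarrow> ('a, 'g) singular_gchain set"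
  where
  "loop_class g p = singular_gclass 1 euclidean (Poly_Mapping.single (path_simplex p) g)"

text \<open>A complex is its set of simplices, i.e. of finite non-empty sets of vertices. An oriented
  \<open>p\<close>-chain is a finitely supported function on the orderings \<open>[v\<^sub>0, \<dots>, v\<^sub>p]\<close> of the
  \<open>p\<close>-simplices that changes sign whenever two vertices are exchanged.\<close>

type_synonym ('a, 'g) simplicial_chain = "'a list \<Rightarrow>\<^sub>0 'g"

definition simplicial_chains ::
    "nat \<Rightarrow> 'a set set \<Rightarrow> ('a, 'g::ab_group_add) simplicial_chain set" where
  "simplicial_chains p K =
     {c. (\<forall>w\<in>Poly_Mapping.keys c. distinct w \<and> length w = Suc p \<and> set w \<in> K) \<and>
         (\<forall>w i j. i < j \<and> j < length w \<longrightarrow>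
            Poly_Mapping.lookup c (w[i := w ! j, j := w ! i]) = - Poly_Mapping.lookup c w)}"

text \<open>The coefficient of the boundary of \<open>c\<close> at \<open>w\<close> is the sum of the coefficients of \<open>c\<close> at all
  \<open>v # w\<close>. On the oriented simplex \<open>[v\<^sub>0, \<dots>, v\<^sub>p]\<close> (the alternating function with value \<open>g\<close> there) this is the
  usual alternating sum of faces, as moving \<open>v\<^sub>i\<close> to the front of the list gives the sign
  \<open>(-1)^i\<close>. The complex is not augmented: faces \<open>[]\<close> of vertices are dropped.\<close>

definition simplicial_boundary ::
    "('a, 'g::ab_group_add) simplicial_chain \<Rightarrow> ('a, 'g) simplicial_chain" where
  "simplicial_boundary c =
     (\<Sum>u\<in>{u \<in> Poly_Mapping.keys c. tl u \<noteq> []}.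
        Poly_Mapping.single (tl u) (Poly_Mapping.lookup c u))"

definition simplicial_cycle_group ::
    "nat \<Rightarrow> 'a set set \<Rightarrow> ('a, 'g::ab_group_add) simplicial_chain monoid" where
  "simplicial_cycle_group p K =
     additive_group {c \<in> simplicial_chains p K. simplicial_boundary c = 0}"

definition simplicial_boundaries ::
    "nat \<Rightarrow> 'a set set \<Rightarrow> ('a, 'g::ab_group_add) simplicial_chain set" where
  "simplicial_boundaries p K = simplicial_boundary ` simplicial_chains (Suc p) K"

definition simplicial_homology ::
    "nat \<Rightarrow> 'a set set \<Rightarrow> ('a, 'g::ab_group_add) simplicial_chain set monoid" where
  "simplicial_homology p K = simplicial_cycle_group p K Mod simplicial_boundaries p K"

definition simplicial_class ::
    "nat \<Rightarrow> 'a set set \<Rightarrow> ('a, 'g::ab_group_add) simplicial_chain \<Rightarrow> ('a, 'g) simplicial_chain set"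
  where
  "simplicial_class p K z = simplicial_boundaries p K #>\<^bsub>simplicial_cycle_group p K\<^esub> z"

text \<open>The map \<open>H\<^sub>p(K) \<rightarrow> H\<^sub>p(L)\<close> induced by an inclusion \<open>K \<subseteq> L\<close> sends \<open>[z]\<close> to
  \<open>[z]\<close>. All representatives of a class \<open>Q\<close> of \<open>K\<close> have the same class in \<open>L\<close>, so the union
  below is just that class.\<close>

definition inclusion_induced ::
    "nat \<Rightarrow> 'a set set \<Rightarrow> ('a, 'g::ab_group_add) simplicial_chain set \<Rightarrow> ('a, 'g) simplicial_chain set"
  where
  "inclusion_induced p L Q = (\<Union>z\<in>Q. simplicial_class p L z)"

text \<open>The library's \<^const>\<open>diameter\<close> is only meaningful for bounded sets, hence the explicit
  boundedness condition on the sets \<open>U i\<close>.\<close>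

definition sRips :: "'a::metric_space set \<Rightarrow> real \<Rightarrow> nat \<Rightarrow> real \<Rightarrow> 'a set set" where
  "sRips Y r1 n r2 =
     {\<sigma>. finite \<sigma> \<and> \<sigma> \<noteq> {} \<and> \<sigma> \<subseteq> Y \<and> diameter \<sigma> < r1 \<and>
         (\<exists>U. (\<forall>i\<le>n. U i \<subseteq> Y \<and> bounded (U i) \<and> diameter (U i) < r2) \<and> \<sigma> \<subseteq> (\<Union>i\<le>n. U i))}"

end

theory Submission
  imports Defs
begin

text \<open>Let \<open>c\<close> be the circumference of the geodesic circle. The two-dimensional homology of the selective Rips
  complex with parameters \<open>a\<close>, 2 and \<open>b\<close> has a simple description: every triple of points with
  pairwise distances less than \<open>a\<close> spans a triangle, while a tetrahedron must, by the pigeonhole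
  principle, have two vertices at distance less than \<open>b\<close>.

  The class is represented by one cycle for all scales. A singular chain that bounds the difference
  of \<open>\<alpha>\<close> and the combination of the \<open>\<beta> i\<close> is subdivided into small triangles. A loop of length at most
  \<open>c\<close> is cut into thirds and filled by the triangle on the three cut points and by fans of thin
  triangles over the thirds (\<open>fill_loop\<close>). Gluing gives a cycle all of whose triangles have sides
  of length at most \<open>c / 3\<close> (\<open>ex_cycle\<close>). It is a cycle at every scale above \<open>c / 3\<close>, and its
  classes are compatible with the inclusions.

  Non-triviality is detected by a cocycle: count, with sign, the triangles that are \<open>\<epsilon>\<close>-close to an
  equilateral triangle inscribed in the circle. Here the bottleneck property gives rigidity. The
  geodesic triangle on such vertices is uniformly close to the circle, because convex neighbourhoods
  leave geodesics no room (\<open>geodesic_near_arc\<close>), and hence it is homotopic to the circle by local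
  simple connectedness (\<open>homotopic_loops_nearby_metric\<close>). If moreover its sides are at most \<open>c / 3\<close>,
  it cannot be shorter than the circle, and it is the circle (\<open>rigid_near_equilateral\<close>). By local
  compactness there is a gap: if the sides are less than some bound \<open>B1 > c / 3\<close>, triangles that are
  \<open>\<epsilon>\<close>-close to an equilateral one are even \<open>\<epsilon> / 2\<close>-close (\<open>near_equilateral_gap\<close>). Exchanging a vertex for
  one at distance less than \<open>B2 = \<epsilon> / 2\<close> therefore preserves being counted, and since every tetrahedron
  has two such vertices, its counted faces cancel in pairs (\<open>count_good_boundary\<close>).

  In the cycle only the triangle on the cut points of \<open>\<alpha>\<close> is counted: the one of \<open>\<beta> i\<close> could be
  equilateral on the circle only if \<open>\<beta> i\<close> ran once around the circle (\<open>thirds_not_equilateral\<close>). So the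
  cocycle takes the value \<open>one_G\<close>, which is not zero. Finally, by rigidity a cycle whose triangles have
  diameter less than \<open>c / 3\<close> contains no counted triangle, so that the class does not come from a
  scale at most \<open>c / 3\<close>.\<close>

section \<open>Chains as linear extensions\<close>

text \<open>Coefficients lie in a mere Abelian group, so there is no scalar multiplication of chains. Instead
  each basis element carries an additive map of coefficients, and these extend to all chains.\<close>

definition lin_ext :: "('k \<Rightarrow> 'g \<Rightarrow> 'h::ab_group_add) \<Rightarrow> ('k \<Rightarrow>\<^sub>0 'g::ab_group_add) \<Rightarrow> 'h" where
  "lin_ext f c = (\<Sum>x\<in>Poly_Mapping.keys c. f x (Poly_Mapping.lookup c x))"

lemma lin_ext_superset:
  assumes "\<And>x. Modules.additive (f x)" "finite S" "Poly_Mapping.keys c \<subseteq> S"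
  shows "lin_ext f c = (\<Sum>x\<in>S. f x (Poly_Mapping.lookup c x))"
  unfolding lin_ext_def
  by (rule sum.mono_neutral_left) (use assms in \<open>auto simp: in_keys_iff Modules.additive.zero\<close>)

lemma additive_lin_ext:
  fixes f :: "'k \<Rightarrow> 'g::ab_group_add \<Rightarrow> 'h::ab_group_add"
  assumes "\<And>x. Modules.additive (f x)"
  shows "Modules.additive (lin_ext f)"
proof
  fix c d :: "'k \<Rightarrow>\<^sub>0 'g"
  let ?S = "Poly_Mapping.keys c \<union> Poly_Mapping.keys d"
  have "lin_ext f (c + d) = (\<Sum>x\<in>?S. f x (Poly_Mapping.lookup (c + d) x))"
    by (rule lin_ext_superset) (use assms Poly_Mapping.keys_add[of c d] in auto)
  also have "\<dots> = (\<Sum>x\<in>?S. f x (Poly_Mapping.lookup c x)) + (\<Sum>x\<in>?S. f x (Poly_Mapping.lookup d x))"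
    by (simp add: lookup_add Modules.additive.add[OF assms] sum.distrib)
  also have "\<dots> = lin_ext f c + lin_ext f d"
    using assms by (simp add: lin_ext_superset[of f ?S c] lin_ext_superset[of f ?S d])
  finally show "lin_ext f (c + d) = lin_ext f c + lin_ext f d" .
qed

lemma lin_ext_single:
  assumes "\<And>x. Modules.additive (f x)"
  shows "lin_ext f (Poly_Mapping.single x g) = f x g"
  by (simp add: lin_ext_def Modules.additive.zero[OF assms])

lemma lin_ext_eq_0: "(\<And>x. x \<in> Poly_Mapping.keys c \<Longrightarrow> f x (Poly_Mapping.lookup c x) = 0) \<Longrightarrow> lin_ext f c = 0"
  by (simp add: lin_ext_def)

lemma poly_mapping_sum_singles:
  fixes c :: "'k \<Rightarrow>\<^sub>0 'g::ab_group_add"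
  shows "c = (\<Sum>x\<in>Poly_Mapping.keys c. Poly_Mapping.single x (Poly_Mapping.lookup c x))"
  by (rule poly_mapping_eqI)
     (simp add: lookup_sum lookup_single when_def sum.delta in_keys_iff)

text \<open>A chain is the sum of its terms, so identities between linear maps, such as the compatibility of
  subdivision with boundaries, need checking on single simplices only.\<close>

lemma additive_eq_on_keys:
  assumes "Modules.additive F" "Modules.additive G"
    "\<And>x g. x \<in> Poly_Mapping.keys c \<Longrightarrow> F (Poly_Mapping.single x g) = G (Poly_Mapping.single x g)"
  shows "F c = G c"
proof -
  have "F c = F (\<Sum>x\<in>Poly_Mapping.keys c. Poly_Mapping.single x (Poly_Mapping.lookup c x))"
    by (simp flip: poly_mapping_sum_singles)
  also have "\<dots> = G (\<Sum>x\<in>Poly_Mapping.keys c. Poly_Mapping.single x (Poly_Mapping.lookup c x))"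
    unfolding Modules.additive.sum[OF assms(1)] Modules.additive.sum[OF assms(2)] by (rule sum.cong) (auto intro: assms(3))
  also have "\<dots> = G c"
    by (simp flip: poly_mapping_sum_singles)
  finally show ?thesis .
qed

lemma additive_compose: "Modules.additive F \<Longrightarrow> Modules.additive G \<Longrightarrow> Modules.additive (\<lambda>x. F (G x))"
  by (simp add: Modules.additive_def)

lemma additive_single: "Modules.additive (Poly_Mapping.single x)"
  by unfold_locales (rule single_add)

lemma additive_diff: "Modules.additive F \<Longrightarrow> Modules.additive G \<Longrightarrow> Modules.additive (\<lambda>x. F x - G x)"
  by (simp add: Modules.additive_def)

lemma additive_plus: "Modules.additive F \<Longrightarrow> Modules.additive G \<Longrightarrow> Modules.additive (\<lambda>x. F x + G x)"
  by (simp add: Modules.additive_def)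

lemma additive_uminus: "Modules.additive F \<Longrightarrow> Modules.additive (\<lambda>x. - F x)"
  by (simp add: Modules.additive_def)

lemma additive_sum: "(\<And>i. i \<in> I \<Longrightarrow> Modules.additive (F i)) \<Longrightarrow> Modules.additive (\<lambda>x. \<Sum>i\<in>I. F i x)"
  by (simp add: Modules.additive_def sum.distrib)

lemma additive_zero: "Modules.additive (\<lambda>x. 0)"
  by (simp add: Modules.additive_def)

lemma additive_id: "Modules.additive (\<lambda>x. x)"
  by (simp add: Modules.additive_def)

lemma additive_If: "Modules.additive F \<Longrightarrow> Modules.additive G \<Longrightarrow> Modules.additive (\<lambda>x. if b then F x else G x)"
  by (simp add: Modules.additive_def)

lemmas additive_intros = additive_single additive_diff additive_plus additive_uminus additive_sum
  additive_zero additive_id additive_If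

subsection \<open>Simplicial chains\<close>

lemma simplicial_boundary_lin_ext:
  "simplicial_boundary = lin_ext (\<lambda>u g. if tl u \<noteq> [] then Poly_Mapping.single (tl u) g else 0)"
  by (rule ext) (simp add: simplicial_boundary_def lin_ext_def sum.inter_filter)

lemma additive_simplicial_boundary: "Modules.additive simplicial_boundary"
  unfolding simplicial_boundary_lin_ext by (intro additive_lin_ext additive_intros)

lemmas simplicial_boundary_add = Modules.additive.add[OF additive_simplicial_boundary]
  and simplicial_boundary_minus = Modules.additive.minus[OF additive_simplicial_boundary]
  and simplicial_boundary_diff = Modules.additive.diff[OF additive_simplicial_boundary]
  and simplicial_boundary_sum = Modules.additive.sum[OF additive_simplicial_boundary]
  and simplicial_boundary_0 = Modules.additive.zero[OF additive_simplicial_boundary]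

lemma simplicial_boundary_single:
  "simplicial_boundary (Poly_Mapping.single u g) =
     (if tl u \<noteq> [] then Poly_Mapping.single (tl u) g else 0)"
  unfolding simplicial_boundary_lin_ext
  by (subst lin_ext_single) (auto intro: additive_intros)

text \<open>The oriented simplices \<open>g \<cdot> [x, y]\<close> and \<open>g \<cdot> [x, y, z]\<close> as alternating chains. Both vanish
  when two vertices coincide, so degenerate simplices need no separate treatment.\<close>

definition edge_chain :: "'g \<Rightarrow> 'a \<Rightarrow> 'a \<Rightarrow> ('a, 'g::ab_group_add) simplicial_chain" where
  "edge_chain g x y = Poly_Mapping.single [x, y] g - Poly_Mapping.single [y, x] g"

definition triangle_chain :: "'g \<Rightarrow> 'a \<Rightarrow> 'a \<Rightarrow> 'a \<Rightarrow> ('a, 'g::ab_group_add) simplicial_chain" where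
  "triangle_chain g x y z =
     Poly_Mapping.single [x, y, z] g + Poly_Mapping.single [y, z, x] g + Poly_Mapping.single [z, x, y] g
     - Poly_Mapping.single [y, x, z] g - Poly_Mapping.single [x, z, y] g - Poly_Mapping.single [z, y, x] g"

lemma edge_chain_same [simp]: "edge_chain g x x = 0"
  by (simp add: edge_chain_def)

lemma edge_chain_swap: "edge_chain g y x = - edge_chain g x y"
  by (simp add: edge_chain_def)

lemma additive_edge_chain: "Modules.additive (\<lambda>g. edge_chain g x y)"
  unfolding edge_chain_def by (intro additive_intros)

lemma additive_triangle_chain: "Modules.additive (\<lambda>g. triangle_chain g x y z)"
  unfolding triangle_chain_def by (intro additive_intros)

lemma boundary_triangle_chain:
  "simplicial_boundary (triangle_chain g x y z) =
     edge_chain g y z - edge_chain g x z + edge_chain g x y"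
  by (simp add: triangle_chain_def edge_chain_def simplicial_boundary_add simplicial_boundary_diff
      simplicial_boundary_single)

lemma triangle_chain_degenerate [simp]:
  "triangle_chain g x x z = 0" "triangle_chain g x y x = 0" "triangle_chain g x y y = 0"
  by (simp_all add: triangle_chain_def algebra_simps)

lemma simplicial_chains_0: "0 \<in> simplicial_chains p K"
  by (simp add: simplicial_chains_def)

lemma simplicial_chains_add:
  "c \<in> simplicial_chains p K \<Longrightarrow> d \<in> simplicial_chains p K \<Longrightarrow> c + d \<in> simplicial_chains p K"
  using Poly_Mapping.keys_add[of c d] unfolding simplicial_chains_def by (auto simp: lookup_add)

lemma simplicial_chains_minus:
  "c \<in> simplicial_chains p K \<Longrightarrow> - c \<in> simplicial_chains p K"
  unfolding simplicial_chains_def by (auto simp: in_keys_iff)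

lemma simplicial_chains_mono: "K \<subseteq> L \<Longrightarrow> simplicial_chains p K \<subseteq> simplicial_chains p L"
  unfolding simplicial_chains_def by auto

lemma triangle_chain_in_simplicial_chains:
  assumes "{x, y, z} \<in> K"
  shows "triangle_chain g x y z \<in> simplicial_chains 2 K"
proof (cases "distinct [x, y, z]")
  case False
  then consider "x = y" | "x = z" | "y = z" by auto
  then show ?thesis by cases (auto simp: simplicial_chains_0)
next
  case True
  let ?c = "triangle_chain g x y z"
  have keys: "distinct w \<and> length w = Suc 2 \<and> set w \<in> K" if "w \<in> Poly_Mapping.keys ?c" for w
  proof -
    have "w \<in> {[x,y,z],[y,z,x],[z,x,y],[y,x,z],[x,z,y],[z,y,x]}"
      using that unfolding triangle_chain_def in_keys_iff
      by (auto simp: lookup_add lookup_minus lookup_single when_def split: if_splits)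
    then show ?thesis
      using True assms by (auto simp: insert_commute)
  qed
  \<comment> \<open>Off the lists of length three both sides vanish; on them there are only three transpositions.\<close>
  have alt: "Poly_Mapping.lookup ?c (w[i := w ! j, j := w ! i]) = - Poly_Mapping.lookup ?c w"
    if ij: "i < j" "j < length w" for w i j
  proof (cases "length w = 3")
    case False
    then have "length w \<noteq> Suc 2" "length (w[i := w ! j, j := w ! i]) \<noteq> Suc 2"
      by simp_all
    then have "w \<notin> Poly_Mapping.keys ?c" "w[i := w ! j, j := w ! i] \<notin> Poly_Mapping.keys ?c"
      using keys by blast+
    then show ?thesis by (simp add: in_keys_iff)
  next
    case True
    obtain p q r where w: "w = [p, q, r]"
      using True by (auto simp: numeral_3_eq_3 length_Suc_conv)
    have "(i = 0 \<and> j = 1) \<or> (i = 0 \<and> j = 2) \<or> (i = 1 \<and> j = 2)"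
      using ij w by auto
    then show ?thesis
      unfolding w triangle_chain_def
      by (elim disjE conjE) (simp_all add: lookup_add lookup_minus lookup_single when_def conj_ac)
  qed
  show ?thesis
    unfolding simplicial_chains_def using keys alt by auto
qed

subsection \<open>Polygonal chains and fans\<close>

fun polygon_chain :: "'g \<Rightarrow> 'a list \<Rightarrow> ('a, 'g::ab_group_add) simplicial_chain" where
  "polygon_chain g (x # y # xs) = edge_chain g x y + polygon_chain g (y # xs)"
| "polygon_chain g _ = 0"

fun fan_chain :: "'g \<Rightarrow> 'a \<Rightarrow> 'a list \<Rightarrow> ('a, 'g::ab_group_add) simplicial_chain" where
  "fan_chain g p (x # y # xs) = triangle_chain g p x y + fan_chain g p (y # xs)"
| "fan_chain g p _ = 0"

text \<open>Consecutive triangles of the fan share a spoke from \<open>p\<close>, which cancels.\<close>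

lemma boundary_fan_chain:
  "xs \<noteq> [] \<Longrightarrow> simplicial_boundary (fan_chain g p xs) =
     polygon_chain g xs + edge_chain g p (hd xs) - edge_chain g p (last xs)"
  by (induction g p xs rule: fan_chain.induct)
     (auto simp: simplicial_boundary_add boundary_triangle_chain simplicial_boundary_0)

lemma polygon_chain_append:
  "polygon_chain g (xs @ [m] @ ys) = polygon_chain g (xs @ [m]) + polygon_chain g (m # ys)"
proof (induction xs)
  case (Cons x xs)
  then show ?case by (cases xs) (auto simp: add.assoc)
qed simp

lemma polygon_chain_map_upt:
  "polygon_chain g (map f [0..<Suc n]) = (\<Sum>i<n. edge_chain g (f i) (f (Suc i)))"
proof (induction n)
  case (Suc n)
  have "map f [0..<Suc (Suc n)] = map f [0..<n] @ [f n] @ [f (Suc n)]" by simp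
  then have "polygon_chain g (map f [0..<Suc (Suc n)])
      = polygon_chain g (map f [0..<n] @ [f n]) + polygon_chain g [f n, f (Suc n)]"
    using polygon_chain_append[of g "map f [0..<n]" "f n" "[f (Suc n)]"] by simp
  then show ?case using Suc.IH by simp
qed simp

subsection \<open>Sums of triangles of a given kind\<close>

text \<open>Being a sum of oriented triangles of a given kind is stable under addition, unlike a condition on
  the keys of the sum, where terms may cancel.\<close>

inductive_set triangle_span :: "('a \<Rightarrow> 'a \<Rightarrow> 'a \<Rightarrow> bool) \<Rightarrow> ('a, 'g::ab_group_add) simplicial_chain set"
  for P :: "'a \<Rightarrow> 'a \<Rightarrow> 'a \<Rightarrow> bool" where
  zero: "0 \<in> triangle_span P"
| step: "t \<in> triangle_span P \<Longrightarrow> P x y z \<Longrightarrow> t + triangle_chain g x y z \<in> triangle_span P"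

lemma triangle_span_triangle: "P x y z \<Longrightarrow> triangle_chain g x y z \<in> triangle_span P"
  using triangle_span.step[OF triangle_span.zero, of P x y z g] by simp

lemma triangle_span_add: "t \<in> triangle_span P \<Longrightarrow> u \<in> triangle_span P \<Longrightarrow> u + t \<in> triangle_span P"
  by (induction rule: triangle_span.induct) (auto simp: triangle_span.step simp flip: add.assoc)

lemma triangle_span_minus: "t \<in> triangle_span P \<Longrightarrow> - t \<in> triangle_span P"
proof (induction rule: triangle_span.induct)
  case (step t x y z g)
  then have "- t + triangle_chain (- g) x y z \<in> triangle_span P" by (intro triangle_span.step)
  then show ?case by (simp add: Modules.additive.minus[OF additive_triangle_chain])
qed (simp add: triangle_span.zero)

lemma triangle_span_diff: "t \<in> triangle_span P \<Longrightarrow> u \<in> triangle_span P \<Longrightarrow> u - t \<in> triangle_span P"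
  using triangle_span_add[OF triangle_span_minus] by fastforce

lemma triangle_span_sum:
  "(\<And>i. i \<in> I \<Longrightarrow> f i \<in> triangle_span P) \<Longrightarrow> (\<Sum>i\<in>I. f i) \<in> triangle_span P"
  by (induction I rule: infinite_finite_induct) (auto simp: triangle_span.zero triangle_span_add)

lemma triangle_span_mono:
  assumes "\<And>x y z. P x y z \<Longrightarrow> Q x y z" "t \<in> triangle_span P"
  shows "t \<in> triangle_span Q"
  using assms(2) by (induction rule: triangle_span.induct) (auto intro: triangle_span.intros assms(1))

lemma triangle_span_simplicial_chains:
  assumes "\<And>x y z. P x y z \<Longrightarrow> {x, y, z} \<in> K" "t \<in> triangle_span P"
  shows "t \<in> simplicial_chains 2 K"
  using assms(2) by (induction rule: triangle_span.induct)
    (auto intro: simplicial_chains_0 simplicial_chains_add triangle_chain_in_simplicial_chains assms(1))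

lemma additive_triangle_span_eq_0:
  assumes "Modules.additive F" "\<And>g x y z. P x y z \<Longrightarrow> F (triangle_chain g x y z) = 0" "t \<in> triangle_span P"
  shows "F t = 0"
  using assms(3) by (induction rule: triangle_span.induct)
    (auto simp: Modules.additive.zero[OF assms(1)] Modules.additive.add[OF assms(1)] assms(2))

section \<open>Singular chains with coefficients\<close>

lemma singular_gboundary_lin_ext:
  "singular_gboundary (Suc p) = lin_ext (\<lambda>f g. \<Sum>k\<le>Suc p.
     Poly_Mapping.single (singular_face (Suc p) k f) (if even k then g else - g))"
  by (rule ext) (simp add: singular_gboundary_def lin_ext_def)

lemma additive_singular_gboundary_term:
  "Modules.additive (\<lambda>g. \<Sum>k\<le>n. Poly_Mapping.single (F k) (if even k then g else - g))"
  by (intro additive_sum additive_compose[OF additive_single] additive_If additive_uminus additive_id)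

lemma additive_singular_gboundary: "Modules.additive (singular_gboundary p)"
proof (cases p)
  case 0
  then show ?thesis by (simp add: singular_gboundary_def[abs_def] Modules.additive_def)
next
  case (Suc q)
  show ?thesis
    unfolding Suc singular_gboundary_lin_ext
    by (intro additive_lin_ext additive_singular_gboundary_term)
qed

lemma singular_gboundary_single:
  "singular_gboundary (Suc p) (Poly_Mapping.single f g) =
     (\<Sum>k\<le>Suc p. Poly_Mapping.single (singular_face (Suc p) k f) (if even k then g else - g))"
  unfolding singular_gboundary_lin_ext
  by (rule lin_ext_single) (rule additive_singular_gboundary_term)

lemma singular_gboundary_1_single:
  "singular_gboundary 1 (Poly_Mapping.single f g) =
     Poly_Mapping.single (singular_face 1 0 f) g - Poly_Mapping.single (singular_face 1 1 f) g"
  using singular_gboundary_single[of 0 f g] by (simp add: single_uminus)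

lemma singular_gboundary_2_single:
  "singular_gboundary 2 (Poly_Mapping.single f g) =
     Poly_Mapping.single (singular_face 2 0 f) g - Poly_Mapping.single (singular_face 2 1 f) g
     + Poly_Mapping.single (singular_face 2 2 f) g"
  using singular_gboundary_single[of 1 f g]
  by (simp add: single_uminus numeral_2_eq_2)

lemma singular_gchains_0: "0 \<in> singular_gchains p X"
  by (simp add: singular_gchains_def)

lemma singular_gchains_single: "singular_simplex p X f \<Longrightarrow> Poly_Mapping.single f g \<in> singular_gchains p X"
  by (auto simp: singular_gchains_def)

lemma singular_gchains_add:
  "c \<in> singular_gchains p X \<Longrightarrow> d \<in> singular_gchains p X \<Longrightarrow> c + d \<in> singular_gchains p X"
  using Poly_Mapping.keys_add[of c d] unfolding singular_gchains_def by blast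

lemma singular_gchains_minus: "c \<in> singular_gchains p X \<Longrightarrow> - c \<in> singular_gchains p X"
  unfolding singular_gchains_def by simp

lemma singular_gchains_sum:
  "(\<And>i. i \<in> I \<Longrightarrow> f i \<in> singular_gchains p X) \<Longrightarrow> (\<Sum>i\<in>I. f i) \<in> singular_gchains p X"
  by (induction I rule: infinite_finite_induct) (auto simp: singular_gchains_0 singular_gchains_add)

text \<open>Inserting zeros at two positions of the barycentric coordinates can be done in either order.\<close>

lemma singular_face_face:
  assumes "i \<le> j" "j \<le> 1"
  shows "singular_face 1 i (singular_face 2 (Suc j) f) = singular_face 1 j (singular_face 2 i f)"
proof
  fix t
  show "singular_face 1 i (singular_face 2 (Suc j) f) t = singular_face 1 j (singular_face 2 i f) t"
  proof (cases "t \<in> standard_simplex 0")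
    case True
    have fi: "simplical_face i t \<in> standard_simplex 1" and fj: "simplical_face j t \<in> standard_simplex 1"
      using simplical_face_in_standard_simplex[of 1 _ t] True assms by auto
    have "simplical_face (Suc j) (simplical_face i t) = simplical_face i (simplical_face j t)"
      using assms by (auto simp: simplical_face_def fun_eq_iff)
    then show ?thesis using True fi fj by (simp add: singular_face_def)
  qed (simp add: singular_face_def)
qed

lemma singular_gboundary_gboundary:
  "singular_gboundary 1 (singular_gboundary 2 c) = 0"
proof (rule additive_eq_on_keys[where c = c and F = "\<lambda>c. singular_gboundary 1 (singular_gboundary 2 c)" and G = "\<lambda>_. 0"])
  show "Modules.additive (\<lambda>c. singular_gboundary 1 (singular_gboundary 2 c))"
    by (rule additive_compose[OF additive_singular_gboundary additive_singular_gboundary])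
  show "Modules.additive (\<lambda>_. 0)" by (rule additive_zero)
  fix f :: "(nat \<Rightarrow> real) \<Rightarrow> 'a" and g :: 'b
  note add = Modules.additive.add[OF additive_singular_gboundary]
    and diff = Modules.additive.diff[OF additive_singular_gboundary]
  have "singular_face 1 0 (singular_face 2 1 f) = singular_face 1 0 (singular_face 2 0 f)"
    "singular_face 1 0 (singular_face 2 2 f) = singular_face 1 1 (singular_face 2 0 f)"
    "singular_face 1 1 (singular_face 2 2 f) = singular_face 1 1 (singular_face 2 1 f)"
    using singular_face_face[of 0 0 f] singular_face_face[of 0 1 f] singular_face_face[of 1 1 f]
    by (simp_all add: numeral_2_eq_2)
  then show "singular_gboundary 1 (singular_gboundary 2 (Poly_Mapping.single f g)) = 0"
    unfolding singular_gboundary_2_single add diff singular_gboundary_1_single by simp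
qed

lemma singular_gboundary_in_gchains:
  assumes "c \<in> singular_gchains 2 X"
  shows "singular_gboundary 2 c \<in> singular_gchains 1 X"
proof -
  have "singular_gboundary 2 c = (\<Sum>f\<in>Poly_Mapping.keys c. \<Sum>k\<le>2. Poly_Mapping.single (singular_face 2 k f)
               (if even k then Poly_Mapping.lookup c f else - Poly_Mapping.lookup c f))"
    by (simp add: singular_gboundary_def)
  also have "\<dots> \<in> singular_gchains 1 X"
  proof (intro singular_gchains_sum singular_gchains_single)
    fix f k assume "f \<in> Poly_Mapping.keys c" "k \<in> {..2::nat}"
    then show "singular_simplex 1 X (singular_face 2 k f)"
      using assms singular_simplex_singular_face[of 2 X f k] by (auto simp: singular_gchains_def)
  qed
  finally show ?thesis .
qed

subsection \<open>Equality of sums of classes\<close>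

lemma additive_group_simps [simp]:
  "carrier (additive_group S) = S" "x \<otimes>\<^bsub>additive_group S\<^esub> y = x + y" "\<one>\<^bsub>additive_group S\<^esub> = 0"
  by (simp_all add: additive_group_def)

lemma comm_group_additive_group:
  assumes "0 \<in> S" "\<And>x y. x \<in> S \<Longrightarrow> y \<in> S \<Longrightarrow> x + y \<in> S" "\<And>x. x \<in> S \<Longrightarrow> - x \<in> S"
  shows "comm_group (additive_group S)"
  by (rule comm_groupI) (use assms in \<open>auto simp: ac_simps intro: bexI[of _ "- x" for x]\<close>)

lemma normal_additive_group:
  assumes "0 \<in> S" "\<And>x y. x \<in> S \<Longrightarrow> y \<in> S \<Longrightarrow> x + y \<in> S" "\<And>x. x \<in> S \<Longrightarrow> - x \<in> S"
    and "N \<subseteq> S" "0 \<in> N" "\<And>x y. x \<in> N \<Longrightarrow> y \<in> N \<Longrightarrow> x + y \<in> N" "\<And>x. x \<in> N \<Longrightarrow> - x \<in> N"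
  shows "N \<lhd> additive_group S"
proof -
  interpret comm_group "additive_group S"
    by (rule comm_group_additive_group) (use assms in auto)
  have "subgroup N (additive_group S)"
  proof (rule subgroupI)
    fix x assume "x \<in> N"
    then have "inv\<^bsub>additive_group S\<^esub> x = - x"
      using assms by (intro inv_equality) auto
    then show "inv\<^bsub>additive_group S\<^esub> x \<in> N" using \<open>x \<in> N\<close> assms by simp
  qed (use assms in auto)
  then show ?thesis by (rule subgroup_imp_normal)
qed

text \<open>The quotient map turns sums into products. That the sum stays in \<open>S\<close> is carried along because the
  induction multiplies by its coset.\<close>

lemma finprod_cosets:
  fixes z :: "'i \<Rightarrow> 'c::ab_group_add"
  assumes "comm_group (additive_group S)" "N \<lhd> additive_group S"
    and "finite I" "\<And>i. i \<in> I \<Longrightarrow> z i \<in> S"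
  shows "finprod (additive_group S Mod N) (\<lambda>i. N #>\<^bsub>additive_group S\<^esub> z i) I = N #>\<^bsub>additive_group S\<^esub> (\<Sum>i\<in>I. z i)
    \<and> (\<Sum>i\<in>I. z i) \<in> S"
proof -
  interpret A: comm_group "additive_group S" by fact
  interpret N: normal N "additive_group S" by fact
  have Q: "comm_group (additive_group S Mod N)"
  proof (rule group.group_comm_groupI[OF N.factorgroup_is_group])
    fix X Y assume "X \<in> carrier (additive_group S Mod N)" "Y \<in> carrier (additive_group S Mod N)"
    then obtain x y where xy: "x \<in> S" "y \<in> S" "X = N #>\<^bsub>additive_group S\<^esub> x" "Y = N #>\<^bsub>additive_group S\<^esub> y"
      by (auto simp: carrier_FactGroup)
    then show "X \<otimes>\<^bsub>additive_group S Mod N\<^esub> Y = Y \<otimes>\<^bsub>additive_group S Mod N\<^esub> X"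
      by (simp add: N.rcos_sum add.commute)
  qed
  interpret Q: comm_group "additive_group S Mod N" by (rule Q)
  show ?thesis
    using assms(3,4)
  proof (induction I rule: finite_induct)
    case empty
    show ?case using A.coset_mult_one[of N] N.subset A.one_closed by simp
  next
    case (insert i I)
    have "finprod (additive_group S Mod N) (\<lambda>i. N #>\<^bsub>additive_group S\<^esub> z i) (insert i I)
        = (N #>\<^bsub>additive_group S\<^esub> z i) \<otimes>\<^bsub>additive_group S Mod N\<^esub>
          finprod (additive_group S Mod N) (\<lambda>i. N #>\<^bsub>additive_group S\<^esub> z i) I"
      using insert by (intro Q.finprod_insert) (auto simp: carrier_FactGroup)
    also have "\<dots> = N #>\<^bsub>additive_group S\<^esub> (z i + (\<Sum>i\<in>I. z i))"
      using insert N.rcos_sum[of "z i" "\<Sum>i\<in>I. z i"] by simp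
    finally show ?case using insert A.m_closed[of "z i" "\<Sum>i\<in>I. z i"] by simp
  qed
qed

lemma singular_simplex_path_simplex:
  assumes "path p"
  shows "singular_simplex 1 euclidean (path_simplex p)"
proof -
  have "continuous_on (standard_simplex 1) (\<lambda>x. p (x 1))"
  proof (rule continuous_on_compose2[of "{0..1}" p])
    show "continuous_on {0..1} p" using assms by (simp add: path_def)
    show "continuous_on (standard_simplex 1) (\<lambda>x. x (1::nat) :: real)"
      by (intro continuous_on_coordinatewise_then_product continuous_on_product_coordinates continuous_on_subset[OF continuous_on_product_coordinates] subset_UNIV)
    show "(\<lambda>x. x 1) ` standard_simplex 1 \<subseteq> {0..1}"
      by (auto simp: standard_simplex_def)
  qed
  then have "continuous_map (subtopology (powertop_real UNIV) (standard_simplex 1)) euclidean (path_simplex p)"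
    unfolding path_simplex_def euclidean_product_topology
    by (subst continuous_map_eq) (auto simp: continuous_map_subtopology_eu intro: continuous_map_eq)
  then show ?thesis
    by (simp add: singular_simplex_def path_simplex_def)
qed

lemma singular_gboundary_loop:
  assumes "is_loop p"
  shows "singular_gboundary 1 (Poly_Mapping.single (path_simplex p) g) = 0"
proof -
  have "singular_face 1 0 (path_simplex p) = singular_face 1 1 (path_simplex p)"
  proof
    fix t :: "nat \<Rightarrow> real"
    show "singular_face 1 0 (path_simplex p) t = singular_face 1 1 (path_simplex p) t"
    proof (cases "t \<in> standard_simplex 0")
      case True
      then have t: "t = (\<lambda>j. if j = 0 then 1 else 0)" by (simp add: standard_simplex_0)
      have in1: "simplical_face k t \<in> standard_simplex 1" if "k \<le> 1" for k
        using simplical_face_in_standard_simplex[of 1 k t] True that by auto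
      have "simplical_face 0 t 1 = 1" "simplical_face 1 t 1 = 0" by (auto simp: simplical_face_def t)
      then show ?thesis
        using in1[of 0] in1[of 1] True assms
        by (simp add: singular_face_def path_simplex_def is_loop_def pathstart_def pathfinish_def)
    qed (simp add: singular_face_def)
  qed
  then show ?thesis unfolding singular_gboundary_1_single by simp
qed

text \<open>Two cycles have the same coset exactly when they differ by a boundary; this extracts the singular
  two-chain behind an equation between homology classes of loops.\<close>

lemma loop_class_eq_finprod:
  fixes \<beta> :: "nat \<Rightarrow> real \<Rightarrow> 'a::metric_space" and g :: "nat \<Rightarrow> 'g::ab_group_add"
  assumes loops: "is_loop \<alpha>" "\<And>i. i \<in> I \<Longrightarrow> is_loop (\<beta> i)" and "finite I"
    and eq: "loop_class h \<alpha> = finprod (singular_ghomology 1 euclidean) (\<lambda>i. loop_class (g i) (\<beta> i)) I"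
  obtains c where "c \<in> singular_gchains 2 (euclidean :: 'a topology)"
    "singular_gboundary 2 c = Poly_Mapping.single (path_simplex \<alpha>) h - (\<Sum>i\<in>I. Poly_Mapping.single (path_simplex (\<beta> i)) (g i))"
proof -
  let ?E = "euclidean :: 'a topology"
  define Z :: "('a, 'g) singular_gchain set" where "Z = {c \<in> singular_gchains 1 ?E. singular_gboundary 1 c = 0}"
  define B :: "('a, 'g) singular_gchain set" where "B = singular_gboundaries 1 ?E"
  note add = Modules.additive.add[OF additive_singular_gboundary]
    and minus = Modules.additive.minus[OF additive_singular_gboundary]
    and zero = Modules.additive.zero[OF additive_singular_gboundary]
  have B_eq: "B = singular_gboundary 2 ` singular_gchains 2 ?E"
    by (simp add: B_def singular_gboundaries_def numeral_2_eq_2)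
  have Z: "0 \<in> Z" "\<And>x y. x \<in> Z \<Longrightarrow> y \<in> Z \<Longrightarrow> x + y \<in> Z" "\<And>x. x \<in> Z \<Longrightarrow> - x \<in> Z"
    by (auto simp: Z_def add minus zero singular_gchains_0 singular_gchains_add singular_gchains_minus)
  have B: "B \<subseteq> Z" "0 \<in> B" "\<And>x y. x \<in> B \<Longrightarrow> y \<in> B \<Longrightarrow> x + y \<in> B" "\<And>x. x \<in> B \<Longrightarrow> - x \<in> B"
  proof -
    show "B \<subseteq> Z"
      unfolding B_eq Z_def using singular_gboundary_gboundary singular_gboundary_in_gchains by blast
    show "0 \<in> B" unfolding B_eq by (rule image_eqI[of _ _ 0]) (simp_all add: zero singular_gchains_0)
    show "x + y \<in> B" if "x \<in> B" "y \<in> B" for x y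
      using that unfolding B_eq by (auto simp flip: add intro!: imageI singular_gchains_add)
    show "- x \<in> B" if "x \<in> B" for x
      using that unfolding B_eq by (auto simp flip: minus intro!: imageI singular_gchains_minus)
  qed
  have cycle: "Poly_Mapping.single (path_simplex p) h \<in> Z" if "is_loop p" for p and h :: 'g
    using that singular_gboundary_loop singular_simplex_path_simplex
    by (auto simp: Z_def is_loop_def intro!: singular_gchains_single)
  have cls: "loop_class h p = B #>\<^bsub>additive_group Z\<^esub> Poly_Mapping.single (path_simplex p) h" for h :: 'g and p
    by (simp add: loop_class_def singular_gclass_def singular_gcycle_group_def B_def Z_def)
  have hom: "singular_ghomology 1 ?E = additive_group Z Mod B"
    by (simp add: singular_ghomology_def singular_gcycle_group_def B_def Z_def)
  let ?s = "\<Sum>i\<in>I. Poly_Mapping.single (path_simplex (\<beta> i)) (g i)"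
  have "B #>\<^bsub>additive_group Z\<^esub> Poly_Mapping.single (path_simplex \<alpha>) h = B #>\<^bsub>additive_group Z\<^esub> ?s"
    using finprod_cosets[OF comm_group_additive_group[OF Z] normal_additive_group[OF Z B] \<open>finite I\<close>, of "\<lambda>i. Poly_Mapping.single (path_simplex (\<beta> i)) (g i)"]
      cycle loops(2) eq unfolding cls hom by simp
  moreover have "Poly_Mapping.single (path_simplex \<alpha>) h \<in> B #>\<^bsub>additive_group Z\<^esub> Poly_Mapping.single (path_simplex \<alpha>) h"
    using B(2) by (auto simp: r_coset_def intro!: bexI[of _ 0])
  ultimately obtain b where "b \<in> B" "Poly_Mapping.single (path_simplex \<alpha>) h = b + ?s"
    by (auto simp: r_coset_def)
  then show ?thesis
    using that unfolding B_eq by (auto simp: algebra_simps)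
qed

section \<open>From singular to simplicial chains\<close>

text \<open>Barycentric coordinates of the points that divide the standard edge and triangle into \<open>N\<close> and
  \<open>N * N\<close> equal parts. The coordinate of index 0 is the dependent one, so that each face map
  carries the points of the edge to the points of the grid on a side.\<close>

definition edge_point :: "nat \<Rightarrow> nat \<Rightarrow> nat \<Rightarrow> real" where
  "edge_point N i = (\<lambda>k. if k = 0 then 1 - i / N else if k = 1 then i / N else 0)"

definition grid_point :: "nat \<Rightarrow> nat \<Rightarrow> nat \<Rightarrow> nat \<Rightarrow> real" where
  "grid_point N i j = (\<lambda>k. if k = 0 then 1 - (i / N + j / N) else if k = 1 then i / N else if k = 2 then j / N else 0)"

definition subdivided_edge :: "nat \<Rightarrow> ((nat \<Rightarrow> real) \<Rightarrow> 'a) \<Rightarrow> 'g \<Rightarrow> ('a, 'g::ab_group_add) simplicial_chain" where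
  "subdivided_edge N f g = (\<Sum>i<N. edge_chain g (f (edge_point N i)) (f (edge_point N (Suc i))))"

text \<open>The two kinds of triangles of the edgewise subdivision, ordered by diagonals \<open>i + j = n\<close>.\<close>

definition subdivided_triangle :: "nat \<Rightarrow> ((nat \<Rightarrow> real) \<Rightarrow> 'a) \<Rightarrow> 'g \<Rightarrow> ('a, 'g::ab_group_add) simplicial_chain" where
  "subdivided_triangle N f g =
     (\<Sum>n<N. \<Sum>i\<le>n. triangle_chain g (f (grid_point N i (n - i))) (f (grid_point N (Suc i) (n - i))) (f (grid_point N i (Suc (n - i)))))
   + (\<Sum>n<N - 1. \<Sum>i\<le>n. triangle_chain g (f (grid_point N (Suc i) (n - i))) (f (grid_point N (Suc i) (Suc (n - i)))) (f (grid_point N i (Suc (n - i)))))"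

text \<open>Each inner edge of the grid is a side of exactly one triangle of either kind.\<close>

lemma grid_telescope:
  fixes H V D :: "nat \<Rightarrow> nat \<Rightarrow> 'b::ab_group_add"
  shows "(\<Sum>n<N. \<Sum>i\<le>n. D i (n - i) - V i (n - i) + H i (n - i))
       + (\<Sum>n<N - 1. \<Sum>i\<le>n. - H i (Suc (n - i)) - D i (n - i) + V (Suc i) (n - i))
       = (\<Sum>i<N. D i (N - 1 - i)) - (\<Sum>j<N. V 0 j) + (\<Sum>i<N. H i 0)"
proof (induction N)
  case (Suc N)
  show ?case
  proof (cases N)
    case 0
    then show ?thesis by simp
  next
    case (Suc M)
    have cancel: "(D0 - v0 + h0) + (D1 - (Vn + vm) + (hm + Hn)) + (- hm - D0 + vm) = D1 - (v0 + Vn) + (h0 + Hn)"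
      for D0 v0 h0 D1 Vn vm hm Hn :: 'b
      by (simp add: algebra_simps)
    have h: "(\<Sum>i\<le>N. H i (N - i)) = (\<Sum>i\<le>M. H i (Suc (M - i))) + H N 0"
      unfolding Suc by (simp add: Suc_diff_le)
    have v: "(\<Sum>i\<le>N. V i (N - i)) = V 0 N + (\<Sum>i\<le>M. V (Suc i) (M - i))"
      unfolding Suc by (subst sum.atMost_Suc_shift) simp
    have d: "(\<Sum>i\<le>M. D i (M - i)) = (\<Sum>i<N. D i (N - 1 - i))"
      unfolding Suc lessThan_Suc_atMost by simp
    have d': "(\<Sum>i\<le>N. D i (N - i)) = (\<Sum>i<Suc N. D i (Suc N - 1 - i))"
      unfolding lessThan_Suc_atMost by simp
    have "(\<Sum>n<Suc N. \<Sum>i\<le>n. D i (n - i) - V i (n - i) + H i (n - i))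
       + (\<Sum>n<Suc N - 1. \<Sum>i\<le>n. - H i (Suc (n - i)) - D i (n - i) + V (Suc i) (n - i))
      = ((\<Sum>n<N. \<Sum>i\<le>n. D i (n - i) - V i (n - i) + H i (n - i))
       + (\<Sum>n<N - 1. \<Sum>i\<le>n. - H i (Suc (n - i)) - D i (n - i) + V (Suc i) (n - i)))
       + ((\<Sum>i\<le>N. D i (N - i)) - (\<Sum>i\<le>N. V i (N - i)) + (\<Sum>i\<le>N. H i (N - i)))
       + (- (\<Sum>i\<le>M. H i (Suc (M - i))) - (\<Sum>i\<le>M. D i (M - i)) + (\<Sum>i\<le>M. V (Suc i) (M - i)))"
      using Suc by (simp add: sum.distrib sum_subtractf sum_negf algebra_simps del: sum.atMost_Suc)
    also have "\<dots> = ((\<Sum>i<N. D i (N - 1 - i)) - (\<Sum>j<N. V 0 j) + (\<Sum>i<N. H i 0))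
       + ((\<Sum>i<Suc N. D i (Suc N - 1 - i)) - (V 0 N + (\<Sum>i\<le>M. V (Suc i) (M - i))) + ((\<Sum>i\<le>M. H i (Suc (M - i))) + H N 0))
       + (- (\<Sum>i\<le>M. H i (Suc (M - i))) - (\<Sum>i<N. D i (N - 1 - i)) + (\<Sum>i\<le>M. V (Suc i) (M - i)))"
      unfolding Suc.IH h v d d' ..
    also have "\<dots> = (\<Sum>i<Suc N. D i (Suc N - 1 - i)) - ((\<Sum>j<N. V 0 j) + V 0 N) + ((\<Sum>i<N. H i 0) + H N 0)"
      by (rule cancel)
    also have "\<dots> = (\<Sum>i<Suc N. D i (Suc N - 1 - i)) - (\<Sum>j<Suc N. V 0 j) + (\<Sum>i<Suc N. H i 0)"
      by (simp only: sum.lessThan_Suc)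
    finally show ?thesis .
  qed
qed simp

lemma edge_point_in_simplex: "i \<le> N \<Longrightarrow> N > 0 \<Longrightarrow> edge_point N i \<in> standard_simplex 1"
  by (auto simp: standard_simplex_def edge_point_def divide_simps)

lemma singular_face_edge_point:
  assumes "i \<le> N" "N > 0"
  shows "singular_face 2 0 f (edge_point N i) = f (grid_point N (N - i) i)"
    "singular_face 2 1 f (edge_point N i) = f (grid_point N 0 i)"
    "singular_face 2 2 f (edge_point N i) = f (grid_point N i 0)"
proof -
  have in1: "edge_point N i \<in> standard_simplex (2 - Suc 0)"
    using edge_point_in_simplex[OF assms] by simp
  have "simplical_face 0 (edge_point N i) = grid_point N (N - i) i"
    using assms by (auto simp: simplical_face_def edge_point_def grid_point_def fun_eq_iff field_simps of_nat_diff)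
  moreover have "simplical_face 1 (edge_point N i) = grid_point N 0 i"
    using assms by (auto simp: simplical_face_def edge_point_def grid_point_def fun_eq_iff)
  moreover have "simplical_face 2 (edge_point N i) = grid_point N i 0"
    using assms by (auto simp: simplical_face_def edge_point_def grid_point_def fun_eq_iff)
  ultimately show "singular_face 2 0 f (edge_point N i) = f (grid_point N (N - i) i)"
    "singular_face 2 1 f (edge_point N i) = f (grid_point N 0 i)"
    "singular_face 2 2 f (edge_point N i) = f (grid_point N i 0)"
    using in1 by (simp_all add: singular_face_def)
qed

text \<open>The inner edges of the grid cancel, and the remaining ones subdivide the three sides.\<close>

lemma boundary_subdivided_triangle:
  assumes "N > 0"
  shows "simplicial_boundary (subdivided_triangle N f g) =
     subdivided_edge N (singular_face 2 0 f) g - subdivided_edge N (singular_face 2 1 f) g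
     + subdivided_edge N (singular_face 2 2 f) g"
proof -
  let ?P = "\<lambda>i j. f (grid_point N i j)"
  define H where "H i j = edge_chain g (?P i j) (?P (Suc i) j)" for i j
  define V where "V i j = edge_chain g (?P i j) (?P i (Suc j))" for i j
  define D where "D i j = edge_chain g (?P (Suc i) j) (?P i (Suc j))" for i j
  have up: "simplicial_boundary (triangle_chain g (?P i (n - i)) (?P (Suc i) (n - i)) (?P i (Suc (n - i))))
      = D i (n - i) - V i (n - i) + H i (n - i)" for i n
    by (simp add: boundary_triangle_chain H_def V_def D_def)
  have down: "simplicial_boundary (triangle_chain g (?P (Suc i) (n - i)) (?P (Suc i) (Suc (n - i))) (?P i (Suc (n - i))))
      = - H i (Suc (n - i)) - D i (n - i) + V (Suc i) (n - i)" for i n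
    unfolding boundary_triangle_chain H_def V_def D_def
    by (simp add: edge_chain_swap[of g "?P (Suc i) (Suc (n - i))" "?P i (Suc (n - i))"])
  have "simplicial_boundary (subdivided_triangle N f g) =
      (\<Sum>i<N. D i (N - 1 - i)) - (\<Sum>j<N. V 0 j) + (\<Sum>i<N. H i 0)"
    unfolding subdivided_triangle_def simplicial_boundary_add simplicial_boundary_sum up down
    by (rule grid_telescope)
  moreover have "(\<Sum>j<N. V 0 j) = subdivided_edge N (singular_face 2 1 f) g"
    unfolding subdivided_edge_def V_def using assms
    by (intro sum.cong refl) (simp add: singular_face_edge_point del: One_nat_def)
  moreover have "(\<Sum>i<N. H i 0) = subdivided_edge N (singular_face 2 2 f) g"
    unfolding subdivided_edge_def H_def using assms
    by (intro sum.cong refl) (simp add: singular_face_edge_point)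
  moreover have "(\<Sum>i<N. D i (N - 1 - i)) = subdivided_edge N (singular_face 2 0 f) g"
  proof -
    have "(\<Sum>i<N. D i (N - 1 - i)) = (\<Sum>i<N. D (N - 1 - i) i)"
      using sum.nat_diff_reindex[of "\<lambda>i. D (N - 1 - i) i" N]
      by (simp add: Suc_diff_Suc)
    also have "\<dots> = subdivided_edge N (singular_face 2 0 f) g"
      unfolding subdivided_edge_def D_def
    proof (rule sum.cong[OF refl])
      fix i assume "i \<in> {..<N}"
      then have i: "i < N" by simp
      then have "Suc (N - 1 - i) = N - i" "N - 1 - i = N - Suc i" by auto
      then show "edge_chain g (f (grid_point N (Suc (N - 1 - i)) i)) (f (grid_point N (N - 1 - i) (Suc i)))
        = edge_chain g (singular_face 2 0 f (edge_point N i)) (singular_face 2 0 f (edge_point N (Suc i)))"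
        using singular_face_edge_point(1)[of i N f] singular_face_edge_point(1)[of "Suc i" N f] i by simp
    qed
    finally show ?thesis .
  qed
  ultimately show ?thesis by simp
qed

lemma additive_subdivided_edge: "Modules.additive (subdivided_edge N f)"
  unfolding subdivided_edge_def[abs_def] by (intro additive_sum additive_edge_chain)

lemma additive_subdivided_triangle: "Modules.additive (subdivided_triangle N f)"
  unfolding subdivided_triangle_def[abs_def]
  by (intro additive_plus additive_sum additive_triangle_chain)

text \<open>Since equal faces are subdivided in the same way, a singular chain bounding a combination of loops
  becomes a simplicial chain bounding the corresponding combination of polygons.\<close>

lemma boundary_subdivided_chain:
  assumes "N > 0"
  shows "simplicial_boundary (lin_ext (subdivided_triangle N) c) = lin_ext (subdivided_edge N) (singular_gboundary 2 c)"
proof (rule additive_eq_on_keys[where c = c and F = "\<lambda>c. simplicial_boundary (lin_ext (subdivided_triangle N) c)"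
      and G = "\<lambda>c. lin_ext (subdivided_edge N) (singular_gboundary 2 c)"])
  note E = additive_lin_ext[where f = "subdivided_edge N", OF additive_subdivided_edge]
  show "Modules.additive (\<lambda>c. simplicial_boundary (lin_ext (subdivided_triangle N) c))"
    by (rule additive_compose[OF additive_simplicial_boundary additive_lin_ext[OF additive_subdivided_triangle]])
  show "Modules.additive (\<lambda>c. lin_ext (subdivided_edge N) (singular_gboundary 2 c))"
    by (rule additive_compose[OF E additive_singular_gboundary])
  fix f :: "(nat \<Rightarrow> real) \<Rightarrow> 'a" and g :: 'b
  show "simplicial_boundary (lin_ext (subdivided_triangle N) (Poly_Mapping.single f g)) =
      lin_ext (subdivided_edge N) (singular_gboundary 2 (Poly_Mapping.single f g))"
    unfolding singular_gboundary_2_single lin_ext_single[OF additive_subdivided_triangle]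
      boundary_subdivided_triangle[OF assms] Modules.additive.add[OF E] Modules.additive.diff[OF E]
      lin_ext_single[OF additive_subdivided_edge] ..
qed

lemma subdivided_edge_path_simplex:
  assumes "N > 0"
  shows "subdivided_edge N (path_simplex p) g = polygon_chain g (map (\<lambda>i. p (real i / real N)) [0..<Suc N])"
proof -
  have "path_simplex p (edge_point N i) = p (real i / real N)" if "i \<le> N" for i
    using edge_point_in_simplex[OF that assms] by (simp add: path_simplex_def) (simp add: edge_point_def)
  then show ?thesis
    unfolding polygon_chain_map_upt subdivided_edge_def by (intro sum.cong refl) simp
qed

text \<open>A singular simplex is uniformly continuous in its two free barycentric coordinates, and neighbouring grid
  points differ by at most \<open>1 / N\<close> in each of them.\<close>

lemma grid_mesh:
  fixes f :: "(nat \<Rightarrow> real) \<Rightarrow> 'a::metric_space"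
  assumes "singular_simplex 2 euclidean f" "\<epsilon> > 0"
  shows "\<forall>\<^sub>F N in sequentially. \<forall>i j i' j'. i + j \<le> N \<longrightarrow> i' + j' \<le> N \<longrightarrow>
      i \<le> Suc i' \<longrightarrow> i' \<le> Suc i \<longrightarrow> j \<le> Suc j' \<longrightarrow> j' \<le> Suc j \<longrightarrow>
      dist (f (grid_point N i j)) (f (grid_point N i' j')) < \<epsilon>"
proof -
  define bary where "bary = (\<lambda>(s, t). (\<lambda>k. if k = 0 then 1 - (s + t) else if k = 1 then s else if k = (2::nat) then t else 0 :: real))"
  define T where "T = ({0..1} \<times> {0..1}) \<inter> {q :: real \<times> real. fst q + snd q \<le> 1}"
  have "compact T"
    unfolding T_def by (intro compact_Int_closed compact_Times closed_Collect_le continuous_intros) auto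
  have "continuous_on T bary"
  proof (rule continuous_on_coordinatewise_then_product)
    fix k :: nat
    consider "k = 0" | "k = 1" | "k = 2" | "k > 2" by linarith
    then show "continuous_on T (\<lambda>x. bary x k)"
      unfolding bary_def case_prod_beta by cases (simp_all add: continuous_intros)
  qed
  moreover have "bary ` T \<subseteq> standard_simplex 2"
    by (auto simp: T_def bary_def standard_simplex_def numeral_2_eq_2)
  moreover have "continuous_on (standard_simplex 2) f"
    using assms(1) unfolding singular_simplex_def euclidean_product_topology by simp
  ultimately have "continuous_on T (\<lambda>q. f (bary q))"
    using continuous_on_compose2[of "standard_simplex 2" f T bary] by blast
  then have "uniformly_continuous_on T (\<lambda>q. f (bary q))"
    using \<open>compact T\<close> by (rule compact_uniformly_continuous)
  then obtain d where d: "d > 0" "\<And>q r. \<lbrakk>q \<in> T; r \<in> T; dist r q < d\<rbrakk> \<Longrightarrow> dist (f (bary r)) (f (bary q)) < \<epsilon>"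
    unfolding uniformly_continuous_on_def using assms(2) by blast
  obtain N0 :: nat where N0: "N0 > 2 / d" using reals_Archimedean2 by blast
  show ?thesis
  proof (rule eventually_sequentiallyI[of "Suc N0"], intro allI impI)
    fix N i j i' j' :: nat
    assume N: "Suc N0 \<le> N" and ij: "i + j \<le> N" "i' + j' \<le> N" "i \<le> Suc i'" "i' \<le> Suc i" "j \<le> Suc j'" "j' \<le> Suc j"
    have "2 / d < N" using N0 N by linarith
    moreover have "real N > 0" using N by simp
    ultimately have small: "2 / N < d" using d(1) by (simp add: field_simps)
    have grid: "grid_point N i j = bary (i / N, j / N)" for i j
      by (simp add: grid_point_def bary_def)
    have inT: "(real i / N, real j / N) \<in> T" if "i + j \<le> N" for i j
      using that N by (auto simp: T_def divide_simps)
    have diff: "\<bar>real k / N - real k' / N\<bar> \<le> 1 / N" if "k \<le> Suc k'" "k' \<le> Suc k" for k k'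
    proof -
      have "\<bar>real k - real k'\<bar> \<le> 1" using that by linarith
      then have "\<bar>real k - real k'\<bar> / N \<le> 1 / N" by (rule divide_right_mono) simp
      then show ?thesis by (simp add: diff_divide_distrib[symmetric])
    qed
    have "dist (real i / N, real j / N) (real i' / N, real j' / N) \<le> \<bar>real i / N - real i' / N\<bar> + \<bar>real j / N - real j' / N\<bar>"
      unfolding dist_Pair_Pair dist_real_def using sqrt_sum_squares_le_sum_abs by auto
    also have "\<dots> \<le> 1 / N + 1 / N" using diff ij by (intro add_mono) auto
    also have "\<dots> < d" using small by simp
    finally show "dist (f (grid_point N i j)) (f (grid_point N i' j')) < \<epsilon>"
      unfolding grid using d(2) inT ij by blast
  qed
qed

definition sides_less :: "real \<Rightarrow> 'a::metric_space \<Rightarrow> 'a \<Rightarrow> 'a \<Rightarrow> bool" where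
  "sides_less \<epsilon> x y z \<longleftrightarrow> dist x y < \<epsilon> \<and> dist y z < \<epsilon> \<and> dist x z < \<epsilon>"

text \<open>A chain has finitely many singular simplices, so one mesh serves all of them.\<close>

lemma subdivided_chain_in_span:
  fixes c :: "('a::metric_space, 'g::ab_group_add) singular_gchain"
  assumes c: "c \<in> singular_gchains 2 (euclidean :: 'a topology)" and \<epsilon>: "\<epsilon> > 0"
  shows "\<forall>\<^sub>F N in sequentially. lin_ext (subdivided_triangle N) c \<in>
      triangle_span (sides_less \<epsilon>)"
proof -
  have "\<forall>\<^sub>F N in sequentially. \<forall>f\<in>Poly_Mapping.keys c. \<forall>i j i' j'. i + j \<le> N \<longrightarrow> i' + j' \<le> N \<longrightarrow>
      i \<le> Suc i' \<longrightarrow> i' \<le> Suc i \<longrightarrow> j \<le> Suc j' \<longrightarrow> j' \<le> Suc j \<longrightarrow>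
      dist (f (grid_point N i j)) (f (grid_point N i' j')) < \<epsilon>"
    using c \<epsilon> by (intro eventually_ball_finite ballI grid_mesh) (auto simp: singular_gchains_def)
  then show ?thesis
  proof (rule eventually_mono)
    fix N assume N: "\<forall>f\<in>Poly_Mapping.keys c. \<forall>i j i' j'. i + j \<le> N \<longrightarrow> i' + j' \<le> N \<longrightarrow>
      i \<le> Suc i' \<longrightarrow> i' \<le> Suc i \<longrightarrow> j \<le> Suc j' \<longrightarrow> j' \<le> Suc j \<longrightarrow>
      dist (f (grid_point N i j)) (f (grid_point N i' j')) < \<epsilon>"
    show "lin_ext (subdivided_triangle N) c \<in> triangle_span (sides_less \<epsilon>)"
      unfolding lin_ext_def subdivided_triangle_def
    proof (intro triangle_span_sum triangle_span_add triangle_span_triangle)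
      fix f n i assume f: "f \<in> Poly_Mapping.keys c"
      note d = N[rule_format, OF f]
      show "sides_less \<epsilon> (f (grid_point N i (n - i))) (f (grid_point N (Suc i) (n - i))) (f (grid_point N i (Suc (n - i))))"
        if "n \<in> {..<N}" "i \<in> {..n}"
        using that unfolding sides_less_def by (intro conjI d) auto
      show "sides_less \<epsilon> (f (grid_point N (Suc i) (n - i))) (f (grid_point N (Suc i) (Suc (n - i)))) (f (grid_point N i (Suc (n - i))))"
        if "n \<in> {..<N - 1}" "i \<in> {..n}"
        using that unfolding sides_less_def by (intro conjI d) auto
    qed
  qed
qed

section \<open>A cocycle counting oriented triangles\<close>

text \<open>The relation distinguishes some triangles and, by its second property, one orientation of each of
  them; in particular the vertices of a distinguished triangle differ.\<close>

locale oriented_triangles =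
  fixes good :: "'a \<Rightarrow> 'a \<Rightarrow> 'a \<Rightarrow> bool"
  assumes rotate: "good x y z \<Longrightarrow> good y z x" and oriented: "good x y z \<Longrightarrow> \<not> good x z y"
begin

lemma good_distinct: "good x y z \<Longrightarrow> x \<noteq> y \<and> y \<noteq> z \<and> x \<noteq> z"
  using rotate oriented by metis

text \<open>In an alternating chain an oriented triangle occurs as three lists with the same coefficient. Summing over
  all of them would lose torsion coefficients, so only the list that starts with a chosen vertex
  is counted. The choice depends on the set of vertices alone.\<close>

definition selected :: "'a list \<Rightarrow> bool" where
  "selected w \<longleftrightarrow> (\<exists>x y z. w = [x, y, z] \<and> good x y z \<and> x = (SOME v. v \<in> {x, y, z}))"

text \<open>The rotation of a triple that starts with the chosen vertex.\<close>

definition rotated :: "'a \<Rightarrow> 'a \<Rightarrow> 'a \<Rightarrow> 'a list" where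
  "rotated x y z = (let v = SOME v. v \<in> {x, y, z} in
     if v = x then [x, y, z] else if v = y then [y, z, x] else [z, x, y])"

lemma chosen_vertex: "(SOME v. v \<in> {x, y, z}) \<in> {x, y, z}"
  by (rule someI[of _ x]) simp

lemma selected_triple: "selected [x, y, z] \<longleftrightarrow> good x y z \<and> x = (SOME v. v \<in> {x, y, z})"
  by (simp add: selected_def)

lemma rotate_set: "{y, z, x} = {x, y, z}" "{z, x, y} = {x, y, z}"
  by auto

lemma selected_rotated: "good x y z \<Longrightarrow> selected (rotated x y z)"
  using chosen_vertex[of x y z] rotate[of x y z] rotate[of y z x]
  by (auto simp: rotated_def selected_triple Let_def rotate_set[of y z x] rotate_set[of x y z])

lemma rotated_rotate: "good x y z \<Longrightarrow> rotated y z x = rotated x y z"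
  using chosen_vertex[of x y z] good_distinct[of x y z]
  unfolding rotated_def Let_def rotate_set[of y z x] by (auto simp: rotate_set)

lemma selected_eq_rotated:
  assumes "good x y z" "selected w" "set w = {x, y, z}"
  shows "w = rotated x y z"
proof -
  obtain a b d where w: "w = [a, b, d]" "good a b d" "a = (SOME v. v \<in> {a, b, d})"
    using assms(2) unfolding selected_def by blast
  then have rw: "w = rotated a b d" by (simp add: rotated_def)
  note dist = good_distinct[OF w(2)] good_distinct[OF assms(1)]
  have "a \<in> {x, y, z}" "b \<in> {x, y, z}" "d \<in> {x, y, z}" using assms(3) w(1) by auto
  then consider "a = x" "b = y" "d = z" | "a = y" "b = z" "d = x" | "a = z" "b = x" "d = y"
    | "a = x" "b = z" "d = y" | "a = y" "b = x" "d = z" | "a = z" "b = y" "d = x"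
    using dist by blast
  then show ?thesis
  proof cases
    case 1 then show ?thesis using rw by simp
  next
    case 2 then show ?thesis using rw rotated_rotate[OF assms(1)] by simp
  next
    case 3 then show ?thesis
      using rw rotated_rotate[OF assms(1)] rotated_rotate[OF rotate[OF assms(1)]] by simp
  next
    case 4 then show ?thesis using w(2) oriented assms(1) by blast
  next
    case 5 then show ?thesis using w(2) oriented assms(1) rotate by blast
  next
    case 6 then show ?thesis using w(2) oriented assms(1) rotate by blast
  qed
qed

definition count_good :: "('a, 'g::ab_group_add) simplicial_chain \<Rightarrow> 'g" where
  "count_good = lin_ext (\<lambda>w g. if selected w then g else 0)"

lemma additive_count_good: "Modules.additive count_good"
  unfolding count_good_def by (intro additive_lin_ext additive_If additive_id additive_zero)

lemmas count_good_add = Modules.additive.add[OF additive_count_good]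
  and count_good_diff = Modules.additive.diff[OF additive_count_good]
  and count_good_sum = Modules.additive.sum[OF additive_count_good]

lemma count_good_single: "count_good (Poly_Mapping.single w g) = (if selected w then g else 0)"
  unfolding count_good_def by (subst lin_ext_single) (auto intro: additive_If additive_id additive_zero)

lemma count_good_triangle:
  assumes "good x y z"
  shows "count_good (triangle_chain g x y z) = g"
proof -
  have rot: "good y z x" "good z x y" using assms rotate by blast+
  have rev: "\<not> good y x z" "\<not> good x z y" "\<not> good z y x"
    using assms rot oriented by blast+
  have "x \<noteq> y" "y \<noteq> z" "x \<noteq> z" using good_distinct[OF assms] by auto
  then show ?thesis
    using assms rot rev chosen_vertex[of x y z]
    unfolding triangle_chain_def count_good_add count_good_diff count_good_single selected_triple
      rotate_set(1)[of y z x] rotate_set(2)[of z x y]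
    by (auto simp: rotate_set)
qed

lemma count_good_triangle_0:
  assumes "\<not> good x y z" "\<not> good x z y"
  shows "count_good (triangle_chain g x y z) = 0"
proof -
  have "\<not> good y z x" "\<not> good z x y" "\<not> good y x z" "\<not> good z y x"
    using assms rotate by blast+
  then show ?thesis
    using assms unfolding triangle_chain_def count_good_add count_good_diff count_good_single selected_triple
    by simp
qed

lemma count_good_eq_0:
  assumes "\<And>x y z. [x, y, z] \<in> Poly_Mapping.keys c \<Longrightarrow> \<not> good x y z"
  shows "count_good c = 0"
  unfolding count_good_def by (rule lin_ext_eq_0) (use assms in \<open>auto simp: selected_def\<close>)

text \<open>The cocycle condition. In a tetrahedron with two vertices close to each other, a distinguished face
  contains exactly one of these two, and exchanging them turns it into the only other
  distinguished face, which has the opposite sign in the boundary.\<close>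

lemma count_good_boundary:
  fixes c :: "('a, 'g::ab_group_add) simplicial_chain"
  assumes c: "c \<in> simplicial_chains 3 K"
    and close_sym: "\<And>x y. close x y \<Longrightarrow> close y x"
    and not_close: "\<And>x y z. good x y z \<Longrightarrow> \<not> close x y"
    and close_pair: "\<And>v x y z. {v, x, y, z} \<in> K \<Longrightarrow> distinct [v, x, y, z] \<Longrightarrow>
        \<exists>p\<in>{v, x, y, z}. \<exists>q\<in>{v, x, y, z}. p \<noteq> q \<and> close p q"
    and exchange: "\<And>v x y z. {v, x, y, z} \<in> K \<Longrightarrow> good x y z \<Longrightarrow> close v x \<Longrightarrow> good v y z"
  shows "count_good (simplicial_boundary c) = 0"
proof -
  let ?c = "Poly_Mapping.lookup c"
  have keys: "distinct w \<and> length w = 4 \<and> set w \<in> K" if "w \<in> Poly_Mapping.keys c" for w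
    using c that by (auto simp: simplicial_chains_def)
  have alt: "?c (w[i := w ! j, j := w ! i]) = - ?c w" if "i < j" "j < length w" for w i j
    using c that by (auto simp: simplicial_chains_def)
  have swap: "?c [x, v, y, z] = - ?c [v, x, y, z]" for v x y z
    using alt[of 0 1 "[v, x, y, z]"] by simp
  have rot: "?c [v, y, z, x] = ?c [v, x, y, z]" for v x y z
    using alt[of 1 2 "[v, x, y, z]"] alt[of 2 3 "[v, y, x, z]"] by simp
  have lookup_rotated: "?c (v # rotated x y z) = ?c [v, x, y, z]" for v x y z
    using rot[of v x y z] rot[of v y z x] by (auto simp: rotated_def Let_def)
  define U where "U = {u \<in> Poly_Mapping.keys c. selected (tl u)}"
  have "count_good (simplicial_boundary c) =
      (\<Sum>u\<in>{u \<in> Poly_Mapping.keys c. tl u \<noteq> []}. if selected (tl u) then ?c u else 0)"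
    unfolding simplicial_boundary_def count_good_sum count_good_single ..
  also have "\<dots> = (\<Sum>u\<in>{u \<in> {u \<in> Poly_Mapping.keys c. tl u \<noteq> []}. selected (tl u)}. ?c u)"
    by (rule sum.inter_filter[symmetric]) simp
  also have "{u \<in> {u \<in> Poly_Mapping.keys c. tl u \<noteq> []}. selected (tl u)} = U"
    by (auto simp: U_def selected_def)
  \<comment> \<open>Group the counted faces by the tetrahedron that they belong to.\<close>
  also have "(\<Sum>u\<in>U. ?c u) = (\<Sum>F\<in>set ` U. \<Sum>u\<in>{u. u \<in> U \<and> set u = F}. ?c u)"
    by (rule sum.image_gen) (simp add: U_def)
  also have "\<dots> = 0"
  proof (rule sum.neutral, rule ballI)
    fix F assume "F \<in> set ` U"
    then obtain u where u: "u \<in> U" "F = set u" by blast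
    then obtain v x y z where vxyz: "u = [v, x, y, z]" "good x y z"
      using keys[of u] unfolding U_def selected_def by (cases u) auto
    have F: "F = {v, x, y, z}" and FK: "F \<in> K" and dist: "distinct [v, x, y, z]"
      using u keys[of u] vxyz by (auto simp: U_def)
    have nc: "\<not> close p q" if "p \<in> {x, y, z}" "q \<in> {x, y, z}" "p \<noteq> q" for p q
      using that not_close vxyz(2) rotate close_sym by (metis empty_iff insert_iff)
    \<comment> \<open>Vertices of a distinguished face are never close, so the close pair involves the remaining vertex \<open>v\<close>.\<close>
    have "\<exists>p\<in>{x, y, z}. close v p"
      using close_pair[of v x y z] FK F dist nc close_sym by (metis insert_iff)
    then obtain x' y' z' where g: "good x' y' z'" "close v x'" and F': "F = {v, x', y', z'}"
      using vxyz(2) rotate[of x y z] rotate[of y z x] F by (metis empty_iff insert_commute insert_iff)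
    have dist': "distinct [v, x', y', z']"
    proof -
      have "card F = 4" using dist unfolding F by simp
      then show ?thesis unfolding F' by (auto simp: card_insert_if split: if_splits)
    qed
    have g': "good v y' z'" using exchange g FK F' by blast
    let ?a = "v # rotated x' y' z'" and ?b = "x' # rotated v y' z'"
    \<comment> \<open>The two faces opposite to \<open>v\<close> and to \<open>x'\<close> are the only ones that can be counted; a face with
      coefficient zero does not occur in \<open>U\<close>.\<close>
    have "{u. u \<in> U \<and> set u = F} = {u \<in> {?a, ?b}. u \<in> Poly_Mapping.keys c}"
    proof (intro equalityI subsetI)
      fix w assume "w \<in> {u \<in> {?a, ?b}. u \<in> Poly_Mapping.keys c}"
      then have w: "w = ?a \<or> w = ?b" "w \<in> Poly_Mapping.keys c" by auto
      have "set (rotated x' y' z') = {x', y', z'}" "set (rotated v y' z') = {v, y', z'}"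
        by (auto simp: rotated_def Let_def)
      then show "w \<in> {u. u \<in> U \<and> set u = F}"
        using w selected_rotated[OF g(1)] selected_rotated[OF g'] by (auto simp: U_def F')
    next
      fix w assume "w \<in> {u. u \<in> U \<and> set u = F}"
      then have w: "w \<in> Poly_Mapping.keys c" "selected (tl w)" "set w = F" by (auto simp: U_def)
      then obtain p q r s where pqrs: "w = [p, q, r, s]" "good q r s"
        using keys[of w] unfolding selected_def by (cases w) auto
      have dw: "distinct [p, q, r, s]" using keys[OF w(1)] pqrs(1) by simp
      have set_qrs: "{q, r, s} = F - {p}" using w(3) pqrs(1) dw by auto
      have "p \<in> F" using w(3) pqrs(1) by auto
      moreover have "p \<noteq> y'" "p \<noteq> z'"
      proof -
        have "\<not> (v \<in> {q, r, s} \<and> x' \<in> {q, r, s})"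
          using g(2) dist' not_close pqrs(2) rotate close_sym
          by (metis distinct_length_2_or_more empty_iff insert_iff)
        then show "p \<noteq> y'" "p \<noteq> z'" unfolding set_qrs F' using dist' by auto
      qed
      ultimately consider "p = v" | "p = x'" unfolding F' by blast
      then have "w = ?a \<or> w = ?b"
      proof cases
        case 1
        then have "set (tl w) = {x', y', z'}" using set_qrs dist' pqrs(1) unfolding F' by auto
        then show ?thesis using selected_eq_rotated[OF g(1) w(2)] 1 pqrs(1) by simp
      next
        case 2
        then have "set (tl w) = {v, y', z'}" using set_qrs dist' pqrs(1) unfolding F' by auto
        then show ?thesis using selected_eq_rotated[OF g' w(2)] 2 pqrs(1) by simp
      qed
      then show "w \<in> {u \<in> {?a, ?b}. u \<in> Poly_Mapping.keys c}" using w(1) by blast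
    qed
    then have "(\<Sum>u\<in>{u. u \<in> U \<and> set u = F}. ?c u) = (\<Sum>u\<in>{u \<in> {?a, ?b}. u \<in> Poly_Mapping.keys c}. ?c u)"
      by simp
    also have "\<dots> = (\<Sum>u\<in>{?a, ?b}. ?c u)"
      by (rule sum.mono_neutral_left) (auto simp: in_keys_iff)
    also have "\<dots> = ?c ?a + ?c ?b"
      using dist' by simp
    also have "\<dots> = 0"
      unfolding lookup_rotated swap[of x' v y' z'] by simp
    finally show "(\<Sum>u\<in>{u. u \<in> U \<and> set u = F}. ?c u) = 0" .
  qed
  finally show ?thesis .
qed

end

section \<open>Homotopies of nearby loops\<close>

text \<open>The rungs \<open>g i\<close> of the ladder join \<open>p\<close> to \<open>q\<close>. Filling the rectangle between two rungs moves the rung past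
  it, so that going along \<open>p\<close> and then down a rung is homotopic to going down the first rung
  and then along \<open>q\<close>. Since the last rung is the first one, \<open>p\<close> is conjugate to \<open>q\<close>.\<close>

lemma homotopic_loops_ladder_normed:
  fixes S :: "'a::real_normed_vector set" and N :: nat and t :: "nat \<Rightarrow> real" and p q :: "real \<Rightarrow> 'a" and g :: "nat \<Rightarrow> real \<Rightarrow> 'a"
  assumes p: "path p" "path_image p \<subseteq> S" "pathfinish p = pathstart p"
    and q: "path q" "path_image q \<subseteq> S" "pathfinish q = pathstart q"
    and t: "t 0 = 0" "t N = 1" "\<And>i. i \<le> N \<Longrightarrow> t i \<in> {0..1}"
    and g: "\<And>i. i \<le> N \<Longrightarrow> path (g i) \<and> path_image (g i) \<subseteq> S \<and>
              pathstart (g i) = p (t i) \<and> pathfinish (g i) = q (t i)"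
    and closed: "g N = g 0"
    and null: "\<And>i. i < N \<Longrightarrow> \<exists>a. homotopic_loops S
        ((subpath (t i) (t (Suc i)) p +++ g (Suc i)) +++
         reversepath (g i +++ subpath (t i) (t (Suc i)) q)) (\<lambda>_. a)"
  shows "homotopic_loops S p q"
proof -
  have const: "(\<lambda>_. a) = linepath a a" for a :: 'a
    by (simp add: linepath_def fun_eq_iff algebra_simps)
  have sub: "path (subpath u v p) \<and> path_image (subpath u v p) \<subseteq> S \<and>
        path (subpath u v q) \<and> path_image (subpath u v q) \<subseteq> S" if "u \<in> {0..1}" "v \<in> {0..1}" for u v
    using that p q path_image_subpath_subset[of u v p] path_image_subpath_subset[of u v q] by auto
  have rung: "homotopic_paths S (subpath (t i) (t (Suc i)) p +++ g (Suc i))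
                (g i +++ subpath (t i) (t (Suc i)) q)" if i: "i < N" for i
  proof -
    obtain a where a: "homotopic_loops S
        ((subpath (t i) (t (Suc i)) p +++ g (Suc i)) +++
         reversepath (g i +++ subpath (t i) (t (Suc i)) q)) (linepath a a)"
      using null[OF i] const by metis
    have "path (g i +++ subpath (t i) (t (Suc i)) q)"
      using g[of i] sub[of "t i" "t (Suc i)"] t(3)[of i] t(3)[of "Suc i"] i by simp
    with a show ?thesis by (rule homotopic_paths_loop_parts)
  qed
  have ind: "homotopic_paths S (subpath 0 (t i) p +++ g i) (g 0 +++ subpath 0 (t i) q)"
    if "i \<le> N" for i
    using that
  proof (induction i)
    case 0
    have s0: "subpath 0 (t 0) p = linepath (p 0) (p 0)" "subpath 0 (t 0) q = linepath (q 0) (q 0)"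
      by (auto simp: subpath_refl t(1))
    have "homotopic_paths S (linepath (p 0) (p 0) +++ g 0) (g 0)"
      using g[of 0] t(1) by (intro homotopic_paths_lid') auto
    moreover have "homotopic_paths S (g 0 +++ linepath (q 0) (q 0)) (g 0)"
      using g[of 0] t(1) by (intro homotopic_paths_rid') auto
    ultimately have "homotopic_paths S (linepath (p 0) (p 0) +++ g 0) (g 0 +++ linepath (q 0) (q 0))"
      by (blast intro: homotopic_paths_sym homotopic_paths_trans)
    then show ?case unfolding s0 .
  next
    case (Suc i)
    define u v where "u = t i" and "v = t (Suc i)"
    have i: "i \<le> N" "i < N" using Suc.prems by auto
    have uv: "u \<in> {0..1}" "v \<in> {0..1}" "(0::real) \<in> {0..1}" 
      using t(3)[of i] t(3)[of "Suc i"] Suc.prems unfolding u_def v_def by auto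
    note gi = g[OF i(1), folded u_def] and gs = g[OF Suc.prems, folded v_def] and g0 = g[of 0, unfolded t(1)]
    note IH = Suc.IH[OF i(1), folded u_def] and rung' = rung[OF i(2), folded u_def v_def]
    have pjoin: "homotopic_paths S (subpath 0 v p) (subpath 0 u p +++ subpath u v p)"
      using homotopic_join_subpaths[OF p(1,2) uv(3,1,2)] homotopic_paths_sym by blast
    have qjoin: "homotopic_paths S (subpath 0 u q +++ subpath u v q) (subpath 0 v q)"
      using homotopic_join_subpaths[OF q(1,2) uv(3,1,2)] .
    note sp = sub[OF uv(3,1)] sub[OF uv(3,2)] sub[OF uv(1,2)]
    have "homotopic_paths S (subpath 0 v p +++ g (Suc i))
        ((subpath 0 u p +++ subpath u v p) +++ g (Suc i))"
      using pjoin gs by (intro homotopic_paths_join) auto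
    also have "homotopic_paths S \<dots> (subpath 0 u p +++ (subpath u v p +++ g (Suc i)))"
      using sp gs by (intro homotopic_paths_sym[OF homotopic_paths_assoc]) auto
    also have "homotopic_paths S \<dots> (subpath 0 u p +++ (g i +++ subpath u v q))"
      using sp gs by (intro homotopic_paths_join rung') auto
    also have "homotopic_paths S \<dots> ((subpath 0 u p +++ g i) +++ subpath u v q)"
      using sp gi by (intro homotopic_paths_assoc) auto
    also have "homotopic_paths S \<dots> ((g 0 +++ subpath 0 u q) +++ subpath u v q)"
      using sp gi by (intro homotopic_paths_join IH) auto
    also have "homotopic_paths S \<dots> (g 0 +++ (subpath 0 u q +++ subpath u v q))"
      using sp g0 by (intro homotopic_paths_sym[OF homotopic_paths_assoc]) auto
    also have "homotopic_paths S \<dots> (g 0 +++ subpath 0 v q)"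
      using qjoin g0 by (intro homotopic_paths_join) auto
    finally show ?case unfolding v_def .
  qed
  note g0 = g[of 0, unfolded t(1)]
  have pg: "homotopic_paths S (p +++ g 0) (g 0 +++ q)"
    using ind[of N] closed by (simp add: t(2))
  have ends: "pathfinish p = pathstart (g 0)" "pathfinish (g 0) = pathstart q"
    using g0 p(3) by (auto simp: pathstart_def)
  have "homotopic_paths S (p +++ g 0 +++ reversepath (g 0)) ((p +++ g 0) +++ reversepath (g 0))"
    using p g0 ends by (intro homotopic_paths_assoc) auto
  also have "homotopic_paths S \<dots> ((g 0 +++ q) +++ reversepath (g 0))"
    using g0 ends by (intro homotopic_paths_join[OF pg]) auto
  also have "homotopic_paths S \<dots> (g 0 +++ q +++ reversepath (g 0))"
    using q g0 ends by (intro homotopic_paths_sym[OF homotopic_paths_assoc]) auto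
  finally have conj: "homotopic_paths S (p +++ g 0 +++ reversepath (g 0)) (g 0 +++ q +++ reversepath (g 0))" .
  have "homotopic_paths S (p +++ g 0 +++ reversepath (g 0)) (p +++ linepath (pathfinish p) (pathfinish p))"
    using p g0 ends homotopic_paths_rinv[of "g 0" S] by (intro homotopic_paths_join) simp_all
  also have "homotopic_paths S \<dots> p"
    using p by (intro homotopic_paths_rid) auto
  finally have "homotopic_paths S p (g 0 +++ q +++ reversepath (g 0))"
    using conj homotopic_paths_sym homotopic_paths_trans by blast
  then have "homotopic_loops S p (g 0 +++ q +++ reversepath (g 0))"
    using p g0 by (intro homotopic_paths_imp_homotopic_loops) (auto simp: pathstart_def)
  moreover have "homotopic_loops S (g 0 +++ q +++ reversepath (g 0)) q"
    using q g0 ends by (intro homotopic_loops_conjugate) auto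
  ultimately show ?thesis
    by (rule homotopic_loops_trans)
qed

text \<open>Every metric space sits isometrically in a normed space, via \<open>x \<mapsto> dist x _ - dist b _\<close> for a base point
  \<open>b\<close>. Homotopies in a subset only see the subset, so the algebra of paths in normed spaces
  applies to metric spaces.\<close>

lemma kuratowski_embedding:
  obtains \<iota> :: "'a::metric_space \<Rightarrow> ('a \<Rightarrow>\<^sub>C real)" where "\<And>x y. dist (\<iota> x) (\<iota> y) = dist x y"
proof -
  fix b :: 'a
  have bc: "(\<lambda>z. dist x z - dist b z) \<in> bcontfun" for x
  proof (rule bcontfun_normI)
    show "continuous_on UNIV (\<lambda>z. dist x z - dist b z)" by (intro continuous_intros)
    show "norm (dist x z - dist b z) \<le> dist x b" for z
      using abs_dist_diff_le[of x z b] by (simp add: dist_commute)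
  qed
  define \<iota> where "\<iota> x = Bcontfun (\<lambda>z. dist x z - dist b z)" for x
  have app: "apply_bcontfun (\<iota> x) z = dist x z - dist b z" for x z
    unfolding \<iota>_def using bc by (simp add: Bcontfun_inverse)
  have "dist (\<iota> x) (\<iota> y) = dist x y" for x y
  proof (rule antisym)
    show "dist (\<iota> x) (\<iota> y) \<le> dist x y"
    proof (rule dist_bound)
      fix z
      have "dist (\<iota> x z) (\<iota> y z) = \<bar>dist x z - dist y z\<bar>"
        unfolding app dist_real_def by simp
      also have "\<dots> \<le> dist x y"
        using abs_dist_diff_le[of x z y] unfolding dist_commute[of z y] .
      finally show "dist (\<iota> x z) (\<iota> y z) \<le> dist x y" .
    qed
    show "dist x y \<le> dist (\<iota> x) (\<iota> y)"
      using dist_bounded[of "\<iota> x" y "\<iota> y"] unfolding app dist_real_def by simp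
  qed
  then show ?thesis by (rule that)
qed

definition segment :: "real \<Rightarrow> real \<Rightarrow> (real \<Rightarrow> 'a) \<Rightarrow> real \<Rightarrow> 'a" where
  "segment u v p = (\<lambda>x. p ((v - u) * x + u))"

lemma segment_affine: "u \<le> v \<Longrightarrow> (\<lambda>x. (v - u) * x + u) ` {0..1} = {u..v::real}"
  by (subst image_affinity_atLeastAtMost) auto

lemma path_image_segment:
  assumes "u \<le> v"
  shows "path_image (segment u v p) = p ` {u..v}"
  unfolding path_image_def segment_def segment_affine[OF assms, symmetric] by (auto simp: image_image)

lemma path_segment:
  assumes "path p" "u \<in> {0..1}" "v \<in> {0..1}" "u \<le> v"
  shows "path (segment u v p)"
  unfolding path_def segment_def
proof (rule continuous_on_compose2[of "{u..v}" p])
  show "continuous_on {u..v} p"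
    using assms by (auto simp: path_def elim!: continuous_on_subset)
  show "continuous_on {0..1} (\<lambda>x. (v - u) * x + u)" by (intro continuous_intros)
  show "(\<lambda>x. (v - u) * x + u) ` {0..1} \<subseteq> {u..v}" using segment_affine[OF assms(4)] by blast
qed

lemma pathstart_segment [simp]: "pathstart (segment u v p) = p u"
  and pathfinish_segment [simp]: "pathfinish (segment u v p) = p v"
  by (simp_all add: pathstart_def pathfinish_def segment_def)

lemma homotopic_loops_ladder:
  fixes S :: "'a::metric_space set" and N :: nat and t :: "nat \<Rightarrow> real" and p q :: "real \<Rightarrow> 'a" and g :: "nat \<Rightarrow> real \<Rightarrow> 'a"
  assumes p: "path p" "path_image p \<subseteq> S" "pathfinish p = pathstart p"
    and q: "path q" "path_image q \<subseteq> S" "pathfinish q = pathstart q"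
    and t: "t 0 = 0" "t N = 1" "\<And>i. i \<le> N \<Longrightarrow> t i \<in> {0..1}"
    and g: "\<And>i. i \<le> N \<Longrightarrow> path (g i) \<and> path_image (g i) \<subseteq> S \<and>
              pathstart (g i) = p (t i) \<and> pathfinish (g i) = q (t i)"
    and closed: "g N = g 0"
    and null: "\<And>i. i < N \<Longrightarrow> \<exists>a. homotopic_loops S
        ((segment (t i) (t (Suc i)) p +++ g (Suc i)) +++
         reversepath (g i +++ segment (t i) (t (Suc i)) q)) (\<lambda>_. a)"
  shows "homotopic_loops S p q"
proof -
  obtain \<iota> :: "'a \<Rightarrow> ('a \<Rightarrow>\<^sub>C real)" where iso: "\<And>x y. dist (\<iota> x) (\<iota> y) = dist x y"
    using kuratowski_embedding by blast
  have "inj \<iota>" by (metis dist_eq_0_iff injI iso)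
  define \<kappa> where "\<kappa> = inv_into UNIV \<iota>"
  have \<kappa>: "\<kappa> (\<iota> x) = x" for x using \<open>inj \<iota>\<close> by (simp add: \<kappa>_def)
  have cont: "continuous_on X \<iota>" for X
    unfolding continuous_on_iff by (auto simp: iso)
  have cont': "continuous_on (\<iota> ` S) \<kappa>"
    unfolding continuous_on_iff by (auto simp: iso \<kappa>)
  have sub: "subpath u v (\<iota> \<circ> r) = \<iota> \<circ> segment u v r" for u v r
    by (auto simp: segment_def subpath_def)
  have pa: "path (\<iota> \<circ> r)" if "path r" for r
    using that cont by (rule path_continuous_image)
  have img: "path_image (\<iota> \<circ> r) \<subseteq> \<iota> ` S" if "path_image r \<subseteq> S" for r
    using that by (auto simp: path_image_compose)
  have "homotopic_loops (\<iota> ` S) (\<iota> \<circ> p) (\<iota> \<circ> q)"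
  proof (rule homotopic_loops_ladder_normed[where N = N and t = t and g = "\<lambda>i. \<iota> \<circ> g i"])
    fix i assume i: "i < N"
    then obtain a where "homotopic_loops S
        ((segment (t i) (t (Suc i)) p +++ g (Suc i)) +++
         reversepath (g i +++ segment (t i) (t (Suc i)) q)) (\<lambda>_. a)"
      using null by blast
    from homotopic_loops_continuous_image[OF this cont, of "\<iota> ` S"]
    show "\<exists>a. homotopic_loops (\<iota> ` S)
        ((subpath (t i) (t (Suc i)) (\<iota> \<circ> p) +++ (\<iota> \<circ> g (Suc i))) +++
         reversepath ((\<iota> \<circ> g i) +++ subpath (t i) (t (Suc i)) (\<iota> \<circ> q))) (\<lambda>_. a)"
      unfolding sub path_compose_join[symmetric] path_compose_reversepath[symmetric]
      by (auto simp: o_def)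
  qed (use assms in \<open>auto simp: pa img pathstart_compose pathfinish_compose\<close>)
  moreover have "\<kappa> \<in> \<iota> ` S \<rightarrow> S" by (auto simp: \<kappa>)
  ultimately have "homotopic_loops S (\<kappa> \<circ> (\<iota> \<circ> p)) (\<kappa> \<circ> (\<iota> \<circ> q))"
    by (intro homotopic_loops_continuous_image[OF _ cont'])
  then show ?thesis by (simp add: o_def \<kappa>)
qed

text \<open>Geodesics parametrized on the unit interval, proportionally to arc length, so that they are paths.\<close>

definition geodesic_path :: "'a::metric_space \<Rightarrow> 'a \<Rightarrow> (real \<Rightarrow> 'a) \<Rightarrow> bool" where
  "geodesic_path x y p \<longleftrightarrow> pathstart p = x \<and> pathfinish p = y \<and>
     (\<forall>s\<in>{0..1}. \<forall>t\<in>{0..1}. dist (p s) (p t) = dist x y * \<bar>s - t\<bar>)"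

lemma path_geodesic_path: "geodesic_path x y p \<Longrightarrow> path p"
  unfolding path_def geodesic_path_def
  by (intro lipschitz_on_continuous_on[where L = "dist x y"] lipschitz_onI) (auto simp: dist_real_def)

lemma geodesic_from_to_imp_geodesic_path:
  assumes "geodesic_from_to \<gamma> x y"
  shows "geodesic_path x y (\<lambda>t. \<gamma> (dist x y * t))"
proof -
  have "dist (\<gamma> (dist x y * s)) (\<gamma> (dist x y * t)) = dist x y * \<bar>s - t\<bar>"
    if "s \<in> {0..1}" "t \<in> {0..1}" for s t
  proof -
    have "dist x y * s \<in> {0..dist x y}" "dist x y * t \<in> {0..dist x y}"
      using that by (auto simp: mult_left_le)
    then have "dist (\<gamma> (dist x y * s)) (\<gamma> (dist x y * t)) = \<bar>dist x y * s - dist x y * t\<bar>"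
      using assms unfolding geodesic_from_to_def by blast
    also have "\<dots> = dist x y * \<bar>s - t\<bar>"
      by (simp add: abs_mult flip: right_diff_distrib)
    finally show ?thesis .
  qed
  then show ?thesis
    using assms unfolding geodesic_path_def geodesic_from_to_def pathstart_def pathfinish_def by simp
qed

text \<open>Geodesics between corresponding points of two uniformly close loops form a ladder. Its rectangles are
  small, and therefore null-homotopic: each side stays within \<open>\<delta> / 2\<close> of one corner.\<close>

lemma homotopic_loops_nearby_metric:
  fixes p q :: "real \<Rightarrow> 'a::metric_space"
  assumes geo: "geodesic_space TYPE('a)"
    and p: "is_loop p" and q: "is_loop q" and \<delta>: "\<delta> > 0"
    and ball: "\<And>x. x \<in> path_image p \<Longrightarrow> ball x \<delta> \<subseteq> S"
    and null: "\<And>x r. x \<in> path_image p \<Longrightarrow> is_loop r \<Longrightarrow> path_image r \<subseteq> ball x \<delta> \<Longrightarrow>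
                 \<exists>y. homotopic_loops S r (\<lambda>_. y)"
    and close: "\<And>t. t \<in> {0..1} \<Longrightarrow> dist (p t) (q t) < \<delta> / 4"
  shows "homotopic_loops S p q"
proof -
  have "\<exists>G. geodesic_path x y G" for x y :: 'a
    using geo geodesic_from_to_imp_geodesic_path unfolding geodesic_space_def by blast
  then have G: "geodesic_path x y (G x y)" if "G = (\<lambda>x y. SOME \<gamma>. geodesic_path x y \<gamma>)" for G and x y :: 'a
    unfolding that by (rule someI_ex)
  define G :: "'a \<Rightarrow> 'a \<Rightarrow> real \<Rightarrow> 'a" where "G = (\<lambda>x y. SOME \<gamma>. geodesic_path x y \<gamma>)"
  note G = G[OF G_def]
  have pp: "path p" "p 1 = p 0" and qq: "path q" "q 1 = q 0"
    using p q by (auto simp: is_loop_def pathstart_def pathfinish_def)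
  have "uniformly_continuous_on {0..1} p"
    using pp(1) by (simp add: path_def compact_uniformly_continuous)
  moreover have "\<delta> / 4 > 0" using \<delta> by simp
  ultimately obtain d where d: "d > 0"
    "\<And>s t. \<lbrakk>s \<in> {0..1}; t \<in> {0..1}; dist t s < d\<rbrakk> \<Longrightarrow> dist (p t) (p s) < \<delta> / 4"
    unfolding uniformly_continuous_on_def by blast
  obtain n where "1 / real (Suc n) < d"
    using nat_approx_posE[OF d(1)] .
  then obtain N :: nat where N: "N > 0" "1 / N < d"
    by blast
  have Gclose: "dist x z \<le> dist x y" if "z \<in> path_image (G x y)" for x y z
  proof -
    obtain t where t: "t \<in> {0..1}" "z = G x y t" using \<open>z \<in> _\<close> by (auto simp: path_image_def)
    have "dist (G x y 0) (G x y t) = dist x y * \<bar>0 - t\<bar>"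
      using G[of x y] t(1) unfolding geodesic_path_def by simp
    moreover have "G x y 0 = x" using G[of x y] by (simp add: geodesic_path_def pathstart_def)
    ultimately show ?thesis using t by (simp add: mult_left_le)
  qed
  have frac01: "real i / real N \<in> {0..1}" if "i \<le> N" for i
    using that N by (simp add: divide_simps)
  have p_in: "p t \<in> path_image p" if "t \<in> {0..1}" for t
    using that by (simp add: path_image_def)
  define g where "g i = G (p (real i / real N)) (q (real i / real N))" for i :: nat
  have gprops: "path (g i)" "pathstart (g i) = p (real i / real N)" "pathfinish (g i) = q (real i / real N)" for i
    using G path_geodesic_path unfolding g_def geodesic_path_def by blast+
  have gnear: "dist (p (real i / real N)) z < \<delta> / 4" if "z \<in> path_image (g i)" "i \<le> N" for z i
    using Gclose[OF that(1)[unfolded g_def]] close[OF frac01[OF that(2)]] by linarith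
  show ?thesis
  proof (rule homotopic_loops_ladder[where N = N and t = "\<lambda>i. real i / real N" and g = g])
    show "path p" "path q" by fact+
    show "pathfinish p = pathstart p" "pathfinish q = pathstart q"
      using p q by (auto simp: is_loop_def)
    show "path_image p \<subseteq> S"
      using ball \<delta> by (meson centre_in_ball subset_eq)
    show "path_image q \<subseteq> S"
    proof
      fix z assume "z \<in> path_image q"
      then obtain t where t: "t \<in> {0..1}" "z = q t" by (auto simp: path_image_def)
      then have "z \<in> ball (p t) \<delta>" using close[OF t(1)] \<delta> by auto
      then show "z \<in> S" using ball[OF p_in[OF t(1)]] by auto
    qed
    show "real 0 / real N = 0" "real N / real N = 1" "\<And>i. i \<le> N \<Longrightarrow> real i / real N \<in> {0..1}"
      using N frac01 by auto
    show "g N = g 0" using N pp qq by (simp add: g_def)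
    show "path (g i) \<and> path_image (g i) \<subseteq> S \<and> pathstart (g i) = p (real i / real N) \<and> pathfinish (g i) = q (real i / real N)"
      if "i \<le> N" for i
    proof -
      have "path_image (g i) \<subseteq> ball (p (real i / real N)) \<delta>" using gnear[OF _ that] \<delta> by fastforce
      then show ?thesis using ball[OF p_in[OF frac01[OF that]]] gprops by blast
    qed
  next
    fix i assume i: "i < N"
    define u v where "u = real i / real N" and "v = real (Suc i) / real N"
    note uv_defs = u_def v_def
    have uv: "u \<in> {0..1}" "v \<in> {0..1}" "u \<le> v" "v - u < d"
      using frac01[of i] frac01[of "Suc i"] i N unfolding uv_defs
      by (auto simp: divide_right_mono simp flip: diff_divide_distrib)
    have pnear: "dist (p u) (p t) < \<delta> / 4" if "t \<in> {u..v}" for t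
      using that uv by (intro d(2)) (auto simp: dist_real_def)
    let ?L = "segment u v p +++ g (Suc i)" and ?R = "g i +++ segment u v q"
    have img: "path_image (segment u v r) = r ` {u..v}" for r :: "real \<Rightarrow> 'a"
      using uv by (simp add: path_image_segment)
    have "path_image ?L \<subseteq> ball (p u) \<delta>"
    proof
      fix z assume "z \<in> path_image ?L"
      then consider t where "t \<in> {u..v}" "z = p t" | "z \<in> path_image (g (Suc i))"
        using path_image_join_subset img by blast
      then show "z \<in> ball (p u) \<delta>"
      proof cases
        case 1 then show ?thesis using pnear \<delta> by fastforce
      next
        case 2
        then have "dist (p v) z < \<delta> / 4" using gnear[of z "Suc i"] i unfolding v_def by simp
        then show ?thesis
          using pnear[of v] uv \<delta> dist_triangle[of "p u" z "p v"] by auto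
      qed
    qed
    moreover have "path_image (reversepath ?R) \<subseteq> ball (p u) \<delta>"
    proof
      fix z assume "z \<in> path_image (reversepath ?R)"
      then have "z \<in> path_image (g i) \<union> path_image (segment u v q)"
        unfolding path_image_reversepath using path_image_join_subset by blast
      then consider t where "t \<in> {u..v}" "z = q t" | "z \<in> path_image (g i)"
        unfolding img by blast
      then show "z \<in> ball (p u) \<delta>"
      proof cases
        case 1
        then show ?thesis
          using pnear[of t] close[of t] uv \<delta> dist_triangle[of "p u" z "p t"] by auto
      next
        case 2
        then show ?thesis using gnear[of z i] i \<delta> unfolding u_def by simp
      qed
    qed
    moreover have loop: "is_loop (?L +++ reversepath ?R)"
    proof -
      have "path ?L" "path ?R"
        using gprops pp qq uv by (auto intro!: path_segment simp: uv_defs)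
      then show ?thesis using gprops by (auto simp: is_loop_def uv_defs)
    qed
    ultimately have "path_image (?L +++ reversepath ?R) \<subseteq> ball (p u) \<delta>"
      using path_image_join_subset[of ?L "reversepath ?R"] by (meson le_sup_iff subset_trans)
    from null[OF p_in[OF uv(1)] loop this] have "\<exists>a. homotopic_loops S (?L +++ reversepath ?R) (\<lambda>_. a)" .
    then show "\<exists>a. homotopic_loops S
        ((segment (real i / real N) (real (Suc i) / real N) p +++ g (Suc i)) +++
         reversepath (g i +++ segment (real i / real N) (real (Suc i) / real N) q)) (\<lambda>_. a)"
      unfolding uv_defs .
  qed
qed

section \<open>Points near an isometrically embedded circle\<close>

definition dist_to_int :: "real \<Rightarrow> real" where
  "dist_to_int x = \<bar>x - of_int (round x)\<bar>"

lemma dist_to_int_le: "dist_to_int x \<le> \<bar>x - of_int m\<bar>"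
  unfolding dist_to_int_def by (rule round_diff_minimal)

lemma dist_to_int_le_abs: "dist_to_int x \<le> \<bar>x\<bar>"
  using dist_to_int_le[of x 0] by simp

lemma dist_to_int_eq_abs:
  assumes "\<bar>x\<bar> \<le> 1/2"
  shows "dist_to_int x = \<bar>x\<bar>"
proof (rule antisym)
  show "\<bar>x\<bar> \<le> dist_to_int x"
  proof (cases "round x = 0")
    case False
    then have "1 \<le> \<bar>real_of_int (round x)\<bar>"
      by linarith
    with assms show ?thesis unfolding dist_to_int_def by linarith
  qed (simp add: dist_to_int_def)
qed (rule dist_to_int_le_abs)

lemma dist_to_int_of_int [simp]: "dist_to_int (of_int n) = 0"
  by (simp add: dist_to_int_def)

lemma dist_to_int_plus_int: "dist_to_int (x + of_int m) = dist_to_int x"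
proof -
  have "dist_to_int (y + of_int m) \<le> dist_to_int y" for y m
    using dist_to_int_le[of "y + of_int m" "round y + m"] by (simp add: dist_to_int_def)
  from this[of x m] this[of "x + of_int m" "- m"] show ?thesis by simp
qed

lemma dist_to_int_plus_1: "dist_to_int (x + 1) = dist_to_int x"
  using dist_to_int_plus_int[of x 1] by simp

text \<open>The chord formula of a geodesic circle in terms of the distance to the nearest integer,
  which is the metric of the circle of circumference one on its universal cover.\<close>

lemma dist_to_int_frac_diff:
  "dist_to_int (s - t) = min \<bar>frac s - frac t\<bar> (1 - \<bar>frac s - frac t\<bar>)"
proof -
  define v where "v = frac s - frac t"
  have v: "\<bar>v\<bar> < 1"
    unfolding v_def using frac_ge_0[of s] frac_lt_1[of s] frac_ge_0[of t] frac_lt_1[of t] by linarith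
  have "s - t = v + of_int (\<lfloor>s\<rfloor> - \<lfloor>t\<rfloor>)"
    by (simp add: v_def frac_def)
  then have eq: "dist_to_int (s - t) = dist_to_int v"
    using dist_to_int_plus_int[of v] by metis
  have "dist_to_int v = min \<bar>v\<bar> (1 - \<bar>v\<bar>)"
  proof (cases "\<bar>v\<bar> \<le> 1/2")
    case True
    then show ?thesis by (simp add: dist_to_int_eq_abs)
  next
    case False
    show ?thesis
    proof (cases "v > 0")
      case True
      have "dist_to_int v = dist_to_int (v - 1)"
        using dist_to_int_plus_1[of "v - 1"] by simp
      also have "\<dots> = \<bar>v - 1\<bar>" using True False v by (intro dist_to_int_eq_abs) linarith
      finally show ?thesis using True False v by linarith
    next
      case neg: False
      have "dist_to_int v = dist_to_int (v + 1)"
        using dist_to_int_plus_1[of v] by simp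
      also have "\<dots> = \<bar>v + 1\<bar>" using neg False v by (intro dist_to_int_eq_abs) linarith
      finally show ?thesis using neg False v by linarith
    qed
  qed
  with eq show ?thesis by (simp add: v_def)
qed

locale isometric_circle =
  fixes A :: "real \<Rightarrow> 'a::metric_space" and c :: real
  assumes c_pos: "c > 0" and dist_A: "dist (A s) (A t) = c * dist_to_int (s - t)"
begin

lemma A_plus_1: "A (t + 1) = A t"
  using dist_A[of "t + 1" t] dist_to_int_of_int[of 1] by simp

lemma A_minus_1: "A (t - 1) = A t"
  using A_plus_1[of "t - 1"] by simp

lemma dist_A_le: "dist (A s) (A t) \<le> c * \<bar>s - t\<bar>"
  unfolding dist_A using c_pos dist_to_int_le_abs by (intro mult_left_mono) auto

lemma dist_A_eq: "\<bar>s - t\<bar> \<le> 1/2 \<Longrightarrow> dist (A s) (A t) = c * \<bar>s - t\<bar>"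
  unfolding dist_A by (simp add: dist_to_int_eq_abs)

lemma dist_A_third: "dist (A s) (A (s + 1/3)) = c / 3"
  by (subst dist_A_eq) auto

lemma dist_A_shift: "dist (A (s + u)) (A (t + u)) = dist (A s) (A t)"
  by (simp add: dist_A)

lemma continuous_on_A: "continuous_on X A"
proof -
  have "c-lipschitz_on X A"
    using dist_A_le c_pos by (intro lipschitz_onI) (auto simp: dist_real_def)
  then show ?thesis by (rule lipschitz_on_continuous_on)
qed

lemma A_near_parameter:
  obtains v where "\<bar>v\<bar> \<le> 1/2" "A u = A (s + v)" "dist (A u) (A s) = c * \<bar>v\<bar>"
proof -
  define v where "v = u - s - of_int (round (u - s))"
  have v: "\<bar>v\<bar> \<le> 1/2"
    unfolding v_def using of_int_round_abs_le[of "u - s"] by linarith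
  have "u - (s + v) = of_int (round (u - s))" by (simp add: v_def)
  then have "dist (A u) (A (s + v)) = 0"
    unfolding dist_A by simp
  then have eq: "A u = A (s + v)" by simp
  have "dist (A u) (A s) = c * \<bar>v\<bar>"
    unfolding eq using dist_A_eq[of "s + v" s] v by simp
  with v eq show ?thesis by (rule that)
qed

lemma range_A: "range A = A ` {0..1}"
proof -
  have "A u \<in> A ` {0..1}" for u
  proof -
    have "dist (A u) (A (frac u)) = 0"
      unfolding dist_A by (metis dist_to_int_of_int frac_def diff_diff_eq2 add_diff_cancel_left' mult_zero_right)
    then show ?thesis
      by (metis atLeastAtMost_iff dist_eq_0_iff frac_ge_0 frac_lt_1 image_iff less_imp_le)
  qed
  then show ?thesis by blast
qed

lemma compact_range_A: "compact (range A)"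
  unfolding range_A by (intro compact_continuous_image continuous_on_A) simp

text \<open>A point of the circle that is almost between \<open>A s\<close> and \<open>A (s + 1/3)\<close> is close to the point at
  the right distance on the short arc. The arc is short enough that going round the other way
  is never competitive.\<close>

lemma near_arc:
  assumes w: "w \<in> range A" and sum: "dist w (A s) + dist w (A (s + 1/3)) \<le> c / 3 + \<kappa>" and "\<kappa> < c / 3"
  shows "dist w (A (s + dist w (A s) / c)) \<le> \<kappa>"
proof -
  obtain u where u: "w = A u" using w by auto
  obtain v where v: "\<bar>v\<bar> \<le> 1/2" "w = A (s + v)" "dist w (A s) = c * \<bar>v\<bar>"
    using A_near_parameter[of u s] u by metis
  have "\<kappa> \<ge> 0"
    using sum dist_triangle2[of "A s" "A (s + 1/3)" w] dist_A_third[of s] by (simp add: dist_commute)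
  show ?thesis
  proof (cases "v \<ge> 0")
    case True
    then show ?thesis using v c_pos \<open>\<kappa> \<ge> 0\<close> by simp
  next
    case False
    have "dist w (A (s + 1/3)) = c * dist_to_int (v - 1/3)"
      unfolding v(2) dist_A by (simp add: algebra_simps)
    moreover have "dist_to_int (v - 1/3) = min (1/3 - v) (2/3 + v)"
    proof (cases "v \<ge> -1/6")
      case True
      then have "dist_to_int (v - 1/3) = \<bar>v - 1/3\<bar>"
        using False by (intro dist_to_int_eq_abs) linarith
      then show ?thesis using True False by linarith
    next
      case f: False
      have "dist_to_int (v - 1/3) = dist_to_int (v + 2/3)"
        using dist_to_int_plus_1[of "v - 1/3"] by (simp add: add.commute)
      also have "\<dots> = \<bar>v + 2/3\<bar>"
        using f v(1) by (intro dist_to_int_eq_abs) linarith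
      finally show ?thesis using f v(1) by linarith
    qed
    ultimately have "c * (\<bar>v\<bar> + min (1/3 - v) (2/3 + v)) \<le> c * (1/3 + \<kappa> / c)"
      using sum v(3) c_pos by (simp add: distrib_left)
    then have "\<bar>v\<bar> + min (1/3 - v) (2/3 + v) \<le> 1/3 + \<kappa> / c"
      using c_pos by simp
    moreover have "\<kappa> / c < 1/3"
      using \<open>\<kappa> < c / 3\<close> c_pos by (simp add: field_simps)
    ultimately have "-2 * v \<le> \<kappa> / c"
      using False v(1) by linarith
    have "dist w (A (s + dist w (A s) / c)) = dist (A (s + v)) (A (s - v))"
      using v c_pos False by simp
    also have "\<dots> \<le> c * \<bar>2 * v\<bar>"
      using dist_A_le[of "s + v" "s - v"] by simp
    also have "\<dots> \<le> c * (\<kappa> / c)"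
      using \<open>-2 * v \<le> \<kappa> / c\<close> False c_pos by (intro mult_left_mono) linarith+
    also have "\<dots> = \<kappa>" using c_pos by simp
    finally show ?thesis .
  qed
qed

text \<open>The order of the vertices follows the orientation of the circle, which makes the relation invariant
  under rotations but not under transpositions.\<close>

definition near_equilateral :: "real \<Rightarrow> 'a \<Rightarrow> 'a \<Rightarrow> 'a \<Rightarrow> bool" where
  "near_equilateral \<epsilon> x y z \<longleftrightarrow>
     (\<exists>s. dist x (A s) \<le> \<epsilon> \<and> dist y (A (s + 1/3)) \<le> \<epsilon> \<and> dist z (A (s + 2/3)) \<le> \<epsilon>)"

lemma near_equilateral_rotate:
  assumes "near_equilateral \<epsilon> x y z"
  shows "near_equilateral \<epsilon> y z x"
proof -
  obtain s where s: "dist x (A s) \<le> \<epsilon>" "dist y (A (s + 1/3)) \<le> \<epsilon>" "dist z (A (s + 2/3)) \<le> \<epsilon>"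
    using assms unfolding near_equilateral_def by blast
  have eq: "s + 1/3 + 1/3 = s + 2/3" "s + 1/3 + 2/3 = s + 1" by simp_all
  show ?thesis
    unfolding near_equilateral_def
    using s by (intro exI[of _ "s + 1/3"]) (simp only: eq A_plus_1)
qed

lemma near_equilateral_mono: "near_equilateral \<epsilon> x y z \<Longrightarrow> \<epsilon> \<le> \<epsilon>' \<Longrightarrow> near_equilateral \<epsilon>' x y z"
  unfolding near_equilateral_def by (meson order_trans)

lemma near_equilateral_perturb:
  assumes "near_equilateral \<epsilon> x y z" "dist v x \<le> \<eta>"
  shows "near_equilateral (\<epsilon> + \<eta>) v y z"
proof -
  obtain s where s: "dist x (A s) \<le> \<epsilon>" "dist y (A (s + 1/3)) \<le> \<epsilon>" "dist z (A (s + 2/3)) \<le> \<epsilon>"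
    using assms unfolding near_equilateral_def by blast
  have "0 \<le> \<eta>" using assms(2) zero_le_dist order_trans by blast
  moreover have "dist v (A s) \<le> \<epsilon> + \<eta>"
    using dist_triangle[of v "A s" x] s assms(2) by linarith
  ultimately show ?thesis
    unfolding near_equilateral_def using s by (intro exI[of _ s]) auto
qed

lemma near_equilateral_dist:
  assumes "near_equilateral \<epsilon> x y z"
  shows "c / 3 - 2 * \<epsilon> \<le> dist x y"
proof -
  obtain s where s: "dist x (A s) \<le> \<epsilon>" "dist y (A (s + 1/3)) \<le> \<epsilon>"
    using assms unfolding near_equilateral_def by blast
  show ?thesis
    using dist_A_third[of s] s dist_triangle[of "A s" "A (s + 1/3)" x] dist_triangle[of x "A (s + 1/3)" y]
    by (simp add: dist_commute)
qed

text \<open>If both orders were possible, the two base points would be within \<open>2 * \<epsilon>\<close> of each other, and \<open>y\<close> would be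
  close to two points of the circle a third apart.\<close>

lemma near_equilateral_oriented:
  assumes "near_equilateral \<epsilon> x y z" "\<epsilon> < c / 12"
  shows "\<not> near_equilateral \<epsilon> x z y"
proof
  assume "near_equilateral \<epsilon> x z y"
  then obtain t where t: "dist x (A t) \<le> \<epsilon>" "dist y (A (t + 2/3)) \<le> \<epsilon>"
    unfolding near_equilateral_def by blast
  obtain s where s: "dist x (A s) \<le> \<epsilon>" "dist y (A (s + 1/3)) \<le> \<epsilon>"
    using assms unfolding near_equilateral_def by blast
  have "dist (A s) (A t) \<le> 2 * \<epsilon>"
    using s(1) t(1) dist_triangle[of "A s" "A t" x] by (simp add: dist_commute)
  then have "dist (A (s + 1/3)) (A (t + 1/3)) \<le> 2 * \<epsilon>"
    by (simp add: dist_A_shift)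
  moreover have "dist (A (s + 1/3)) (A (t + 2/3)) \<le> 2 * \<epsilon>"
    using s(2) t(2) dist_triangle[of "A (s + 1/3)" "A (t + 2/3)" y] by (simp add: dist_commute)
  ultimately have "dist (A (t + 1/3)) (A (t + 2/3)) \<le> 4 * \<epsilon>"
    using dist_triangle[of "A (t + 1/3)" "A (t + 2/3)" "A (s + 1/3)"] by (simp add: dist_commute)
  moreover have "dist (A (t + 1/3)) (A (t + 2/3)) = c / 3"
    using dist_A_third[of "t + 1/3"] by (simp add: add.assoc)
  ultimately show False using assms(2) by linarith
qed

text \<open>Three points of the circle near an equilateral triangle whose sides do not exceed a third of the
  circumference form an equilateral triangle: the three arcs between them add up to the circle.\<close>

lemma near_equilateral_on_circle:
  assumes "near_equilateral \<epsilon> x y z" "\<epsilon> \<le> c / 24"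
    and on: "x \<in> range A" "y \<in> range A" "z \<in> range A"
    and sides: "dist x y \<le> c / 3" "dist y z \<le> c / 3" "dist x z \<le> c / 3"
  shows "near_equilateral 0 x y z"
proof -
  obtain s where s: "dist x (A s) \<le> \<epsilon>" "dist y (A (s + 1/3)) \<le> \<epsilon>" "dist z (A (s + 2/3)) \<le> \<epsilon>"
    using assms unfolding near_equilateral_def by blast
  have offset: "\<exists>e. \<bar>e\<bar> \<le> 1/24 \<and> w = A (t + e)" if w: "w \<in> range A" "dist w (A t) \<le> \<epsilon>" for w t
  proof -
    obtain u where "w = A u" using w(1) by blast
    then obtain e where e: "w = A (t + e)" "dist w (A t) = c * \<bar>e\<bar>"
      using A_near_parameter[of u t] by metis
    have "c * \<bar>e\<bar> \<le> c * (1/24)"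
      using w(2) e(2) assms(2) by simp
    then have "\<bar>e\<bar> \<le> 1/24" using c_pos by simp
    with e show ?thesis by blast
  qed
  obtain e1 where e1: "\<bar>e1\<bar> \<le> 1/24" "x = A (s + e1)" using offset on s by blast
  obtain e2 where e2: "\<bar>e2\<bar> \<le> 1/24" "y = A (s + 1/3 + e2)" using offset on s by blast
  obtain e3 where e3: "\<bar>e3\<bar> \<le> 1/24" "z = A (s + 2/3 + e3)" using offset on s by blast
  have arc: "b - a \<le> 1/3" if "dist (A a) (A b) \<le> c / 3" "\<bar>b - a - 1/3\<bar> \<le> 1/12" for a b
  proof -
    have "\<bar>a - b\<bar> \<le> 1/2" using that(2) by linarith
    then have "c * \<bar>a - b\<bar> \<le> c * (1/3)"
      using that(1) dist_A_eq[of a b] by simp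
    then have "\<bar>a - b\<bar> \<le> 1/3" using c_pos mult_le_cancel_left_pos by blast
    then show ?thesis by linarith
  qed
  \<comment> \<open>Each short side says that the offset does not increase along it; going once around, all are equal.\<close>
  have x': "x = A (s + e1 + 1)" using e1(2) A_plus_1 by metis
  have "(s + 1/3 + e2) - (s + e1) \<le> 1/3"
    using sides(1) e1 e2 by (intro arc) (simp, linarith)
  then have "e2 \<le> e1" by linarith
  moreover have "(s + 2/3 + e3) - (s + 1/3 + e2) \<le> 1/3"
    using sides(2) e2 e3 by (intro arc) (simp, linarith)
  then have "e3 \<le> e2" by linarith
  moreover have "(s + e1 + 1) - (s + 2/3 + e3) \<le> 1/3"
    using sides(3) x' e1 e3 by (intro arc) (simp add: dist_commute, linarith)
  then have "e1 \<le> e3" by linarith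
  ultimately have "e2 = e1" "e3 = e1" by auto
  then show ?thesis
    unfolding near_equilateral_def using e1 e2 e3
    by (intro exI[of _ "s + e1"]) (simp add: algebra_simps)
qed

lemma near_equilateral_0D:
  assumes "near_equilateral 0 x y z"
  shows "x \<in> range A \<and> y \<in> range A \<and> z \<in> range A \<and> dist x y = c / 3 \<and> dist y z = c / 3 \<and> dist x z = c / 3"
proof -
  obtain s where s: "x = A s" "y = A (s + 1/3)" "z = A (s + 2/3)"
    using assms unfolding near_equilateral_def by auto
  have "dist x y = c / 3" using s dist_A_third by simp
  moreover have "dist y z = c / 3" using s dist_A_third[of "s + 1/3"] by (simp add: add.assoc)
  moreover have "dist x z = c / 3"
    using s dist_A_third[of "s + 2/3"] A_plus_1[of s] by (simp add: dist_commute add.assoc)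
  ultimately show ?thesis using s by blast
qed

end

section \<open>Rigidity of equilateral triangles on a bottleneck circle\<close>

text \<open>The function \<open>m\<close> plays the role of arc length; inscribed sums are dominated by a telescoping sum.\<close>

lemma curve_length_le:
  assumes "\<And>s t. \<lbrakk>0 \<le> s; s \<le> t; t \<le> 1\<rbrakk> \<Longrightarrow> dist (p s) (p t) \<le> m t - m s"
  shows "curve_length p \<le> ereal (m 1 - m 0)"
  unfolding curve_length_def
proof (rule SUP_least)
  fix ts assume "ts \<in> {ts. sorted ts \<and> set ts \<subseteq> {0..1::real}}"
  then have ts: "sorted ts" "set ts \<subseteq> {0..1}" by auto
  have mono: "m s \<le> m t" if "0 \<le> s" "s \<le> t" "t \<le> 1" for s t
    using assms[OF that] zero_le_dist[of "p s" "p t"] by linarith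
  have "(\<Sum>i<length ts - 1. dist (p (ts ! i)) (p (ts ! Suc i))) \<le> m 1 - m 0"
  proof (cases "ts = []")
    case True
    have "m 0 \<le> m 1" by (rule mono) simp_all
    then show ?thesis unfolding True by simp
  next
    case False
    have in01: "0 \<le> ts ! i \<and> ts ! i \<le> 1" if "i < length ts" for i
      using subsetD[OF ts(2) nth_mem[OF that]] by simp
    have "(\<Sum>i<length ts - 1. dist (p (ts ! i)) (p (ts ! Suc i)))
        \<le> (\<Sum>i<length ts - 1. m (ts ! Suc i) - m (ts ! i))"
    proof (rule sum_mono)
      fix i assume "i \<in> {..<length ts - 1}"
      then have i: "i < length ts" "Suc i < length ts" by auto
      then have "ts ! i \<le> ts ! Suc i" using ts(1) by (simp add: sorted_nth_mono)
      then show "dist (p (ts ! i)) (p (ts ! Suc i)) \<le> m (ts ! Suc i) - m (ts ! i)"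
        using assms in01[OF i(1)] in01[OF i(2)] by simp
    qed
    also have "\<dots> = m (ts ! (length ts - 1)) - m (ts ! 0)"
      by (rule sum_lessThan_telescope)
    also have "\<dots> \<le> m 1 - m 0"
      using mono[of "ts ! (length ts - 1)" 1] mono[of 0 "ts ! 0"]
        in01[of "length ts - 1"] in01[of 0] False by simp
    finally show ?thesis .
  qed
  then show "ereal (\<Sum>i<length ts - 1. dist (p (ts ! i)) (p (ts ! Suc i))) \<le> ereal (m 1 - m 0)"
    by simp
qed

lemma curve_length_ge:
  "sorted ts \<Longrightarrow> set ts \<subseteq> {0..1} \<Longrightarrow>
     ereal (\<Sum>i<length ts - 1. dist (p (ts ! i)) (p (ts ! Suc i))) \<le> curve_length p"
  unfolding curve_length_def by (rule SUP_upper) auto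

text \<open>The corners sit at thirds of the parameter interval, as for an equilateral triangle on the circle, so that
  the loop can be compared with the circle pointwise.\<close>

definition triangle_loop :: "(real \<Rightarrow> 'a) \<Rightarrow> (real \<Rightarrow> 'a) \<Rightarrow> (real \<Rightarrow> 'a) \<Rightarrow> real \<Rightarrow> 'a" where
  "triangle_loop p q r t =
     (if t \<le> 1/3 then p (3 * t) else if t \<le> 2/3 then q (3 * t - 1) else r (3 * t - 2))"

lemma is_loop_triangle_loop:
  assumes "geodesic_path x y p" "geodesic_path y z q" "geodesic_path z x r"
  shows "is_loop (triangle_loop p q r)"
proof -
  note ends = assms[unfolded geodesic_path_def pathstart_def pathfinish_def]
  have cont: "continuous_on {0..1} p" "continuous_on {0..1} q" "continuous_on {0..1} r"
    using assms[THEN path_geodesic_path] by (auto simp: path_def)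
  have cq: "continuous_on {1/3..2/3} (\<lambda>t. q (3 * t - 1))" and cr: "continuous_on {2/3..1} (\<lambda>t. r (3 * t - 2))"
    and cp: "continuous_on {0..1/3} (\<lambda>t. p (3 * t))"
    by (rule continuous_on_compose2[OF cont(2)] continuous_on_compose2[OF cont(3)]
          continuous_on_compose2[OF cont(1)]; auto intro!: continuous_intros)+
  have inner: "continuous_on {t \<in> {0..1}. 1/3 \<le> t} (\<lambda>t. if t \<le> 2/3 then q (3 * t - 1) else r (3 * t - 2))"
  proof (rule continuous_on_cases_le[where h = "\<lambda>t. t" and a = "2/3"])
    show "q (3 * t - 1) = r (3 * t - 2)" if "t = 2/3" for t
      unfolding that using ends by simp
    show "continuous_on {t \<in> {t \<in> {0..1}. 1/3 \<le> t}. t \<le> 2/3} (\<lambda>t. q (3 * t - 1))"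
      by (rule continuous_on_subset[OF cq]) auto
    show "continuous_on {t \<in> {t \<in> {0..1}. 1/3 \<le> t}. 2/3 \<le> t} (\<lambda>t. r (3 * t - 2))"
      by (rule continuous_on_subset[OF cr]) auto
  qed simp
  have "continuous_on {0..1} (\<lambda>t. if t \<le> 1/3 then p (3 * t) else if t \<le> 2/3 then q (3 * t - 1) else r (3 * t - 2))"
  proof (rule continuous_on_cases_le[where h = "\<lambda>t. t" and a = "1/3", OF _ inner])
    show "p (3 * t) = (if t \<le> 2/3 then q (3 * t - 1) else r (3 * t - 2))" if "t = 1/3" for t
      unfolding that using ends by simp
    show "continuous_on {t \<in> {0..1}. t \<le> 1/3} (\<lambda>t. p (3 * t))"
      by (rule continuous_on_subset[OF cp]) auto
  qed simp
  then have "path (triangle_loop p q r)"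
    by (simp add: path_def triangle_loop_def[abs_def])
  then show ?thesis
    using ends by (simp add: is_loop_def pathstart_def pathfinish_def triangle_loop_def)
qed

lemma dist_le_join:
  fixes m :: "real \<Rightarrow> real"
  assumes "\<And>s t. \<lbrakk>a \<le> s; s \<le> t; t \<le> b\<rbrakk> \<Longrightarrow> dist (p s) (p t) \<le> m t - m s"
    and "\<And>s t. \<lbrakk>b \<le> s; s \<le> t; t \<le> d\<rbrakk> \<Longrightarrow> dist (p s) (p t) \<le> m t - m s"
    and st: "a \<le> s" "s \<le> t" "t \<le> d"
  shows "dist (p s) (p t) \<le> m t - m s"
proof (cases "s \<le> b \<and> b \<le> t")
  case True
  then show ?thesis
    using assms(1)[of s b] assms(2)[of b t] st dist_triangle[of "p s" "p t" "p b"] by linarith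
qed (use assms in auto)

lemma curve_length_triangle_loop:
  assumes "geodesic_path x y p" "geodesic_path y z q" "geodesic_path z x r"
  shows "curve_length (triangle_loop p q r) \<le> ereal (dist x y + dist y z + dist z x)"
proof -
  define m where "m t = (if t \<le> 1/3 then dist x y * (3 * t) else if t \<le> 2/3 then dist x y + dist y z * (3 * t - 1)
     else dist x y + dist y z + dist z x * (3 * t - 2))" for t :: real
  let ?l = "triangle_loop p q r"
  note ends = assms[unfolded geodesic_path_def pathstart_def pathfinish_def]
  have pieces: "?l t = p (3 * t) \<and> m t = dist x y * (3 * t)" if "t \<le> 1/3" for t
    using that by (simp add: triangle_loop_def m_def)
  have pieces': "?l t = q (3 * t - 1) \<and> m t = dist x y + dist y z * (3 * t - 1)" if "1/3 \<le> t" "t \<le> 2/3" for t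
  proof (cases "t = 1/3")
    case True
    show ?thesis unfolding True triangle_loop_def m_def using ends by simp
  qed (use that in \<open>simp add: triangle_loop_def m_def\<close>)
  have pieces'': "?l t = r (3 * t - 2) \<and> m t = dist x y + dist y z + dist z x * (3 * t - 2)" if "2/3 \<le> t" for t
  proof (cases "t = 2/3")
    case True
    show ?thesis unfolding True triangle_loop_def m_def using ends by simp
  qed (use that in \<open>simp add: triangle_loop_def m_def\<close>)
  have 1: "dist (?l s) (?l t) \<le> m t - m s" if "0 \<le> s" "s \<le> t" "t \<le> 1/3" for s t
    using that ends pieces[of s] pieces[of t] by (simp add: algebra_simps)
  have 2: "dist (?l s) (?l t) \<le> m t - m s" if "1/3 \<le> s" "s \<le> t" "t \<le> 2/3" for s t
    using that ends pieces'[of s] pieces'[of t] by (simp add: algebra_simps)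
  have 3: "dist (?l s) (?l t) \<le> m t - m s" if "2/3 \<le> s" "s \<le> t" "t \<le> 1" for s t
    using that ends pieces''[of s] pieces''[of t] by (simp add: algebra_simps)
  have "dist (?l s) (?l t) \<le> m t - m s" if "0 \<le> s" "s \<le> t" "t \<le> 1" for s t
    by (rule dist_le_join[where p = ?l and m = m, OF dist_le_join[where p = ?l and m = m, OF 1 2] 3 that])
  from curve_length_le[of ?l m, OF this] show ?thesis
    by (simp add: m_def)
qed

text \<open>A Lebesgue number for the cover by balls whose loops contract in \<open>W\<close>.\<close>

lemma uniform_semilocal_simple_connectedness:
  fixes S W :: "'a::metric_space set"
  assumes "semilocally_simply_connected TYPE('a)" "compact S" "open W" "S \<subseteq> W"
  obtains \<delta> where "\<delta> > 0" "\<And>x. x \<in> S \<Longrightarrow> ball x \<delta> \<subseteq> W"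
    "\<And>x r. x \<in> S \<Longrightarrow> is_loop r \<Longrightarrow> path_image r \<subseteq> ball x \<delta> \<Longrightarrow> \<exists>y. homotopic_loops W r (\<lambda>_. y)"
proof -
  define good where "good G \<longleftrightarrow> open G \<and> G \<subseteq> W \<and>
    (\<forall>r. is_loop r \<and> path_image r \<subseteq> G \<longrightarrow> (\<exists>y. homotopic_loops W r (\<lambda>_. y)))" for G :: "'a set"
  have "\<exists>G. good G \<and> x \<in> G" if x: "x \<in> S" for x
  proof -
    obtain e where e: "e > 0" "ball x e \<subseteq> W"
      using assms x by (meson open_contains_ball subset_eq)
    obtain d where d: "d > 0" "\<And>r. is_loop r \<Longrightarrow> path_image r \<subseteq> ball x d \<Longrightarrow>
        \<exists>y. homotopic_loops (ball x e) r (\<lambda>_. y)"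
      using assms(1) e(1) unfolding semilocally_simply_connected_def by meson
    have "good (ball x (min d e))"
      unfolding good_def
    proof (intro conjI allI impI)
      fix r :: "real \<Rightarrow> 'a" assume r: "is_loop r \<and> path_image r \<subseteq> ball x (min d e)"
      moreover have "ball x (min d e) \<subseteq> ball x d" by (simp add: subset_ball)
      ultimately obtain y where "homotopic_loops (ball x e) r (\<lambda>_. y)"
        using d(2) by blast
      then show "\<exists>y. homotopic_loops W r (\<lambda>_. y)"
        using e(2) homotopic_loops_subset by blast
    next
      show "ball x (min d e) \<subseteq> W" using e(2) subset_ball[of "min d e" e x] by auto
    qed simp
    then show ?thesis using d(1) e(1) by (intro exI[of _ "ball x (min d e)"]) simp
  qed
  then have "S \<subseteq> \<Union>{G. good G}" by blast
  moreover have "\<And>G. G \<in> {G. good G} \<Longrightarrow> open G" by (simp add: good_def)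
  ultimately obtain \<delta> where \<delta>: "0 < \<delta>" "\<And>x. x \<in> S \<Longrightarrow> \<exists>G\<in>{G. good G}. ball x \<delta> \<subseteq> G"
    using Heine_Borel_lemma[OF assms(2)] by blast
  show ?thesis
  proof (rule that[OF \<delta>(1)])
    show "ball x \<delta> \<subseteq> W" if "x \<in> S" for x
      using \<delta>(2)[OF that] unfolding good_def by blast
    show "\<exists>y. homotopic_loops W r (\<lambda>_. y)" if "x \<in> S" "is_loop r" "path_image r \<subseteq> ball x \<delta>" for x r
      using \<delta>(2)[OF that(1)] that(2,3) unfolding good_def by blast
  qed
qed

context isometric_circle
begin

lemma A_plus_int: "A (t + of_int n) = A t"
proof -
  have "dist (A (t + of_int n)) (A t) = 0" unfolding dist_A by simp
  then show ?thesis by simp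
qed

lemma is_loop_A: "is_loop (\<lambda>t. A (s + t))"
  using A_plus_1[of s]
  by (auto simp: is_loop_def path_def pathstart_def pathfinish_def
      intro!: continuous_on_compose2[OF continuous_on_A[of UNIV]] continuous_intros)

text \<open>Rotating the circle in itself sweeps out nothing but the circle.\<close>

lemma homotopic_loops_rotate:
  assumes "range A \<subseteq> W"
  shows "homotopic_loops W A (\<lambda>t. A (s + t))"
  unfolding homotopic_loops
proof (intro exI conjI ballI)
  show "continuous_on ({0..1} \<times> {0..1}) (\<lambda>(u, t). A (u * s + t))"
    unfolding case_prod_beta
    by (intro continuous_on_compose2[OF continuous_on_A[of UNIV]] continuous_intros) auto
  show "(\<lambda>(u, t). A (u * s + t)) \<in> {0..1} \<times> {0..1} \<rightarrow> W"
    using assms by auto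
  show "pathfinish ((\<lambda>(u, t). A (u * s + t)) \<circ> Pair u) = pathstart ((\<lambda>(u, t). A (u * s + t)) \<circ> Pair u)" for u
    using A_plus_1[of "u * s"] by (simp add: pathfinish_def pathstart_def)
qed auto

text \<open>A convex neighbourhood of the circle that is contained in its \<open>\<eta>\<close>-neighbourhood keeps the geodesic close to
  the circle. A point of the circle near the point at time \<open>t\<close> has almost the right distances
  to both ends of the arc, and these determine it.\<close>

lemma geodesic_near_arc:
  assumes V: "geodesically_convex V" "\<And>w. w \<in> V \<Longrightarrow> \<exists>t. dist w (A t) < \<eta>"
    and xy: "x \<in> V" "y \<in> V" "dist x (A s) \<le> \<epsilon>" "dist y (A (s + 1/3)) \<le> \<epsilon>" "dist x y \<le> c / 3"
    and \<gamma>: "geodesic_from_to \<gamma> x y" and \<tau>: "0 \<le> \<tau>" "\<tau> \<le> 1"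
    and small: "2 * \<eta> + 2 * \<epsilon> < c / 3"
  shows "dist (\<gamma> (dist x y * \<tau>)) (A (s + \<tau> / 3)) \<le> 4 * \<eta> + 5 * \<epsilon>"
proof -
  define L where "L = dist x y"
  define m where "m = \<gamma> (L * \<tau>)"
  have L: "c / 3 - 2 * \<epsilon> \<le> L" "L \<le> c / 3" "0 \<le> L" "0 \<le> \<epsilon>"
    using dist_A_third[of s] xy dist_triangle[of "A s" "A (s + 1/3)" x] dist_triangle[of x "A (s + 1/3)" y]
      zero_le_dist[of x "A s"] zero_le_dist[of x y] dist_commute[of "A s" x]
    unfolding L_def by linarith+
  have L\<tau>: "L * \<tau> \<in> {0..L}" using \<tau> L by (auto simp: mult_left_le)
  have "m \<in> V"
    using V(1) xy(1,2) \<gamma> L\<tau> unfolding geodesically_convex_def m_def L_def by blast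
  then obtain t where t: "dist m (A t) < \<eta>" using V(2) by blast
  have ends: "\<gamma> 0 = x" "\<gamma> L = y" using \<gamma> by (auto simp: geodesic_from_to_def L_def)
  have "\<And>s t. \<lbrakk>s \<in> {0..L}; t \<in> {0..L}\<rbrakk> \<Longrightarrow> dist (\<gamma> s) (\<gamma> t) = \<bar>s - t\<bar>"
    using \<gamma> by (auto simp: geodesic_from_to_def L_def)
  from this[of 0 "L * \<tau>"] this[of "L * \<tau>" L] have mx: "dist x m = L * \<tau>" and my: "dist m y = L - L * \<tau>"
    using L\<tau> L ends by (auto simp: m_def)
  define d where "d = dist (A t) (A s)"
  have d: "d \<le> L * \<tau> + \<eta> + \<epsilon>" "L * \<tau> - \<eta> - \<epsilon> \<le> d"
    using t mx xy(3) dist_triangle[of "A t" "A s" m] dist_triangle[of m "A s" x]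
      dist_triangle[of x m "A s"] dist_triangle[of "A s" m "A t"]
    by (auto simp: d_def dist_commute)
  have "dist (A t) (A (s + 1/3)) \<le> \<eta> + (L - L * \<tau>) + \<epsilon>"
    using t my xy(4) dist_triangle[of "A t" "A (s + 1/3)" m] dist_triangle[of m "A (s + 1/3)" y]
    by (auto simp: dist_commute)
  then have "dist (A t) (A s) + dist (A t) (A (s + 1/3)) \<le> c / 3 + (2 * \<eta> + 2 * \<epsilon>)"
    using d L by (simp add: d_def)
  then have near: "dist (A t) (A (s + d / c)) \<le> 2 * \<eta> + 2 * \<epsilon>"
    using near_arc[of "A t" s] small unfolding d_def by blast
  have "(c / 3 - L) * \<tau> \<le> (2 * \<epsilon>) * 1"
    using L \<tau> by (intro mult_mono) auto
  moreover have "0 \<le> (c / 3 - L) * \<tau>" using L \<tau> by simp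
  ultimately have "\<bar>d - c / 3 * \<tau>\<bar> \<le> \<eta> + 3 * \<epsilon>"
    using d by (simp add: left_diff_distrib)
  moreover have "dist (A (s + d / c)) (A (s + \<tau> / 3)) \<le> c * \<bar>d / c - \<tau> / 3\<bar>"
    using dist_A_le[of "s + d / c" "s + \<tau> / 3"] by simp
  moreover have "c * \<bar>d / c - \<tau> / 3\<bar> = \<bar>d - c / 3 * \<tau>\<bar>"
    using c_pos by (simp add: abs_mult_pos' right_diff_distrib)
  ultimately have "dist (A (s + d / c)) (A (s + \<tau> / 3)) \<le> \<eta> + 3 * \<epsilon>"
    by linarith
  then have "dist m (A (s + \<tau> / 3)) \<le> \<eta> + (2 * \<eta> + 2 * \<epsilon>) + (\<eta> + 3 * \<epsilon>)"
    using t near dist_triangle[of m "A (s + \<tau> / 3)" "A t"]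
      dist_triangle[of "A t" "A (s + \<tau> / 3)" "A (s + d / c)"] by linarith
  then show ?thesis unfolding m_def L_def by simp
qed

text \<open>This is where the bottleneck property enters. The geodesic triangle on points near an equilateral triangle is
  uniformly close to the circle, hence homotopic to it nearby. If its sides are at most a third
  of the circumference, it is not longer than the circle, so by the bottleneck property it runs
  on the circle, and its corners are points of the circle.\<close>

lemma rigid_near_equilateral:
  assumes geo: "geodesic_space TYPE('a)" and semiloc: "semilocally_simply_connected TYPE('a)"
    and convex: "\<And>W. open W \<Longrightarrow> range A \<subseteq> W \<Longrightarrow> \<exists>V\<subseteq>W. range A \<subseteq> interior V \<and> geodesically_convex V"
    and W0: "open W0" "range A \<subseteq> W0"
    and bottleneck: "\<And>q. is_loop q \<Longrightarrow> homotopic_loops W0 q A \<Longrightarrow> curve_length q \<le> ereal c \<Longrightarrow>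
        path_image q \<subseteq> range A"
  obtains \<epsilon> where "\<epsilon> > 0" "\<epsilon> \<le> c / 24"
    "\<And>x y z. near_equilateral \<epsilon> x y z \<Longrightarrow> dist x y \<le> c / 3 \<Longrightarrow> dist y z \<le> c / 3 \<Longrightarrow> dist x z \<le> c / 3 \<Longrightarrow>
       near_equilateral 0 x y z"
proof -
  obtain \<delta> where \<delta>: "\<delta> > 0" "\<And>x. x \<in> range A \<Longrightarrow> ball x \<delta> \<subseteq> W0"
    "\<And>x r. x \<in> range A \<Longrightarrow> is_loop r \<Longrightarrow> path_image r \<subseteq> ball x \<delta> \<Longrightarrow> \<exists>y. homotopic_loops W0 r (\<lambda>_. y)"
    using uniform_semilocal_simple_connectedness[OF semiloc compact_range_A W0] by metis
  \<comment> \<open>Small enough that the error \<open>4 * \<eta> + 5 * \<epsilon>\<close> in the comparison with the arcs is less than \<open>\<delta> / 4\<close> when \<open>\<epsilon> \<le> \<eta>\<close>.\<close>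
  define \<eta> where "\<eta> = min (\<delta> / 64) (c / 64)"
  have \<eta>: "\<eta> > 0" "\<eta> \<le> \<delta> / 64" "\<eta> \<le> c / 64"
    using \<delta>(1) c_pos unfolding \<eta>_def by (auto simp: min_def)
  have "open (\<Union>t. ball (A t) \<eta>)" "range A \<subseteq> (\<Union>t. ball (A t) \<eta>)"
    using \<eta>(1) by auto
  from convex[OF this] obtain V where V: "V \<subseteq> (\<Union>t. ball (A t) \<eta>)" "range A \<subseteq> interior V" "geodesically_convex V"
    by blast
  obtain \<epsilon>1 where \<epsilon>1: "\<epsilon>1 > 0" "(\<Union>x\<in>range A. cball x \<epsilon>1) \<subseteq> interior V"
    using compact_subset_open_imp_cball_epsilon_subset[OF compact_range_A open_interior V(2)] by blast
  \<comment> \<open>Every point within \<open>\<epsilon>1\<close> of the circle lies in the convex neighbourhood.\<close>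
  define \<epsilon> where "\<epsilon> = min \<epsilon>1 \<eta>"
  have \<epsilon>: "\<epsilon> > 0" "\<epsilon> \<le> \<eta>" "\<epsilon> \<le> \<epsilon>1" using \<epsilon>1(1) \<eta>(1) by (auto simp: \<epsilon>_def)
  have inV: "w \<in> V" if "dist w (A t) \<le> \<epsilon>" for w t
  proof -
    have "w \<in> cball (A t) \<epsilon>1" using that \<epsilon>(3) by (simp add: dist_commute)
    then show ?thesis using \<epsilon>1(2) interior_subset by blast
  qed
  have Vnear: "\<exists>t. dist w (A t) < \<eta>" if "w \<in> V" for w
  proof -
    obtain t where "w \<in> ball (A t) \<eta>" using V(1) \<open>w \<in> V\<close> by blast
    then show ?thesis by (intro exI[of _ t]) (simp add: dist_commute)
  qed
  have small: "2 * \<eta> + 2 * \<epsilon> < c / 3" "4 * \<eta> + 5 * \<epsilon> < \<delta> / 4"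
    using \<eta> \<epsilon> c_pos \<delta>(1) by linarith+
  have conv: "\<exists>\<gamma>. geodesic_from_to \<gamma> x y" for x y :: 'a
    using geo unfolding geodesic_space_def by blast
  show ?thesis
  proof (rule that[OF \<epsilon>(1)])
    show "\<epsilon> \<le> c / 24" using \<epsilon>(2) \<eta>(3) c_pos by linarith
  next
    fix x y z
    assume near: "near_equilateral \<epsilon> x y z" and sides: "dist x y \<le> c / 3" "dist y z \<le> c / 3" "dist x z \<le> c / 3"
    obtain s where s: "dist x (A s) \<le> \<epsilon>" "dist y (A (s + 1/3)) \<le> \<epsilon>" "dist z (A (s + 2/3)) \<le> \<epsilon>"
      using near unfolding near_equilateral_def by blast
    obtain \<gamma>1 \<gamma>2 \<gamma>3 where \<gamma>: "geodesic_from_to \<gamma>1 x y" "geodesic_from_to \<gamma>2 y z" "geodesic_from_to \<gamma>3 z x"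
      using conv by meson
    let ?g1 = "\<lambda>t. \<gamma>1 (dist x y * t)" and ?g2 = "\<lambda>t. \<gamma>2 (dist y z * t)" and ?g3 = "\<lambda>t. \<gamma>3 (dist z x * t)"
    note g = \<gamma>[THEN geodesic_from_to_imp_geodesic_path]
    define q where "q = triangle_loop ?g1 ?g2 ?g3"
    have loop: "is_loop q" unfolding q_def by (rule is_loop_triangle_loop[OF g])
    have "curve_length q \<le> ereal (dist x y + dist y z + dist z x)"
      unfolding q_def by (rule curve_length_triangle_loop[OF g])
    also have "\<dots> \<le> ereal c" using sides by (simp add: dist_commute)
    finally have len: "curve_length q \<le> ereal c" .
    have eqs: "s + 1/3 + 1/3 = s + 2/3" "s + 2/3 + 1/3 = s + 1" by simp_all
    have s': "dist z (A (s + 1/3 + 1/3)) \<le> \<epsilon>" "dist x (A (s + 2/3 + 1/3)) \<le> \<epsilon>"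
      unfolding eqs A_plus_1 by fact+
    note arc = geodesic_near_arc[OF V(3) Vnear, where \<epsilon> = \<epsilon>]
    have "dist (A (s + t)) (q t) \<le> 4 * \<eta> + 5 * \<epsilon>" if t: "t \<in> {0..1}" for t
    proof -
      consider "t \<le> 1/3" | "1/3 < t" "t \<le> 2/3" | "2/3 < t" by linarith
      then show ?thesis
      proof cases
        case 1
        have eq: "s + 3 * t / 3 = s + t" by simp
        have "dist (\<gamma>1 (dist x y * (3 * t))) (A (s + 3 * t / 3)) \<le> 4 * \<eta> + 5 * \<epsilon>"
          by (rule arc[OF _ inV[OF s(1)] inV[OF s(2)] s(1) s(2) sides(1) \<gamma>(1)]) (use 1 t small(1) in auto)
        then show ?thesis
          unfolding eq using 1 by (simp add: q_def triangle_loop_def dist_commute)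
      next
        case 2
        have eq: "s + 1/3 + (3 * t - 1) / 3 = s + t" by (simp add: field_simps)
        have "dist (\<gamma>2 (dist y z * (3 * t - 1))) (A (s + 1/3 + (3 * t - 1) / 3)) \<le> 4 * \<eta> + 5 * \<epsilon>"
          by (rule arc[OF _ inV[OF s(2)] inV[OF s(3)] s(2) s'(1) sides(2) \<gamma>(2)]) (use 2 t small(1) in auto)
        then show ?thesis
          unfolding eq using 2 by (simp add: q_def triangle_loop_def dist_commute)
      next
        case 3
        have eq: "s + 2/3 + (3 * t - 2) / 3 = s + t" by (simp add: field_simps)
        have zx: "dist z x \<le> c / 3" using sides(3) by (simp add: dist_commute)
        have "dist (\<gamma>3 (dist z x * (3 * t - 2))) (A (s + 2/3 + (3 * t - 2) / 3)) \<le> 4 * \<eta> + 5 * \<epsilon>"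
          by (rule arc[OF _ inV[OF s(3)] inV[OF s(1)] s(3) s'(2) zx \<gamma>(3)]) (use 3 t small(1) in auto)
        then show ?thesis
          unfolding eq using 3 by (simp add: q_def triangle_loop_def dist_commute)
      qed
    qed
    then have close: "dist (A (s + t)) (q t) < \<delta> / 4" if "t \<in> {0..1}" for t
      using that small(2) by (meson le_less_trans)
    have "homotopic_loops W0 (\<lambda>t. A (s + t)) q"
    proof (rule homotopic_loops_nearby_metric[OF geo is_loop_A loop \<delta>(1)])
      show "ball w \<delta> \<subseteq> W0" if "w \<in> path_image (\<lambda>t. A (s + t))" for w
        using that by (intro \<delta>(2)) (auto simp: path_image_def)
      show "\<exists>y. homotopic_loops W0 r (\<lambda>_. y)"
        if "w \<in> path_image (\<lambda>t. A (s + t))" "is_loop r" "path_image r \<subseteq> ball w \<delta>" for w r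
        using that by (intro \<delta>(3)[of w r]) (auto simp: path_image_def)
    qed (rule close)
    then have "homotopic_loops W0 q A"
      using homotopic_loops_rotate[OF W0(2), of s] homotopic_loops_sym homotopic_loops_trans by blast
    then have img: "path_image q \<subseteq> range A"
      using bottleneck loop len by blast
    have "q 0 = x" "q (1/3) = y" "q (2/3) = z"
      using g by (auto simp: q_def triangle_loop_def geodesic_path_def pathstart_def pathfinish_def)
    moreover have "q t \<in> range A" if "t \<in> {0..1}" for t
      using img that by (auto simp: path_image_def)
    from this[of 0] this[of "1/3"] this[of "2/3"] have "q 0 \<in> range A" "q (1/3) \<in> range A" "q (2/3) \<in> range A"
      by simp_all
    ultimately have "x \<in> range A" "y \<in> range A" "z \<in> range A" by simp_all
    moreover have "\<epsilon> \<le> c / 24" using \<epsilon>(2) \<eta>(3) c_pos by linarith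
    ultimately show "near_equilateral 0 x y z"
      using near_equilateral_on_circle near sides by blast
  qed
qed

end

lemma compact_neighbourhood:
  fixes S :: "'a::metric_space set"
  assumes "locally compact (UNIV :: 'a set)" "compact S"
  obtains C where "compact C" "S \<subseteq> interior C"
proof -
  obtain u v where uv: "\<And>x::'a. x \<in> u x \<and> u x \<subseteq> v x \<and> open (u x) \<and> compact (v x)"
    using locally_compactE[OF assms(1)] by (metis UNIV_I open_openin subtopology_UNIV)
  obtain T where T: "T \<subseteq> S" "finite T" "S \<subseteq> (\<Union>x\<in>T. u x)"
    using compactE_image[OF assms(2), of S u] uv by blast
  show ?thesis
  proof
    show "compact (\<Union>x\<in>T. v x)" using T uv by (intro compact_UN) auto
    have "open (\<Union>x\<in>T. u x)" "(\<Union>x\<in>T. u x) \<subseteq> (\<Union>x\<in>T. v x)"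
      using uv by (blast intro: open_UN)+
    then show "S \<subseteq> interior (\<Union>x\<in>T. v x)"
      using T(3) interior_maximal by blast
  qed
qed

context isometric_circle
begin

text \<open>On the compact set of triples that are within \<open>\<epsilon>\<close>, but not within \<open>\<epsilon>'\<close>, of an equilateral triangle, the longest
  side attains its minimum. By rigidity this minimum exceeds a third of the circumference.\<close>

lemma near_equilateral_gap:
  assumes C: "compact C" "\<And>w t. dist w (A t) \<le> \<epsilon> \<Longrightarrow> w \<in> C"
    and rigid: "\<And>x y z. near_equilateral \<epsilon> x y z \<Longrightarrow> dist x y \<le> c / 3 \<Longrightarrow> dist y z \<le> c / 3 \<Longrightarrow>
       dist x z \<le> c / 3 \<Longrightarrow> near_equilateral 0 x y z"
    and "\<epsilon>' > 0"
  obtains B where "B > c / 3" "\<And>x y z. near_equilateral \<epsilon> x y z \<Longrightarrow> dist x y < B \<Longrightarrow> dist y z < B \<Longrightarrow>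
       dist x z < B \<Longrightarrow> near_equilateral \<epsilon>' x y z"
proof -
  define near where "near p s \<longleftrightarrow> dist (fst p) (A s) \<le> \<epsilon> \<and> dist (fst (snd p)) (A (s + 1/3)) \<le> \<epsilon> \<and>
      dist (snd (snd p)) (A (s + 2/3)) \<le> \<epsilon>" for p s
  define P where "P = (\<Union>s. {p. dist (fst p) (A s) < \<epsilon>' \<and> dist (fst (snd p)) (A (s + 1/3)) < \<epsilon>' \<and>
      dist (snd (snd p)) (A (s + 2/3)) < \<epsilon>'})"
  \<comment> \<open>The base point \<open>s\<close> of a nearby equilateral triangle is kept as a fourth coordinate, so that the set is
    visibly closed.\<close>
  define T where "T = {q. near (fst q) (snd q)} \<inter> (C \<times> C \<times> C) \<times> {0..1} \<inter> (- P) \<times> UNIV"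
  define f where "f q = max (dist (fst (fst q)) (fst (snd (fst q))))
      (max (dist (fst (snd (fst q))) (snd (snd (fst q)))) (dist (fst (fst q)) (snd (snd (fst q)))))"
    for q :: "('a \<times> 'a \<times> 'a) \<times> real"
  have contA: "continuous_on X (\<lambda>x. A (g x))" if "continuous_on X g" for X :: "'b::topological_space set" and g
    using continuous_on_compose2[OF continuous_on_A[of UNIV] that] by simp
  have "open P"
    unfolding P_def
    by (intro open_UN ballI open_Collect_conj open_Collect_less continuous_intros)
  have "closed {q. near (fst q) (snd q)}"
    unfolding near_def
    by (intro closed_Collect_conj closed_Collect_le continuous_intros contA)
  moreover have "compact ((C \<times> C \<times> C) \<times> {0..1::real})"
    using C(1) by (intro compact_Times) auto
  moreover have "closed ((- P) \<times> (UNIV :: real set))"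
    using \<open>open P\<close> by (intro closed_Times) auto
  ultimately have "compact T"
    unfolding T_def by (intro compact_Int_closed closed_Int_compact)
  have "continuous_on T f"
    unfolding f_def by (intro continuous_intros)
  have inT: "\<exists>s. ((x, y, z), s) \<in> T" if near_xyz: "near_equilateral \<epsilon> x y z" and "\<not> near_equilateral \<epsilon>' x y z" for x y z
  proof -
    obtain s where s: "dist x (A s) \<le> \<epsilon>" "dist y (A (s + 1/3)) \<le> \<epsilon>" "dist z (A (s + 2/3)) \<le> \<epsilon>"
      using near_xyz unfolding near_equilateral_def by blast
    have "A (frac s + u) = A (s + u)" for u
      using A_plus_int[of "frac s + u" "\<lfloor>s\<rfloor>"] by (simp add: frac_def algebra_simps)
    from this[of 0] this[of "1/3"] this[of "2/3"] have "near (x, y, z) (frac s)"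
      using s by (simp add: near_def)
    moreover have "(x, y, z) \<notin> P"
      using that(2) unfolding P_def near_equilateral_def by (force dest: less_imp_le)
    ultimately show ?thesis
      using C(2) s frac_ge_0[of s] frac_lt_1[of s] by (intro exI[of _ "frac s"]) (auto simp: T_def less_imp_le)
  qed
  show ?thesis
  proof (cases "T = {}")
    case True
    show ?thesis
      by (rule that[of "c / 3 + 1"]) (use inT True in auto)
  next
    case False
    obtain q where q: "q \<in> T" "\<And>q'. q' \<in> T \<Longrightarrow> f q \<le> f q'"
      using continuous_attains_inf[OF \<open>compact T\<close> False \<open>continuous_on T f\<close>] by blast
    obtain x y z s where xyz: "q = ((x, y, z), s)" by (metis prod.exhaust)
    show ?thesis
    proof (rule that[of "f q"])
      show "f q > c / 3"
      proof (rule ccontr)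
        assume "\<not> f q > c / 3"
        then have "dist x y \<le> c / 3" "dist y z \<le> c / 3" "dist x z \<le> c / 3"
          by (auto simp: f_def xyz)
        moreover have "near_equilateral \<epsilon> x y z"
          using q(1) unfolding xyz T_def near_def near_equilateral_def by auto
        ultimately have "near_equilateral 0 x y z" by (intro rigid)
        then obtain s' where "x = A s'" "y = A (s' + 1/3)" "z = A (s' + 2/3)"
          unfolding near_equilateral_def by auto
        then have "(x, y, z) \<in> P"
          unfolding P_def using \<open>\<epsilon>' > 0\<close> by (intro UN_I[of s']) simp_all
        then show False using q(1) by (simp add: xyz T_def)
      qed
    next
      fix x y z
      assume near: "near_equilateral \<epsilon> x y z" and d: "dist x y < f q" "dist y z < f q" "dist x z < f q"
      show "near_equilateral \<epsilon>' x y z"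
      proof (rule ccontr)
        assume "\<not> near_equilateral \<epsilon>' x y z"
        from inT[OF near this] obtain s where "((x, y, z), s) \<in> T" by blast
        have "f ((x, y, z), s) < f q" unfolding f_def[of "((x, y, z), s)"] using d by simp
        with q(2)[OF \<open>((x, y, z), s) \<in> T\<close>] show False by simp
      qed
    qed
  qed
qed

end

section \<open>Cutting a loop of length at most the circumference into thirds\<close>

fun polygon_length :: "(real \<Rightarrow> 'a::metric_space) \<Rightarrow> real list \<Rightarrow> real" where
  "polygon_length p (s # t # ts) = dist (p s) (p t) + polygon_length p (t # ts)"
| "polygon_length p _ = 0"

lemma polygon_length_eq_sum:
  "polygon_length p ts = (\<Sum>i<length ts - 1. dist (p (ts ! i)) (p (ts ! Suc i)))"
  by (induction p ts rule: polygon_length.induct) (auto simp: sum.lessThan_Suc_shift simp del: sum.lessThan_Suc)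

lemma polygon_length_append: "polygon_length p ts + polygon_length p us \<le> polygon_length p (ts @ us)"
proof (induction p ts rule: polygon_length.induct)
  case ("2_2" p s)
  then show ?case by (cases us) auto
qed auto

lemma polygon_length_const: "set ts \<subseteq> {a} \<Longrightarrow> polygon_length p ts = 0"
  by (induction p ts rule: polygon_length.induct) auto

definition length_le :: "(real \<Rightarrow> 'a::metric_space) \<Rightarrow> real \<Rightarrow> real \<Rightarrow> real \<Rightarrow> bool" where
  "length_le p a b L \<longleftrightarrow> (\<forall>ts. sorted ts \<and> set ts \<subseteq> {a..b} \<longrightarrow> polygon_length p ts \<le> L)"

lemma length_le_curve_length:
  assumes "curve_length p \<le> ereal L"
  shows "length_le p 0 1 L"
  unfolding length_le_def
proof (intro allI impI)
  fix ts assume "sorted ts \<and> set ts \<subseteq> {0..1::real}"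
  then have "ereal (polygon_length p ts) \<le> curve_length p"
    unfolding polygon_length_eq_sum by (intro curve_length_ge) auto
  then have "ereal (polygon_length p ts) \<le> ereal L" using assms by (rule order_trans)
  then show "polygon_length p ts \<le> L" by simp
qed

lemma sorted_map_monotone: "mono f \<Longrightarrow> sorted xs \<Longrightarrow> sorted (map f xs)"
  by (induction xs) (auto dest: monoD)

lemma continuous_on_polygon_length:
  assumes "continuous_on {a..b} p"
    and "\<And>s. s \<in> set ts \<Longrightarrow> continuous_on {a..b} (\<lambda>t. f t s) \<and> (\<forall>t\<in>{a..b}. f t s \<in> {a..b})"
  shows "continuous_on {a..b} (\<lambda>t. polygon_length p (map (f t) ts))"
  using assms(2)
proof (induction ts rule: induct_list012)
  case (3 x y ts)
  have "continuous_on {a..b} (\<lambda>t. p (f t x))" "continuous_on {a..b} (\<lambda>t. p (f t y))"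
    using 3(3)[of x] 3(3)[of y] by (auto intro!: continuous_on_compose2[OF assms(1)])
  then show ?case
    using 3 by (simp add: continuous_on_dist continuous_on_add)
qed auto

text \<open>Lower semicontinuity of the length suffices to cut a path at a prescribed length: cut at the
  supremum of all parameters at which the initial part is still short enough.\<close>

lemma length_le_split:
  fixes p :: "real \<Rightarrow> 'a::metric_space"
  assumes cont: "continuous_on {a..b} p" and "a \<le> b" "0 \<le> L1" "0 \<le> L2" and len: "length_le p a b (L1 + L2)"
  obtains m where "a \<le> m" "m \<le> b" "length_le p a m L1" "length_le p m b L2"
proof -
  define S where "S = {t \<in> {a..b}. length_le p a t L1}"
  have "a \<in> S"
    unfolding S_def length_le_def using assms by (auto simp: polygon_length_const)
  have bdd: "bdd_above S" unfolding S_def by (intro bdd_aboveI[of _ b]) auto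
  define m where "m = Sup S"
  have m: "a \<le> m" "m \<le> b"
    unfolding m_def using \<open>a \<in> S\<close> bdd by (auto intro: cSup_upper cSup_least simp: S_def)
  have left: "polygon_length p ts \<le> L1" if ts: "sorted ts" "set ts \<subseteq> {a..m}" for ts
  proof -
    define h where "h t = polygon_length p (map (min t) ts)" for t
    have "continuous_on {a..b} h"
      unfolding h_def
    proof (intro continuous_on_polygon_length cont conjI ballI)
      show "continuous_on {a..b} (\<lambda>t. min t s)" for s by (intro continuous_intros)
      show "min t s \<in> {a..b}" if "s \<in> set ts" "t \<in> {a..b}" for s t
        using ts m that by (auto simp: min_def max_def)
    qed
    then have "closed {t \<in> {a..b}. h t \<le> L1}"
      by (intro continuous_on_closed_Collect_le continuous_intros) auto
    moreover have "S \<subseteq> {t \<in> {a..b}. h t \<le> L1}"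
    proof
      fix t assume t: "t \<in> S"
      have "sorted (map (min t) ts)"
        using ts(1) by (intro sorted_map_monotone) (auto simp: mono_def min_def)
      moreover have "set (map (min t) ts) \<subseteq> {a..t}"
        using t ts(2) by (auto simp: S_def)
      ultimately show "t \<in> {t \<in> {a..b}. h t \<le> L1}"
        using t unfolding S_def length_le_def h_def by blast
    qed
    ultimately have "m \<in> {t \<in> {a..b}. h t \<le> L1}"
      unfolding m_def using closed_subset_contains_Sup \<open>a \<in> S\<close> bdd
      by (metis (no_types, lifting) empty_iff)
    moreover have "map (min m) ts = ts"
      using ts(2) by (intro map_idI) auto
    ultimately show ?thesis by (simp add: h_def)
  qed
  have right: "polygon_length p us \<le> L2" if us: "sorted us" "set us \<subseteq> {m..b}" for us
  proof (cases "m = b")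
    case True
    then show ?thesis using us assms by (simp add: polygon_length_const)
  next
    case False
    define k where "k t = polygon_length p (map (max t) us)" for t
    have "continuous_on {a..b} k"
      unfolding k_def
    proof (intro continuous_on_polygon_length cont conjI ballI)
      show "continuous_on {a..b} (\<lambda>t. max t s)" for s by (intro continuous_intros)
      show "max t s \<in> {a..b}" if "s \<in> set us" "t \<in> {a..b}" for s t
        using us m that by (auto simp: min_def max_def)
    qed
    then have cl: "closed {t \<in> {a..b}. k t \<le> L2}"
      by (intro continuous_on_closed_Collect_le continuous_intros) auto
    \<comment> \<open>Beyond \<open>m\<close> the initial part is longer than \<open>L1\<close>, which leaves less than \<open>L2\<close> for the rest.\<close>
    have "{m<..<b} \<subseteq> {t \<in> {a..b}. k t \<le> L2}"
    proof
      fix t assume t: "t \<in> {m<..<b}"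
      have "t \<notin> S" using t cSup_upper[OF _ bdd, of t] by (auto simp: m_def)
      then obtain ts where ts: "sorted ts" "set ts \<subseteq> {a..t}" "polygon_length p ts > L1"
        using t m unfolding S_def length_le_def by fastforce
      have "sorted (map (max t) us)"
        using us(1) by (intro sorted_map_monotone) (auto simp: mono_def max_def)
      moreover have "set (map (max t) us) \<subseteq> {t..b}"
        using us t by auto
      ultimately have max: "sorted (map (max t) us)" "set (map (max t) us) \<subseteq> {t..b}" .
      have "sorted (ts @ map (max t) us)"
        using ts max by (fastforce simp: sorted_append)
      moreover have "set (ts @ map (max t) us) \<subseteq> {a..b}"
        using ts(2) max(2) t m by fastforce
      ultimately have "polygon_length p (ts @ map (max t) us) \<le> L1 + L2"
        using len unfolding length_le_def by blast
      then have "k t \<le> L2"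
        using polygon_length_append[of p ts "map (max t) us"] ts(3) by (simp add: k_def)
      then show "t \<in> {t \<in> {a..b}. k t \<le> L2}" using t m by simp
    qed
    then have "closure {m<..<b} \<subseteq> {t \<in> {a..b}. k t \<le> L2}"
      using cl closure_minimal by blast
    then have "k m \<le> L2" using False m by auto
    moreover have "map (max m) us = us"
      using us(2) by (intro map_idI) auto
    ultimately show ?thesis by (simp add: k_def)
  qed
  show ?thesis
    by (rule that[OF m]) (auto simp: length_le_def left right)
qed

lemma length_le_dist:
  assumes "length_le p a b L" "a \<le> s" "s \<le> t" "t \<le> b"
  shows "dist (p s) (p t) \<le> L"
proof -
  have "polygon_length p [s, t] \<le> L"
    using assms(1)[unfolded length_le_def, rule_format, of "[s, t]"] assms(2-4) by simp
  then show ?thesis by simp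
qed

lemma length_le_dist3:
  assumes "length_le p a b L" "a \<le> s" "s \<le> t" "t \<le> u" "u \<le> b"
  shows "dist (p s) (p t) + dist (p t) (p u) \<le> L"
proof -
  have "polygon_length p [s, t, u] \<le> L"
    using assms(1)[unfolded length_le_def, rule_format, of "[s, t, u]"] assms(2-5) by simp
  then show ?thesis by simp
qed

lemma length_le_thirds:
  fixes p :: "real \<Rightarrow> 'a::metric_space"
  assumes "path p" "curve_length p \<le> ereal c" "0 \<le> c"
  obtains t1 t2 where "0 \<le> t1" "t1 \<le> t2" "t2 \<le> 1"
    "length_le p 0 t1 (c/3)" "length_le p t1 t2 (c/3)" "length_le p t2 1 (c/3)"
proof -
  have cont: "continuous_on {0..1} p" using assms by (simp add: path_def)
  obtain t1 where t1: "0 \<le> t1" "t1 \<le> 1" "length_le p 0 t1 (c/3)" "length_le p t1 1 (2 * c / 3)"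
    using length_le_split[OF cont, of "c/3" "2 * c / 3"] length_le_curve_length[OF assms(2)] assms(3) by auto
  have "continuous_on {t1..1} p" using t1 by (intro continuous_on_subset[OF cont]) auto
  then obtain t2 where "t1 \<le> t2" "t2 \<le> 1" "length_le p t1 t2 (c/3)" "length_le p t2 1 (c/3)"
    using length_le_split[of t1 1 p "c/3" "c/3"] t1 assms(3) by auto
  with t1 that show ?thesis by blast
qed

text \<open>A point between \<open>x\<close> and \<open>y\<close> lies on a geodesic from \<open>x\<close> to \<open>y\<close>, and hence in every geodesically convex set
  containing both. A point off \<open>S\<close> is missed by one of the convex neighbourhoods of \<open>S\<close>.\<close>

lemma between_in_convex_core:
  fixes S :: "'a::metric_space set"
  assumes geo: "geodesic_space TYPE('a)"
    and convex: "\<And>W. open W \<Longrightarrow> S \<subseteq> W \<Longrightarrow> \<exists>V\<subseteq>W. S \<subseteq> interior V \<and> geodesically_convex V"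
    and xy: "x \<in> S" "y \<in> S" "dist x m + dist m y = dist x y"
  shows "m \<in> S"
proof (rule ccontr)
  assume "m \<notin> S"
  then have "open (- {m})" "S \<subseteq> - {m}" by auto
  from convex[OF this] obtain V where V: "V \<subseteq> - {m}" "S \<subseteq> V" "geodesically_convex V"
    using interior_subset by (metis subset_trans)
  obtain \<gamma>1 \<gamma>2 where \<gamma>: "geodesic_from_to \<gamma>1 x m" "geodesic_from_to \<gamma>2 m y"
    using geo unfolding geodesic_space_def by blast
  let ?a = "dist x m" and ?b = "dist m y"
  note \<gamma>' = \<gamma>[unfolded geodesic_from_to_def]
  define \<gamma> where "\<gamma> t = (if t \<le> ?a then \<gamma>1 t else \<gamma>2 (t - ?a))" for t
  have left: "\<gamma> t = \<gamma>1 t" if "t \<le> ?a" for t using that by (simp add: \<gamma>_def)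
  have right: "\<gamma> t = \<gamma>2 (t - ?a)" if "?a \<le> t" for t
    using that \<gamma>' by (cases "t = ?a") (auto simp: \<gamma>_def)
  have 1: "dist (\<gamma> s) (\<gamma> t) \<le> t - s" if "0 \<le> s" "s \<le> t" "t \<le> ?a" for s t
    using that \<gamma>'(1) by (simp add: left)
  have 2: "dist (\<gamma> s) (\<gamma> t) \<le> t - s" if "?a \<le> s" "s \<le> t" "t \<le> dist x y" for s t
    using that \<gamma>'(2) xy(3) by (simp add: right)
  have short: "dist (\<gamma> s) (\<gamma> t) \<le> t - s" if "0 \<le> s" "s \<le> t" "t \<le> dist x y" for s t
    by (rule dist_le_join[where m = "\<lambda>t. t" and p = \<gamma>, OF 1 2 that])
  have ends: "\<gamma> 0 = x" "\<gamma> (dist x y) = y"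
  proof -
    have "dist x y - ?a = ?b" "?a \<le> dist x y" using xy(3) zero_le_dist[of m y] by linarith+
    then show "\<gamma> 0 = x" "\<gamma> (dist x y) = y" using \<gamma>' by (simp_all add: left right)
  qed
  \<comment> \<open>The concatenation does not increase distances, and its end points are as far apart as possible,
    so it is isometric.\<close>
  have iso: "dist (\<gamma> s) (\<gamma> t) = t - s" if st: "0 \<le> s" "s \<le> t" "t \<le> dist x y" for s t
    using short[OF st] short[of 0 s] short[of t "dist x y"] st ends
      dist_triangle[of x y "\<gamma> s"] dist_triangle[of "\<gamma> s" y "\<gamma> t"] by fastforce
  have "geodesic_from_to \<gamma> x y"
    unfolding geodesic_from_to_def
  proof (intro conjI ballI ends)
    fix s t assume "s \<in> {0..dist x y}" "t \<in> {0..dist x y}"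
    then show "dist (\<gamma> s) (\<gamma> t) = \<bar>s - t\<bar>"
      using iso[of s t] iso[of t s] by (cases "s \<le> t") (auto simp: dist_commute)
  qed
  then have "\<gamma> ` {0..dist x y} \<subseteq> V"
    using V(2,3) xy(1,2) unfolding geodesically_convex_def by blast
  moreover have "\<gamma> ?a = m" using \<gamma>' by (simp add: left)
  moreover have "?a \<in> {0..dist x y}" using xy(3) zero_le_dist[of m y] zero_le_dist[of x m] unfolding atLeastAtMost_iff by linarith
  ultimately show False using V(1) by blast
qed

context isometric_circle
begin

lemma range_A_interval: "range A = A ` {s..s + 1}"
proof -
  have "A u \<in> A ` {s..s + 1}" for u
  proof -
    have "A (s + frac (u - s)) = A u"
      using A_plus_int[of "s + frac (u - s)" "\<lfloor>u - s\<rfloor>"] by (simp add: frac_def)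
    moreover have "s + frac (u - s) \<in> {s..s + 1}"
      using frac_ge_0[of "u - s"] frac_lt_1[of "u - s"] by simp
    ultimately show ?thesis by (metis imageI)
  qed
  then show ?thesis by blast
qed

text \<open>A path no longer than the distance of its ends consists of points between them. These lie on the circle and
  are determined by their distance from \<open>A s\<close>, which takes every value up to \<open>c / 3\<close>.\<close>

lemma image_eq_arc:
  assumes between: "\<And>s m. dist (A s) m + dist m (A (s + 1/3)) = c / 3 \<Longrightarrow> m \<in> range A"
    and p: "continuous_on {a..b} p" "a \<le> b" "p a = A s" "p b = A (s + 1/3)" "length_le p a b (c / 3)"
  shows "p ` {a..b} = A ` {s..s + 1/3}"
proof -
  have on: "p t = A (s + dist (A s) (p t) / c) \<and> dist (A s) (p t) \<le> c / 3" if t: "t \<in> {a..b}" for t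
  proof -
    have le: "dist (A s) (p t) + dist (p t) (A (s + 1/3)) \<le> c / 3"
      using length_le_dist3[OF p(5), of a t b] t p(3,4) by auto
    then have "dist (A s) (p t) + dist (p t) (A (s + 1/3)) = c / 3"
      using dist_triangle[of "A s" "A (s + 1/3)" "p t"] dist_A_third[of s] by linarith
    then have "p t \<in> range A" by (rule between)
    from near_arc[OF this, of s 0] le c_pos
    have "dist (p t) (A (s + dist (p t) (A s) / c)) \<le> 0" by (simp add: dist_commute)
    moreover have "dist (A s) (p t) \<le> c / 3" using le zero_le_dist[of "p t" "A (s + 1/3)"] by linarith
    ultimately show ?thesis by (simp add: dist_commute)
  qed
  show ?thesis
  proof
    show "p ` {a..b} \<subseteq> A ` {s..s + 1/3}"
    proof
      fix w assume "w \<in> p ` {a..b}"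
      then obtain t where t: "t \<in> {a..b}" "w = p t" by blast
      have "dist (A s) (p t) / c \<le> 1/3" "0 \<le> dist (A s) (p t) / c"
        using on[OF t(1)] c_pos by (auto simp: field_simps)
      then have "s + dist (A s) (p t) / c \<in> {s..s + 1/3}" by simp
      then show "w \<in> A ` {s..s + 1/3}" using on[OF t(1)] t(2) by blast
    qed
    show "A ` {s..s + 1/3} \<subseteq> p ` {a..b}"
    proof
      fix w assume "w \<in> A ` {s..s + 1/3}"
      then obtain u where u: "u \<in> {s..s + 1/3}" "w = A u" by blast
      define r where "r = u - s"
      have r: "0 \<le> r" "r \<le> 1/3" "w = A (s + r)" using u by (auto simp: r_def)
      have "continuous_on {a..b} (\<lambda>t. dist (A s) (p t))"
        using p(1) by (intro continuous_intros)
      moreover have "dist (A s) (p a) \<le> c * r" "c * r \<le> dist (A s) (p b)"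
        using p(3,4) r c_pos dist_A_third[of s] by auto
      ultimately obtain t where "a \<le> t" "t \<le> b" "dist (A s) (p t) = c * r"
        using IVT'[of "\<lambda>t. dist (A s) (p t)" a "c * r" b] p(2) by blast
      then have "p t = A (s + r)" "t \<in> {a..b}" using on[of t] c_pos by auto
      then show "w \<in> p ` {a..b}" unfolding r(3) by (metis imageI)
    qed
  qed
qed

lemma image_eq_circle:
  assumes between: "\<And>s m. dist (A s) m + dist m (A (s + 1/3)) = c / 3 \<Longrightarrow> m \<in> range A"
    and p: "path p" "p 0 = p 1" "0 \<le> t1" "t1 \<le> t2" "t2 \<le> 1"
    and len: "length_le p 0 t1 (c/3)" "length_le p t1 t2 (c/3)" "length_le p t2 1 (c/3)"
    and near: "near_equilateral 0 (p 0) (p t1) (p t2)"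
  shows "path_image p = range A"
proof -
  obtain s where s: "p 0 = A s" "p t1 = A (s + 1/3)" "p t2 = A (s + 2/3)"
    using near unfolding near_equilateral_def by auto
  have eqs: "s + 1/3 + 1/3 = s + 2/3" "s + 2/3 + 1/3 = s + 1" by simp_all
  have s': "p t2 = A (s + 1/3 + 1/3)" "p 1 = A (s + 2/3 + 1/3)"
    unfolding eqs A_plus_1 using s p(2) by simp_all
  have cont: "continuous_on {0..t1} p" "continuous_on {t1..t2} p" "continuous_on {t2..1} p"
    using p by (auto simp: path_def elim!: continuous_on_subset)
  have "path_image p = p ` ({0..t1} \<union> {t1..t2} \<union> {t2..1})"
    using p(3-5) by (simp add: path_image_def ivl_disj_un_two_touch)
  also have "\<dots> = A ` ({s..s + 1/3} \<union> {s + 1/3..s + 2/3} \<union> {s + 2/3..s + 1})"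
    unfolding image_Un
    using image_eq_arc[OF between cont(1) p(3) s(1,2) len(1)]
      image_eq_arc[OF between cont(2) p(4) s(2) s'(1) len(2), unfolded eqs]
      image_eq_arc[OF between cont(3) p(5) s(3) s'(2) len(3), unfolded eqs] by simp
  also have "{s..s + 1/3} \<union> {s + 1/3..s + 2/3} \<union> {s + 2/3..s + 1} = {s..s + 1}"
    by auto
  also have "A ` {s..s + 1} = range A" using range_A_interval by simp
  finally show ?thesis .
qed

lemma isometric_circle_reflect: "isometric_circle (\<lambda>t. A (- t)) c"
proof
  show "dist (A (- s)) (A (- t)) = c * dist_to_int (s - t)" for s t
    using dist_A[of "- t" "- s"] by (simp add: dist_commute)
qed (rule c_pos)

text \<open>A loop whose cut points form an equilateral triangle on the circle runs along the arc between any two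
  consecutive ones, and so has the circle as its image.\<close>

lemma thirds_not_equilateral:
  assumes between: "\<And>x y m. x \<in> range A \<Longrightarrow> y \<in> range A \<Longrightarrow> dist x m + dist m y = dist x y \<Longrightarrow> m \<in> range A"
    and p: "path p" "p 0 = p 1" "0 \<le> t1" "t1 \<le> t2" "t2 \<le> 1"
    and len: "length_le p 0 t1 (c/3)" "length_le p t1 t2 (c/3)" "length_le p t2 1 (c/3)"
    and neq: "path_image p \<noteq> range A"
  shows "\<not> near_equilateral 0 (p 0) (p t1) (p t2)" "\<not> near_equilateral 0 (p 0) (p t2) (p t1)"
proof -
  have b: "m \<in> range A" if "dist (A s) m + dist m (A (s + 1/3)) = c / 3" for s m
    using that by (intro between[of "A s" "A (s + 1/3)" m] rangeI) (simp only: dist_A_third)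
  show "\<not> near_equilateral 0 (p 0) (p t1) (p t2)"
  proof
    assume "near_equilateral 0 (p 0) (p t1) (p t2)"
    with p len have "path_image p = range A"
      by (intro image_eq_circle[where p = p]) (rule b)
    with neq show False by simp
  qed
  \<comment> \<open>Traversing the circle backwards exchanges the two orientations.\<close>
  interpret R: isometric_circle "\<lambda>t. A (- t)" c by (rule isometric_circle_reflect)
  have range: "range (\<lambda>t. A (- t)) = range A"
  proof -
    have "A t \<in> range (\<lambda>t. A (- t))" for t by (rule range_eqI[of _ _ "- t"]) simp
    then show ?thesis by blast
  qed
  show "\<not> near_equilateral 0 (p 0) (p t2) (p t1)"
  proof
    assume "near_equilateral 0 (p 0) (p t2) (p t1)"
    then obtain s where s: "p 0 = A s" "p t2 = A (s + 1/3)" "p t1 = A (s + 2/3)"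
      unfolding near_equilateral_def by auto
    have "A (- (- s + 1/3)) = A (s + 2/3)" "A (- (- s + 2/3)) = A (s + 1/3)"
      using A_minus_1[of "s + 2/3"] A_minus_1[of "s + 1/3"] by (simp_all add: algebra_simps)
    then have "R.near_equilateral 0 (p 0) (p t1) (p t2)"
      unfolding R.near_equilateral_def using s by (intro exI[of _ "- s"]) simp
    moreover have b': "m \<in> range (\<lambda>t. A (- t))"
      if "dist (A (- s)) m + dist m (A (- (s + 1/3))) = c / 3" for s m
      unfolding range using that
      by (intro between[of "A (- s)" "A (- (s + 1/3))" m] rangeI) (simp only: R.dist_A_third)
    ultimately have "path_image p = range (\<lambda>t. A (- t))"
      using p len by (intro R.image_eq_circle[where p = p]) (rule b')
    with neq range show False by simp
  qed
qed

end

section \<open>Simplices of selective Rips complexes\<close>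

lemma sRips_dist_less:
  assumes "\<sigma> \<in> sRips Y a n b" "x \<in> \<sigma>" "y \<in> \<sigma>"
  shows "dist x y < a"
proof -
  have "bounded \<sigma>" using assms(1) by (simp add: sRips_def finite_imp_bounded)
  then have "dist x y \<le> diameter \<sigma>" using assms(2,3) by (rule diameter_bounded_bound)
  then show ?thesis using assms(1) by (simp add: sRips_def)
qed

lemma diameter_less:
  fixes S :: "'a::metric_space set"
  assumes "finite S" "S \<noteq> {}" "\<And>x y. x \<in> S \<Longrightarrow> y \<in> S \<Longrightarrow> dist x y < d"
  shows "diameter S < d"
proof -
  have fin: "finite ((\<lambda>(x, y). dist x y) ` (S \<times> S))" "(\<lambda>(x, y). dist x y) ` (S \<times> S) \<noteq> {}"
    using assms by auto
  have "diameter S = Sup ((\<lambda>(x, y). dist x y) ` (S \<times> S))"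
    using assms(2) by (simp add: diameter_def)
  also have "\<dots> = Max ((\<lambda>(x, y). dist x y) ` (S \<times> S))"
    using fin by (rule cSup_eq_Max)
  also have "\<dots> < d"
    using fin assms(3) by (subst Max_less_iff) auto
  finally show ?thesis .
qed

lemma triangle_in_sRips:
  assumes "dist x y < a" "dist y z < a" "dist x z < a" "b > 0"
  shows "{x, y, z} \<in> sRips UNIV a 2 b"
  unfolding sRips_def
proof (intro CollectI conjI exI allI impI)
  have "a > 0" using assms(1) zero_le_dist[of x y] by linarith
  then show "diameter {x, y, z} < a"
    using assms by (intro diameter_less) (auto simp: dist_commute)
  let ?U = "\<lambda>i::nat. {if i = 0 then x else if i = 1 then y else z}"
  show "{x, y, z} \<subseteq> (\<Union>i\<le>2. ?U i)"
    by (simp add: numeral_2_eq_2 atMost_Suc)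
  show "diameter (?U i) < b" for i
    using assms(4) by (intro diameter_less) auto
qed auto

text \<open>Pigeonhole: four vertices lie in three sets of small diameter.\<close>

lemma sRips_close_pair:
  assumes "{v, x, y, z} \<in> sRips Y a 2 b" "distinct [v, x, y, z]"
  shows "\<exists>p\<in>{v, x, y, z}. \<exists>q\<in>{v, x, y, z}. p \<noteq> q \<and> dist p q < b"
proof -
  obtain U where U: "\<forall>i\<le>2. U i \<subseteq> Y \<and> bounded (U i) \<and> diameter (U i) < b" "{v, x, y, z} \<subseteq> (\<Union>i\<le>(2::nat). U i)"
    using assms(1) unfolding sRips_def by blast
  define f where "f p = (SOME i. i \<le> 2 \<and> p \<in> U i)" for p
  have f: "f p \<le> 2 \<and> p \<in> U (f p)" if "p \<in> {v, x, y, z}" for p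
    unfolding f_def by (rule someI_ex) (use that U(2) in blast)
  have "card (f ` {v, x, y, z}) \<le> card {..2::nat}"
    using f by (intro card_mono) auto
  also have "\<dots> < card {v, x, y, z}" using assms(2) by simp
  finally have "\<not> inj_on f {v, x, y, z}" by (rule pigeonhole)
  then obtain p q where pq: "p \<in> {v, x, y, z}" "q \<in> {v, x, y, z}" "p \<noteq> q" "f p = f q"
    unfolding inj_on_def by blast
  have "dist p q \<le> diameter (U (f p))"
    using f[OF pq(1)] f[OF pq(2)] pq(4) U(1) by (intro diameter_bounded_bound) auto
  then have "dist p q < b" using f[OF pq(1)] U(1) by fastforce
  with pq show ?thesis by blast
qed

lemma sRips_mono:
  assumes "a \<le> a'" "b \<le> b'"
  shows "sRips Y a n b \<subseteq> sRips Y a' n b'"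
proof
  fix \<sigma> assume "\<sigma> \<in> sRips Y a n b"
  then obtain U where U: "finite \<sigma>" "\<sigma> \<noteq> {}" "\<sigma> \<subseteq> Y" "diameter \<sigma> < a"
    "\<forall>i\<le>n. U i \<subseteq> Y \<and> bounded (U i) \<and> diameter (U i) < b" "\<sigma> \<subseteq> (\<Union>i\<le>n. U i)"
    unfolding sRips_def by blast
  have "\<forall>i\<le>n. U i \<subseteq> Y \<and> bounded (U i) \<and> diameter (U i) < b'"
    using U(5) assms(2) less_le_trans by blast
  moreover have "diameter \<sigma> < a'" using U(4) assms(1) by linarith
  ultimately show "\<sigma> \<in> sRips Y a' n b'"
    using U(1-3,6) unfolding sRips_def by blast
qed

subsection \<open>Classes of cycles\<close>

lemma simplicial_boundaries_2: "simplicial_boundaries 2 K = simplicial_boundary ` simplicial_chains 3 K"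
  by (simp add: simplicial_boundaries_def)

lemma simplicial_class_eq: "simplicial_class p K z = (\<lambda>b. b + z) ` simplicial_boundaries p K"
  by (auto simp: simplicial_class_def r_coset_def simplicial_cycle_group_def)

lemma zero_in_simplicial_boundaries: "0 \<in> simplicial_boundaries p K"
  unfolding simplicial_boundaries_def
  by (rule image_eqI[of _ _ 0]) (simp_all add: simplicial_boundary_0 simplicial_chains_0)

lemma simplicial_boundaries_add:
  "b \<in> simplicial_boundaries p K \<Longrightarrow> d \<in> simplicial_boundaries p K \<Longrightarrow> b + d \<in> simplicial_boundaries p K"
  unfolding simplicial_boundaries_def
  by (auto simp flip: simplicial_boundary_add intro!: imageI simplicial_chains_add)

lemma simplicial_boundaries_minus:
  "b \<in> simplicial_boundaries p K \<Longrightarrow> - b \<in> simplicial_boundaries p K"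
  unfolding simplicial_boundaries_def
  by (auto simp flip: simplicial_boundary_minus intro!: imageI simplicial_chains_minus)

lemma simplicial_boundaries_mono: "K \<subseteq> L \<Longrightarrow> simplicial_boundaries p K \<subseteq> simplicial_boundaries p L"
  unfolding simplicial_boundaries_def by (intro image_mono simplicial_chains_mono)

lemma simplicial_class_self: "z \<in> simplicial_class p K z"
  unfolding simplicial_class_eq using zero_in_simplicial_boundaries[of p K]
  by (intro image_eqI[of _ _ 0]) auto

lemma carrier_simplicial_homology:
  "carrier (simplicial_homology p K) = simplicial_class p K ` {c \<in> simplicial_chains p K. simplicial_boundary c = 0}"
  by (simp add: simplicial_homology_def carrier_FactGroup simplicial_cycle_group_def simplicial_class_def)

lemma one_simplicial_homology: "\<one>\<^bsub>simplicial_homology p K\<^esub> = simplicial_boundaries p K"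
  by (simp add: simplicial_homology_def)

text \<open>All representatives in \<open>K\<close> differ by boundaries of \<open>K\<close>, which are boundaries of \<open>L\<close>.\<close>

lemma inclusion_induced_class:
  assumes "K \<subseteq> L"
  shows "inclusion_induced p L (simplicial_class p K z) = simplicial_class p L z"
proof -
  have "simplicial_class p L z' = simplicial_class p L z" if z': "z' \<in> simplicial_class p K z" for z'
  proof -
    obtain b where b: "b \<in> simplicial_boundaries p L" "z' = b + z"
      using z' simplicial_boundaries_mono[OF assms] unfolding simplicial_class_eq by blast
    show ?thesis
    proof (intro equalityI subsetI)
      fix w assume "w \<in> simplicial_class p L z'"
      then obtain d where d: "d \<in> simplicial_boundaries p L" "w = (d + b) + z"
        unfolding simplicial_class_eq b(2) by (auto simp: add.assoc)
      then show "w \<in> simplicial_class p L z"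
        unfolding simplicial_class_eq using simplicial_boundaries_add[OF d(1) b(1)] by blast
    next
      fix w assume "w \<in> simplicial_class p L z"
      then obtain d where d: "d \<in> simplicial_boundaries p L" "w = (d + - b) + (b + z)"
        unfolding simplicial_class_eq by auto
      then show "w \<in> simplicial_class p L z'"
        unfolding simplicial_class_eq b(2)
        using simplicial_boundaries_add[OF d(1) simplicial_boundaries_minus[OF b(1)]] by blast
    qed
  qed
  then show ?thesis
    unfolding inclusion_induced_def using simplicial_class_self[of z p K] by blast
qed

section \<open>Filling a short loop\<close>

lemma fan_chain_in_span:
  "successively (P p) xs \<Longrightarrow> fan_chain g p xs \<in> triangle_span P"
proof (induction g p xs rule: fan_chain.induct)
  case (1 g p x y xs)
  then show ?case by (simp add: triangle_span_add triangle_span_triangle)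
qed (simp_all add: triangle_span.zero)

lemma polygon_chain_insert:
  assumes "xs \<noteq> []" "ys \<noteq> []"
  shows "polygon_chain g (xs @ m # ys) = polygon_chain g (xs @ ys) + simplicial_boundary (triangle_chain g (last xs) m (hd ys))"
proof -
  obtain xs' x where xs: "xs = xs' @ [x]" using assms(1) by (metis append_butlast_last_id)
  obtain y ys' where ys: "ys = y # ys'" using assms(2) by (cases ys) auto
  have "polygon_chain g (xs @ m # ys) = polygon_chain g (xs' @ [x]) + polygon_chain g (x # m # y # ys')"
    using polygon_chain_append[of g xs' x "m # y # ys'"] by (simp add: xs ys)
  moreover have "polygon_chain g (xs @ ys) = polygon_chain g (xs' @ [x]) + polygon_chain g (x # y # ys')"
    using polygon_chain_append[of g xs' x "y # ys'"] by (simp add: xs ys)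
  ultimately show ?thesis by (simp add: xs ys boundary_triangle_chain)
qed

text \<open>The times at which a loop is cut into thirds need not be multiples of \<open>1 / N\<close>, as the subdivision of singular
  simplices requires. They are inserted one at a time, at the cost of one small triangle each.\<close>

lemma insert_time:
  fixes p :: "real \<Rightarrow> 'a::metric_space" and g :: "'g::ab_group_add"
  assumes ts: "sorted ts" "successively (\<lambda>s t. t - s \<le> \<eta>) ts" "ts \<noteq> []" "set ts \<subseteq> {0..1}"
    and x: "hd ts \<le> x" "x \<le> last ts"
    and "\<eta> \<ge> 0" and small: "\<And>s t. \<lbrakk>s \<in> {0..1}; t \<in> {0..1}; \<bar>s - t\<bar> \<le> \<eta>\<rbrakk> \<Longrightarrow> dist (p s) (p t) < \<epsilon>"
  obtains xs ys t where "ts = xs @ ys" "\<forall>s\<in>set ts. s \<le> x \<longrightarrow> s \<in> set xs"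
    "sorted (xs @ x # ys)" "successively (\<lambda>s t. t - s \<le> \<eta>) (xs @ x # ys)"
    "hd (xs @ x # ys) = hd ts" "last (xs @ x # ys) = last ts" "x \<in> {0..1}"
    "t \<in> triangle_span (sides_less \<epsilon>)"
    "polygon_chain g (map p (xs @ x # ys)) = polygon_chain g (map p ts) + simplicial_boundary t"
proof -
  define xs ys where "xs = takeWhile (\<lambda>s. s \<le> x) ts" and "ys = dropWhile (\<lambda>s. s \<le> x) ts"
  have ts_eq: "ts = xs @ ys" by (simp add: xs_def ys_def)
  have xs_le: "s \<le> x" if "s \<in> set xs" for s using set_takeWhileD[OF that[unfolded xs_def]] by blast
  have "xs \<noteq> []" using ts(3) x(1) by (cases ts) (auto simp: xs_def)
  then have hd: "hd (xs @ x # ys) = hd ts" by (simp add: ts_eq)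
  have sorted_ys: "sorted ys" "sorted xs" using ts(1) by (auto simp: ts_eq sorted_append)
  have ys_gt: "x < s" if "s \<in> set ys" for s
  proof -
    have "ys \<noteq> []" using that by auto
    then have "x < hd ys" using hd_dropWhile[of "\<lambda>s. s \<le> x" ts] by (simp add: ys_def not_le)
    moreover have "hd ys \<le> s" using sorted_ys(1) that by (cases ys) auto
    ultimately show ?thesis by linarith
  qed
  have sorted: "sorted (xs @ x # ys)"
    using sorted_ys xs_le ys_gt by (fastforce simp: sorted_append)
  have inxs: "s \<in> set xs" if "s \<in> set ts" "s \<le> x" for s
    using that ys_gt by (force simp: ts_eq)
  have x01: "x \<in> {0..1}"
    using x ts(3,4) hd_in_set[OF ts(3)] last_in_set[OF ts(3)] by (meson atLeastAtMost_iff order_trans subsetD)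
  have last_xs: "last xs \<in> set xs" using \<open>xs \<noteq> []\<close> by simp
  show ?thesis
  proof (cases "ys = []")
    case True
    then have "last ts = last xs" by (simp add: ts_eq)
    then have "last xs = x" using xs_le[OF last_xs] x(2) by simp
    obtain xs' where xs': "xs = xs' @ [x]" using \<open>xs \<noteq> []\<close> \<open>last xs = x\<close> by (metis append_butlast_last_id)
    show ?thesis
    proof (rule that[of xs ys 0])
      show "successively (\<lambda>s t. t - s \<le> \<eta>) (xs @ x # ys)"
        using ts(2) \<open>\<eta> \<ge> 0\<close> \<open>last xs = x\<close> by (simp add: ts_eq True successively_append_iff)
      show "polygon_chain g (map p (xs @ x # ys)) = polygon_chain g (map p ts) + simplicial_boundary 0"
        using polygon_chain_append[of g "map p xs'" "p x" "[p x]"]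
        by (simp add: ts_eq True xs' simplicial_boundary_0)
      show "last (xs @ x # ys) = last ts" using \<open>last xs = x\<close> by (simp add: ts_eq True)
    qed (use ts_eq inxs sorted hd x01 in \<open>auto intro: triangle_span.zero\<close>)
  next
    case False
    have hd_ys: "hd ys \<in> set ys" using False by simp
    have gap: "hd ys - last xs \<le> \<eta>"
      using ts(2) \<open>xs \<noteq> []\<close> False by (simp add: ts_eq successively_append_iff)
    have l: "last xs \<le> x" "x < hd ys" using xs_le[OF last_xs] ys_gt[OF hd_ys] by auto
    have in01: "last xs \<in> {0..1}" "hd ys \<in> {0..1}"
      using ts(4) last_xs hd_ys by (auto simp: ts_eq)
    have d: "sides_less \<epsilon> (p (last xs)) (p x) (p (hd ys))"
      using l gap in01 x01 unfolding sides_less_def by (intro conjI small) auto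
    show ?thesis
    proof (rule that[of xs ys "triangle_chain g (p (last xs)) (p x) (p (hd ys))"])
      show "successively (\<lambda>s t. t - s \<le> \<eta>) (xs @ x # ys)"
        using ts(2) gap l \<open>xs \<noteq> []\<close> False
        by (cases ys) (auto simp: ts_eq successively_append_iff)
      show "polygon_chain g (map p (xs @ x # ys)) = polygon_chain g (map p ts)
          + simplicial_boundary (triangle_chain g (p (last xs)) (p x) (p (hd ys)))"
        using polygon_chain_insert[of "map p xs" "map p ys" g "p x"] \<open>xs \<noteq> []\<close> False
        by (simp add: ts_eq last_map hd_map)
      show "last (xs @ x # ys) = last ts" using False by (simp add: ts_eq)
    qed (use ts_eq inxs sorted hd x01 d in \<open>auto intro: triangle_span_triangle\<close>)
  qed
qed

lemma length_le_affine:
  assumes "\<And>s t. \<lbrakk>a \<le> s; s \<le> t; t \<le> b\<rbrakk> \<Longrightarrow> dist (p s) (p t) \<le> c * (t - s)" "0 \<le> c" "a \<le> b"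
  shows "length_le p a b (c * (b - a))"
  unfolding length_le_def
proof (intro allI impI)
  fix ts assume "sorted ts \<and> set ts \<subseteq> {a..b}"
  then show "polygon_length p ts \<le> c * (b - a)"
    using assms(1,3)
  proof (induction ts arbitrary: a rule: induct_list012)
    case (3 s t ts)
    then have st: "a \<le> s" "s \<le> t" "t \<le> b" by auto
    have "polygon_length p (t # ts) \<le> c * (b - t)"
      by (rule "3.IH"(2)) (use 3(3-5) st in auto)
    moreover have "dist (p s) (p t) \<le> c * (t - s)" using 3(4) st by simp
    moreover have "c * (b - t) + c * (t - s) \<le> c * (b - a)"
      using st assms(2) by (simp flip: distrib_left add: mult_left_mono)
    ultimately show ?case by simp
  qed (use assms(2) in \<open>auto intro!: mult_nonneg_nonneg\<close>)
qed

context isometric_circle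
begin

text \<open>Triangles that may be used freely in a filling: they are simplices at every scale above \<open>c / 3\<close>, and the short
  side rules out that they are almost equilateral.\<close>

definition thin :: "'a \<Rightarrow> 'a \<Rightarrow> 'a \<Rightarrow> bool" where
  "thin x y z \<longleftrightarrow> dist x y \<le> c / 3 \<and> dist y z \<le> c / 3 \<and> dist x z \<le> c / 3 \<and>
     (dist x y < c / 4 \<or> dist y z < c / 4 \<or> dist x z < c / 4)"

lemma fan_thin:
  assumes "successively (\<lambda>s t. t - s \<le> \<eta>) ts" "sorted ts" "set ts \<subseteq> {a..b}" "{a..b} \<subseteq> {0..1}" "length_le p a b (c / 3)"
    and small: "\<And>s t. \<lbrakk>s \<in> {0..1}; t \<in> {0..1}; \<bar>s - t\<bar> \<le> \<eta>\<rbrakk> \<Longrightarrow> dist (p s) (p t) < c / 4"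
  shows "fan_chain g (p a) (map p ts) \<in> triangle_span thin"
proof (rule fan_chain_in_span)
  have "successively (\<lambda>s t. thin (p a) (p s) (p t)) ts"
    using assms(1-3)
  proof (induction ts rule: induct_list012)
    case (3 s t ts)
    then have st: "a \<le> s" "s \<le> t" "t \<le> b" "t - s \<le> \<eta>" by auto
    then have "s \<in> {0..1}" "t \<in> {0..1}" using assms(4) by (auto intro: subsetD)
    then have "dist (p s) (p t) < c / 4" using st by (intro small) auto
    then have "thin (p a) (p s) (p t)"
      unfolding thin_def using length_le_dist[OF assms(5)] st by auto
    with 3 show ?case by simp
  qed simp_all
  then show "successively (thin (p a)) (map p ts)"
    by (simp add: successively_map)
qed

lemma sides_less_imp_thin: "sides_less (c / 4) x y z \<Longrightarrow> thin x y z"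
  using c_pos by (auto simp: thin_def sides_less_def)

text \<open>The loop is filled by the triangle on the three cut points, together with fans of thin triangles that
  have a cut point as their tip and the following third of the loop as their base. As these
  thirds have length at most \<open>c / 3\<close>, so have all sides.\<close>

lemma fill_loop:
  fixes p :: "real \<Rightarrow> 'a" and g :: "'g::ab_group_add" and N :: nat
  assumes p: "p 0 = p 1" and t12: "0 \<le> t1" "t1 \<le> t2" "t2 \<le> 1"
    and len: "length_le p 0 t1 (c/3)" "length_le p t1 t2 (c/3)" "length_le p t2 1 (c/3)"
    and "N > 0" and small: "\<And>s t. \<lbrakk>s \<in> {0..1}; t \<in> {0..1}; \<bar>s - t\<bar> \<le> 1 / N\<rbrakk> \<Longrightarrow> dist (p s) (p t) < c / 4"
  obtains t where "t \<in> triangle_span thin"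
    "simplicial_boundary (t + triangle_chain g (p 0) (p t1) (p t2)) = polygon_chain g (map (\<lambda>i. p (real i / real N)) [0..<Suc N])"
proof -
  define ts where "ts = map (\<lambda>i. real i / real N) [0..<Suc N]"
  have ends: "hd ts = 0" "last ts = 1" "ts \<noteq> []"
    using \<open>N > 0\<close> by (auto simp: ts_def hd_map last_map simp del: upt_Suc)
  have sorted_ts: "sorted ts"
    using \<open>N > 0\<close> by (auto simp: ts_def sorted_iff_nth_mono divide_right_mono simp del: upt_Suc)
  have succ_ts: "successively (\<lambda>s t. t - s \<le> 1 / N) ts"
    by (auto simp: ts_def successively_conv_nth nth_append diff_divide_distrib[symmetric] simp del: upt_Suc)
  have ts01: "set ts \<subseteq> {0..1}"
    using \<open>N > 0\<close> by (auto simp: ts_def)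
  have "0 \<le> 1 / real N" by simp
  have x1: "hd ts \<le> t1" "t1 \<le> last ts" using ends t12 by auto
  obtain xs ys b1 where 1: "ts = xs @ ys" "\<forall>s\<in>set ts. s \<le> t1 \<longrightarrow> s \<in> set xs"
    "sorted (xs @ t1 # ys)" "successively (\<lambda>s t. t - s \<le> 1 / N) (xs @ t1 # ys)"
    "hd (xs @ t1 # ys) = hd ts" "last (xs @ t1 # ys) = last ts" "t1 \<in> {0..1}"
    "b1 \<in> triangle_span (sides_less (c / 4))"
    "polygon_chain g (map p (xs @ t1 # ys)) = polygon_chain g (map p ts) + simplicial_boundary b1"
    by (rule insert_time[where p = p and g = g, OF sorted_ts succ_ts ends(3) ts01 x1 \<open>0 \<le> 1 / real N\<close> small]) (assumption | rule that)+
  let ?ts' = "xs @ t1 # ys"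
  have ts': "?ts' \<noteq> []" "set ?ts' \<subseteq> {0..1}" using 1(1,7) ts01 by auto
  have x2: "hd ?ts' \<le> t2" "t2 \<le> last ?ts'" unfolding 1(5,6) using ends t12 by auto
  obtain us vs b2 where 2: "?ts' = us @ vs" "\<forall>s\<in>set ?ts'. s \<le> t2 \<longrightarrow> s \<in> set us"
    "sorted (us @ t2 # vs)" "successively (\<lambda>s t. t - s \<le> 1 / N) (us @ t2 # vs)"
    "hd (us @ t2 # vs) = hd ?ts'" "last (us @ t2 # vs) = last ?ts'" "t2 \<in> {0..1}"
    "b2 \<in> triangle_span (sides_less (c / 4))"
    "polygon_chain g (map p (us @ t2 # vs)) = polygon_chain g (map p ?ts') + simplicial_boundary b2"
    by (rule insert_time[where p = p and g = g, OF 1(3,4) ts' x2 \<open>0 \<le> 1 / real N\<close> small]) (assumption | rule that)+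
  have ends2: "hd (us @ t2 # vs) = 0" "last (us @ t2 # vs) = 1"
    unfolding 2(5,6) 1(5,6) ends by simp_all
  have "t1 \<in> set us" using 2(2) t12 by auto
  then obtain u w where us: "us = u @ t1 # w" by (meson split_list)
  have in01': "set (us @ t2 # vs) \<subseteq> {0..1}" using 2(1,7) ts'(2) by auto
  let ?L1 = "u @ [t1]" and ?L2 = "t1 # w @ [t2]" and ?L3 = "t2 # vs"
  have all: "us @ t2 # vs = u @ [t1] @ (w @ [t2] @ vs)" "us @ t2 # vs = (u @ t1 # w) @ [t2] @ vs"
    by (simp_all add: us)
  have s: "sorted ?L1" "sorted ?L2" "sorted ?L3"
    using 2(3) unfolding us by (auto simp: sorted_append)
  have sub: "set ?L1 \<subseteq> {0..t1}" "set ?L2 \<subseteq> {t1..t2}" "set ?L3 \<subseteq> {t2..1}"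
    using 2(3) in01' t12 unfolding us by (auto simp: sorted_append)
  have gaps: "successively (\<lambda>s t. t - s \<le> 1 / N) ?L1" "successively (\<lambda>s t. t - s \<le> 1 / N) ?L2"
    "successively (\<lambda>s t. t - s \<le> 1 / N) ?L3"
    using 2(4) unfolding us by (auto simp: successively_append_iff successively_Cons hd_append split: if_splits)
  define f where "f = fan_chain g (p 0) (map p ?L1) + fan_chain g (p t1) (map p ?L2) + fan_chain g (p t2) (map p ?L3)"
  have sub01: "{0..t1} \<subseteq> {0..1}" "{t1..t2} \<subseteq> {0..1}" "{t2..1} \<subseteq> {0..1}"
    using t12 by auto
  have "fan_chain g (p 0) (map p ?L1) \<in> triangle_span thin"
    by (rule fan_thin[where p = p and g = g and \<eta> = "1 / N", OF gaps(1) s(1) sub(1) sub01(1) len(1) small])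
  moreover have "fan_chain g (p t1) (map p ?L2) \<in> triangle_span thin"
    by (rule fan_thin[where p = p and g = g and \<eta> = "1 / N", OF gaps(2) s(2) sub(2) sub01(2) len(2) small])
  moreover have "fan_chain g (p t2) (map p ?L3) \<in> triangle_span thin"
    by (rule fan_thin[where p = p and g = g and \<eta> = "1 / N", OF gaps(3) s(3) sub(3) sub01(3) len(3) small])
  ultimately have "f \<in> triangle_span thin"
    unfolding f_def by (metis triangle_span_add)
  moreover have "b1 + b2 \<in> triangle_span thin"
    by (intro triangle_span_add triangle_span_mono[OF _ 1(8)] triangle_span_mono[OF _ 2(8)]) (rule sides_less_imp_thin, assumption)+
  ultimately have thin_f: "f - (b1 + b2) \<in> triangle_span thin" by (rule triangle_span_diff[rotated])
  have hd1: "hd (map p ?L1) = p 0"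
    using ends2(1) by (cases u) (auto simp: us)
  have last3: "last (map p ?L3) = p 1"
  proof -
    have "last (map p ?L3) = p (last ?L3)" by (rule last_map) simp
    also have "last ?L3 = last (us @ t2 # vs)" by simp
    finally show ?thesis unfolding ends2(2) .
  qed
  have "simplicial_boundary f = (polygon_chain g (map p ?L1) - edge_chain g (p 0) (p t1))
      + (polygon_chain g (map p ?L2) - edge_chain g (p t1) (p t2))
      + (polygon_chain g (map p ?L3) - edge_chain g (p t2) (p 1))"
    unfolding f_def simplicial_boundary_add
    using boundary_fan_chain[of "map p ?L1" g "p 0"] boundary_fan_chain[of "map p ?L2" g "p t1"]
      boundary_fan_chain[of "map p ?L3" g "p t2"] hd1 last3 by simp
  moreover have "polygon_chain g (map p (us @ t2 # vs)) =
      polygon_chain g (map p ?L1) + polygon_chain g (map p ?L2) + polygon_chain g (map p ?L3)"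
    using polygon_chain_append[of g "map p u" "p t1" "map p (w @ [t2] @ vs)"]
      polygon_chain_append[of g "map p (t1 # w)" "p t2" "map p vs"]
    unfolding all(1) by (simp add: add.assoc)
  ultimately have "simplicial_boundary f = polygon_chain g (map p (us @ t2 # vs))
      - edge_chain g (p 0) (p t1) - edge_chain g (p t1) (p t2) - edge_chain g (p t2) (p 1)"
    by simp
  then have "simplicial_boundary (f - (b1 + b2) + triangle_chain g (p 0) (p t1) (p t2)) = polygon_chain g (map p ts)"
    unfolding simplicial_boundary_add simplicial_boundary_diff boundary_triangle_chain
    using 1(9) 2(9) p edge_chain_swap[of g "p 0" "p t2"] by simp
  then show ?thesis using that[OF thin_f] by (simp add: ts_def o_def del: upt_Suc)
qed

end

text \<open>A reparameterization has degree one, so by the intermediate value theorem it reaches every point of the circle.\<close>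

lemma same_up_to_reparam_image:
  assumes "same_up_to_reparam q p" "is_loop q"
  shows "path_image q \<subseteq> path_image p"
proof
  obtain \<phi> \<psi> where \<phi>: "circle_reparam \<phi>" and eq: "\<And>t. p (frac (\<psi> t)) = q (frac (\<phi> t))"
    using assms(1) unfolding same_up_to_reparam_def by metis
  fix w assume "w \<in> path_image q"
  then obtain t where t: "t \<in> {0..1}" "w = q t" by (auto simp: path_image_def)
  have "w = q (frac t)"
    using t assms(2) by (cases "t = 1") (auto simp: is_loop_def pathstart_def pathfinish_def frac_eq)
  define m where "m = \<lceil>\<phi> 0 - t\<rceil>"
  have m: "\<phi> 0 \<le> t + of_int m" "t + of_int m < \<phi> 0 + 1"
    unfolding m_def by linarith+
  have "continuous_on {0..1} \<phi>" using \<phi> by (auto simp: circle_reparam_def elim: continuous_on_subset)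
  moreover have "\<phi> (0 + 1) = \<phi> 0 + 1" using \<phi> unfolding circle_reparam_def by blast
  then have "\<phi> 1 = \<phi> 0 + 1" by simp
  ultimately obtain u where "\<phi> u = t + of_int m"
    using IVT'[of \<phi> 0 "t + of_int m" 1] m by auto
  then have "frac (\<phi> u) = frac t" by simp
  then have "w = p (frac (\<psi> u))" using \<open>w = q (frac t)\<close> eq[of u] by simp
  then show "w \<in> path_image p"
    unfolding path_image_def by (metis atLeastAtMost_iff frac_ge_0 frac_lt_1 image_eqI less_imp_le)
qed

section \<open>The cycle\<close>

lemma path_mesh:
  fixes p :: "real \<Rightarrow> 'a::metric_space"
  assumes "path p" "\<epsilon> > 0"
  shows "\<forall>\<^sub>F N in sequentially. \<forall>s\<in>{0..1}. \<forall>t\<in>{0..1}. \<bar>s - t\<bar> \<le> 1 / real N \<longrightarrow> dist (p s) (p t) < \<epsilon>"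
proof -
  have "uniformly_continuous_on {0..1} p"
    using assms(1) by (simp add: path_def compact_uniformly_continuous)
  then obtain d where d: "d > 0" "\<And>s t. \<lbrakk>s \<in> {0..1}; t \<in> {0..1}; dist t s < d\<rbrakk> \<Longrightarrow> dist (p t) (p s) < \<epsilon>"
    unfolding uniformly_continuous_on_def using assms(2) by blast
  obtain N0 :: nat where N0: "N0 > 1 / d" using reals_Archimedean2 by blast
  show ?thesis
  proof (rule eventually_sequentiallyI[of "Suc N0"], intro ballI impI)
    fix N s t assume N: "Suc N0 \<le> N" and st: "s \<in> {0..1}" "t \<in> {0..1}" "\<bar>s - t\<bar> \<le> 1 / real N"
    have "1 / d < N" "real N > 0" using N0 N by linarith+
    then have "1 / N < d" using d(1) by (simp add: field_simps)
    then show "dist (p s) (p t) < \<epsilon>" using st by (intro d(2)) (auto simp: dist_real_def)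
  qed
qed

context isometric_circle
begin

text \<open>The triangles that the cocycle does not see: by rigidity, a triangle with sides at most \<open>c / 3\<close> is near an
  equilateral one only if it is equilateral on the circle.\<close>

definition skew :: "'a \<Rightarrow> 'a \<Rightarrow> 'a \<Rightarrow> bool" where
  "skew x y z \<longleftrightarrow> dist x y \<le> c / 3 \<and> dist y z \<le> c / 3 \<and> dist x z \<le> c / 3 \<and>
     \<not> near_equilateral 0 x y z \<and> \<not> near_equilateral 0 x z y"

lemma thin_imp_skew:
  assumes "thin x y z"
  shows "skew x y z"
proof -
  have "\<not> near_equilateral 0 x y z" "\<not> near_equilateral 0 x z y"
    using assms near_equilateral_0D[of x y z] near_equilateral_0D[of x z y] c_pos
    by (auto simp: thin_def dist_commute)
  then show ?thesis using assms by (simp add: skew_def thin_def)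
qed

text \<open>The subdivided singular chain bounds the polygon of \<open>\<alpha>\<close> minus those of the \<open>\<beta> i\<close>. Filling each polygon closes it
  up to a cycle. The only equilateral triangle in it is the one on the cut points of \<open>\<alpha>\<close>, since
  the loops \<open>\<beta> i\<close> do not traverse the circle.\<close>

lemma ex_cycle:
  fixes \<beta> :: "'i \<Rightarrow> real \<Rightarrow> 'a" and g :: "'i \<Rightarrow> 'g::ab_group_add" and h :: 'g
  assumes \<alpha>: "path \<alpha>" "\<And>t. t \<in> {0..1} \<Longrightarrow> \<alpha> t = A t"
    and \<beta>: "\<And>i. i \<in> I \<Longrightarrow> is_loop (\<beta> i) \<and> curve_length (\<beta> i) \<le> ereal c \<and> path_image (\<beta> i) \<noteq> range A"
    and "finite I"
    and between: "\<And>x y m. x \<in> range A \<Longrightarrow> y \<in> range A \<Longrightarrow> dist x m + dist m y = dist x y \<Longrightarrow> m \<in> range A"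
    and b: "b \<in> singular_gchains 2 (euclidean :: 'a topology)"
      "singular_gboundary 2 b = Poly_Mapping.single (path_simplex \<alpha>) h - (\<Sum>i\<in>I. Poly_Mapping.single (path_simplex (\<beta> i)) (g i))"
  shows "\<exists>r\<in>triangle_span skew. simplicial_boundary (triangle_chain h (A 0) (A (1/3)) (A (2/3)) + r) = 0"
proof -
  have "\<exists>t1 t2. 0 \<le> t1 \<and> t1 \<le> t2 \<and> t2 \<le> 1 \<and> length_le (\<beta> i) 0 t1 (c/3) \<and> length_le (\<beta> i) t1 t2 (c/3) \<and>
      length_le (\<beta> i) t2 1 (c/3)" if "i \<in> I" for i
    using \<beta>[OF that] c_pos by (auto simp: is_loop_def elim!: length_le_thirds[where c = c])
  then obtain t1 t2 where t12: "\<And>i. i \<in> I \<Longrightarrow> 0 \<le> t1 i \<and> t1 i \<le> t2 i \<and> t2 i \<le> 1 \<and> length_le (\<beta> i) 0 (t1 i) (c/3) \<and>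
      length_le (\<beta> i) (t1 i) (t2 i) (c/3) \<and> length_le (\<beta> i) (t2 i) 1 (c/3)"
    by metis
  have closed: "\<beta> i 0 = \<beta> i 1" "path (\<beta> i)" if "i \<in> I" for i
    using \<beta>[OF that] by (auto simp: is_loop_def pathstart_def pathfinish_def)
  have corner: "skew (\<beta> i 0) (\<beta> i (t1 i)) (\<beta> i (t2 i))" if i: "i \<in> I" for i
  proof -
    have t: "0 \<le> t1 i" "t1 i \<le> t2 i" "t2 i \<le> 1" and len: "length_le (\<beta> i) 0 (t1 i) (c/3)"
      "length_le (\<beta> i) (t1 i) (t2 i) (c/3)" "length_le (\<beta> i) (t2 i) 1 (c/3)"
      using t12[OF i] by auto
    have "dist (\<beta> i 0) (\<beta> i (t2 i)) \<le> c / 3"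
      using length_le_dist[OF len(3), of "t2 i" 1] t closed[OF i] by (simp add: dist_commute)
    then show ?thesis
      unfolding skew_def
      using length_le_dist[OF len(1), of 0 "t1 i"] length_le_dist[OF len(2), of "t1 i" "t2 i"] t
        thirds_not_equilateral[OF between closed(2,1)[OF i] t len] \<beta>[OF i] by auto
  qed
  have "c / 4 > 0" using c_pos by simp
  have "\<forall>\<^sub>F N in sequentially. N > 0 \<and>
      lin_ext (subdivided_triangle N) b \<in> triangle_span (sides_less (c / 4)) \<and>
      (\<forall>s\<in>{0..1}. \<forall>t\<in>{0..1}. \<bar>s - t\<bar> \<le> 1 / real N \<longrightarrow> dist (\<alpha> s) (\<alpha> t) < c / 4) \<and>
      (\<forall>i\<in>I. \<forall>s\<in>{0..1}. \<forall>t\<in>{0..1}. \<bar>s - t\<bar> \<le> 1 / real N \<longrightarrow> dist (\<beta> i s) (\<beta> i t) < c / 4)"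
    using \<open>finite I\<close> closed(2) \<alpha>(1) \<open>c / 4 > 0\<close>
    by (intro eventually_conj eventually_gt_at_top subdivided_chain_in_span[OF b(1)] path_mesh eventually_ball_finite ballI) auto
  then obtain N where N: "N > 0"
      "lin_ext (subdivided_triangle N) b \<in> triangle_span (sides_less (c / 4))"
      "\<And>s t. \<lbrakk>s \<in> {0..1}; t \<in> {0..1}; \<bar>s - t\<bar> \<le> 1 / real N\<rbrakk> \<Longrightarrow> dist (\<alpha> s) (\<alpha> t) < c / 4"
      "\<And>i s t. \<lbrakk>i \<in> I; s \<in> {0..1}; t \<in> {0..1}; \<bar>s - t\<bar> \<le> 1 / real N\<rbrakk> \<Longrightarrow> dist (\<beta> i s) (\<beta> i t) < c / 4"
    using eventually_happens'[OF sequentially_bot] by (smt (verit, best))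
  have lenA: "length_le \<alpha> u v (c / 3)" if "0 \<le> u" "v - u = 1/3" "v \<le> 1" for u v
  proof -
    have "length_le \<alpha> u v (c * (v - u))"
    proof (rule length_le_affine)
      fix s t assume "u \<le> s" "s \<le> t" "t \<le> v"
      then show "dist (\<alpha> s) (\<alpha> t) \<le> c * (t - s)"
        using that dist_A_le[of s t] by (simp add: \<alpha>(2))
    qed (use that c_pos in auto)
    then show ?thesis using that(2) by simp
  qed
  have \<alpha>01: "\<alpha> 0 = A 0" "\<alpha> (1/3) = A (1/3)" "\<alpha> (2/3) = A (2/3)" "\<alpha> 1 = A 0"
    using \<alpha>(2) A_plus_1[of 0] by auto
  obtain r0 where r0: "r0 \<in> triangle_span thin"
    "simplicial_boundary (r0 + triangle_chain h (A 0) (A (1/3)) (A (2/3))) = subdivided_edge N (path_simplex \<alpha>) h"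
    using fill_loop[of \<alpha> "1/3" "2/3" N h, OF _ _ _ _ lenA lenA lenA N(1) N(3)] \<alpha>01
      subdivided_edge_path_simplex[OF N(1), of \<alpha> h] by auto
  have "\<exists>r. r \<in> triangle_span thin \<and>
      simplicial_boundary (r + triangle_chain (g i) (\<beta> i 0) (\<beta> i (t1 i)) (\<beta> i (t2 i))) = subdivided_edge N (path_simplex (\<beta> i)) (g i)"
    if i: "i \<in> I" for i
    using fill_loop[of "\<beta> i" "t1 i" "t2 i" N "g i", OF closed(1)[OF i] _ _ _ _ _ _ N(1) N(4)[OF i]] t12[OF i]
      subdivided_edge_path_simplex[OF N(1), of "\<beta> i" "g i"] by metis
  then obtain r where r: "\<And>i. i \<in> I \<Longrightarrow> r i \<in> triangle_span thin"
      "\<And>i. i \<in> I \<Longrightarrow> simplicial_boundary (r i + triangle_chain (g i) (\<beta> i 0) (\<beta> i (t1 i)) (\<beta> i (t2 i))) =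
        subdivided_edge N (path_simplex (\<beta> i)) (g i)"
    by metis
  define s where "s = r0 - (\<Sum>i\<in>I. r i + triangle_chain (g i) (\<beta> i 0) (\<beta> i (t1 i)) (\<beta> i (t2 i)))
      - lin_ext (subdivided_triangle N) b"
  have skew_if_thin: "u \<in> triangle_span skew" if "u \<in> triangle_span thin" for u :: "('a, 'g) simplicial_chain"
    by (rule triangle_span_mono[OF _ that]) (rule thin_imp_skew)
  have "lin_ext (subdivided_triangle N) b \<in> triangle_span skew"
    by (rule triangle_span_mono[OF _ N(2)]) (intro thin_imp_skew sides_less_imp_thin)
  moreover have "r i + triangle_chain (g i) (\<beta> i 0) (\<beta> i (t1 i)) (\<beta> i (t2 i)) \<in> triangle_span skew" if "i \<in> I" for i
    using that by (intro triangle_span_add skew_if_thin r(1) triangle_span_triangle[where P = skew] corner)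
  ultimately have "s \<in> triangle_span skew"
    unfolding s_def by (intro triangle_span_diff triangle_span_sum skew_if_thin[OF r0(1)])
  moreover have "simplicial_boundary (triangle_chain h (A 0) (A (1/3)) (A (2/3)) + s) = 0"
  proof -
    note E = additive_lin_ext[where f = "subdivided_edge N", OF additive_subdivided_edge]
    have "lin_ext (subdivided_edge N) (singular_gboundary 2 b) = subdivided_edge N (path_simplex \<alpha>) h
        - (\<Sum>i\<in>I. subdivided_edge N (path_simplex (\<beta> i)) (g i))"
      unfolding b(2) Modules.additive.diff[OF E] Modules.additive.sum[OF E] lin_ext_single[OF additive_subdivided_edge] ..
    moreover have eq: "triangle_chain h (A 0) (A (1/3)) (A (2/3)) + s = (r0 + triangle_chain h (A 0) (A (1/3)) (A (2/3)))
        - (\<Sum>i\<in>I. r i + triangle_chain (g i) (\<beta> i 0) (\<beta> i (t1 i)) (\<beta> i (t2 i))) - lin_ext (subdivided_triangle N) b"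
      by (simp add: s_def)
    ultimately show ?thesis
      unfolding eq simplicial_boundary_diff simplicial_boundary_sum r0(2) boundary_subdivided_chain[OF N(1)]
      using r(2) by simp
  qed
  ultimately show ?thesis by blast
qed

end

section \<open>The critical class\<close>

theorem theorem5p1:
  fixes \<alpha> :: "real \<Rightarrow> 'a::metric_space"
    and one_G :: "'g::ab_group_add"
    and \<beta> :: "nat \<Rightarrow> real \<Rightarrow> 'a" and g :: "nat \<Rightarrow> 'g" and k :: nat
  assumes "geodesic_space TYPE('a)"
    and "locally compact (UNIV :: 'a set)"
    and "semilocally_simply_connected TYPE('a)"
    and "one_G \<noteq> 0"
    and "geodesic_circle \<alpha>"
    and "bottleneck_loop \<alpha>"
    and "\<forall>i\<in>{1..k}. is_loop (\<beta> i) \<and> curve_length (\<beta> i) \<le> curve_length \<alpha> \<and>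
           path_image (\<beta> i) \<noteq> path_image \<alpha>"
    and "\<exists>i\<in>{1..k}. g i \<noteq> 0"
    and "loop_class one_G \<alpha> =
           finprod (singular_ghomology 1 euclidean) (\<lambda>i. loop_class (g i) (\<beta> i)) {1..k}"
    and "\<forall>U. neighbourhood_of U (path_image \<alpha>) \<longrightarrow>
           (\<exists>V\<subseteq>U. neighbourhood_of V (path_image \<alpha>) \<and> geodesically_convex V)"
  shows "\<exists>B1 B2 :: real. ereal B1 > curve_length \<alpha> / 3 \<and> B2 > 0 \<and>
    (\<forall>a b :: real \<Rightarrow> real.
       bij_betw a {0<..} {0<..} \<and> strict_mono_on {0<..} a \<and>
       bij_betw b {0<..} {0<..} \<and> strict_mono_on {0<..} b \<and>
       (\<forall>r>0. a r \<ge> b r) \<longrightarrow>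
       (let K = (\<lambda>r. sRips (UNIV :: 'a set) (a r) 2 (b r));
            H = (\<lambda>r. simplicial_homology 2 (K r) :: ('a, 'g) simplicial_chain set monoid);
            R = {r. r > 0 \<and> B1 > a r \<and> ereal (a r) > curve_length \<alpha> / 3 \<and> B2 > b r}
        in \<exists>Q. (\<forall>r\<in>R. Q r \<in> carrier (H r) \<and> Q r \<noteq> \<one>\<^bsub>H r\<^esub>) \<and>
               (\<forall>r1\<in>R. \<forall>r2\<in>R. r1 < r2 \<longrightarrow> inclusion_induced 2 (K r2) (Q r1) = Q r2) \<and>
               (\<forall>q>0. ereal (a q) \<le> curve_length \<alpha> / 3 \<longrightarrow>
                  (\<forall>r\<in>R. \<not> (\<exists>Q'\<in>carrier (H q). inclusion_induced 2 (K r) Q' = Q r)))))"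
proof -
  obtain c where c: "c > 0" "\<And>s t. \<lbrakk>s \<in> {0..1}; t \<in> {0..1}\<rbrakk> \<Longrightarrow> dist (\<alpha> s) (\<alpha> t) = c * min \<bar>s - t\<bar> (1 - \<bar>s - t\<bar>)"
    using assms(5) unfolding geodesic_circle_def by blast
  define A where "A t = \<alpha> (frac t)" for t
  interpret isometric_circle A c
  proof
    show "dist (A s) (A t) = c * dist_to_int (s - t)" for s t
      unfolding A_def dist_to_int_frac_diff
      using frac_ge_0[of s] frac_lt_1[of s] frac_ge_0[of t] frac_lt_1[of t] by (intro c(2)) auto
  qed (rule c(1))
  have \<alpha>A: "\<alpha> t = A t" if "t \<in> {0..1}" for t
  proof (cases "t = 1")
    case True
    have "\<alpha> 1 = \<alpha> 0" using c(2)[of 1 0] by simp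
    then show ?thesis by (simp add: A_def True)
  next
    case False
    then have "frac t = t" using that by (simp add: frac_eq)
    then show ?thesis by (simp add: A_def)
  qed
  have loop: "is_loop \<alpha>" and path: "path \<alpha>"
    using assms(6) by (auto simp: bottleneck_loop_def is_loop_def)
  have img: "path_image \<alpha> = range A"
    unfolding range_A path_image_def using \<alpha>A by (intro image_cong) auto
  have len: "curve_length \<alpha> = ereal c"
  proof (rule antisym)
    have "dist (\<alpha> s) (\<alpha> t) \<le> c * t - c * s" if "0 \<le> s" "s \<le> t" "t \<le> 1" for s t
      using that dist_A_le[of s t] by (simp add: \<alpha>A right_diff_distrib)
    from curve_length_le[of \<alpha> "\<lambda>t. c * t", OF this] show "curve_length \<alpha> \<le> ereal c" by simp
    have "(\<Sum>i<length [0, 1/3, 2/3, 1] - 1. dist (\<alpha> ([0, 1/3, 2/3, 1] ! i)) (\<alpha> ([0, 1/3, 2/3, 1] ! Suc i))) = c"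
      by (simp add: numeral_3_eq_3 c(2) min_def)
    then show "ereal c \<le> curve_length \<alpha>"
      using curve_length_ge[of "[0, 1/3, 2/3, 1]" \<alpha>] by simp
  qed
  have third: "curve_length \<alpha> / 3 = ereal (c / 3)" by (simp add: len)
  have convex: "\<exists>V\<subseteq>W. range A \<subseteq> interior V \<and> geodesically_convex V" if "open W" "range A \<subseteq> W" for W
    using assms(10) that unfolding img neighbourhood_of_def by (simp add: interior_open)
  have between: "m \<in> range A" if "x \<in> range A" "y \<in> range A" "dist x m + dist m y = dist x y" for x y m
    by (rule between_in_convex_core[OF assms(1) convex that])
  obtain U where U: "range A \<subseteq> interior U"
    "\<And>q. is_loop q \<Longrightarrow> path_image q \<subseteq> U \<Longrightarrow> homotopic_loops U q \<alpha> \<Longrightarrow> curve_length q \<le> ereal c \<Longrightarrow>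
       same_up_to_reparam q \<alpha> \<or> same_up_to_reparam q (reversepath \<alpha>)"
    using assms(6) unfolding bottleneck_loop_def neighbourhood_of_def img len by blast
  have bottleneck: "path_image q \<subseteq> range A"
    if q: "is_loop q" "homotopic_loops (interior U) q A" "curve_length q \<le> ereal c" for q
  proof -
    have "homotopic_loops (interior U) A \<alpha>"
      using is_loop_A[of 0] U(1) \<alpha>A by (intro homotopic_loops_eq) (auto simp: is_loop_def path_image_def)
    with q(2) have "homotopic_loops (interior U) q \<alpha>" by (rule homotopic_loops_trans)
    then have "homotopic_loops U q \<alpha>" by (rule homotopic_loops_subset) (rule interior_subset)
    then have "same_up_to_reparam q \<alpha> \<or> same_up_to_reparam q (reversepath \<alpha>)"
      using U(2) q(1,3) homotopic_loops_imp_subset by blast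
    then show ?thesis
      using same_up_to_reparam_image[OF _ q(1)] img path_image_reversepath[of \<alpha>] by blast
  qed
  obtain \<epsilon>0 where \<epsilon>0: "\<epsilon>0 > 0" "\<epsilon>0 \<le> c / 24"
    "\<And>x y z. near_equilateral \<epsilon>0 x y z \<Longrightarrow> dist x y \<le> c / 3 \<Longrightarrow> dist y z \<le> c / 3 \<Longrightarrow> dist x z \<le> c / 3 \<Longrightarrow>
       near_equilateral 0 x y z"
    using rigid_near_equilateral[OF assms(1,3) convex open_interior U(1) bottleneck] by blast
  obtain C where C: "compact C" "range A \<subseteq> interior C"
    using compact_neighbourhood[OF assms(2) compact_range_A] by blast
  obtain \<epsilon>1 where \<epsilon>1: "\<epsilon>1 > 0" "(\<Union>x\<in>range A. cball x \<epsilon>1) \<subseteq> interior C"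
    using compact_subset_open_imp_cball_epsilon_subset[OF compact_range_A open_interior C(2)] by blast
  define \<epsilon> where "\<epsilon> = min \<epsilon>0 \<epsilon>1"
  have \<epsilon>: "\<epsilon> > 0" "\<epsilon> \<le> c / 24" "\<epsilon> \<le> \<epsilon>0" "\<epsilon> \<le> \<epsilon>1" using \<epsilon>0 \<epsilon>1 by (auto simp: \<epsilon>_def)
  have rigid: "near_equilateral 0 x y z"
    if "near_equilateral \<epsilon> x y z" "dist x y \<le> c / 3" "dist y z \<le> c / 3" "dist x z \<le> c / 3" for x y z
    using \<epsilon>0(3) near_equilateral_mono[OF that(1) \<epsilon>(3)] that(2-4) by blast
  have inC: "w \<in> C" if "dist w (A t) \<le> \<epsilon>" for w t
  proof -
    have "w \<in> cball (A t) \<epsilon>1" using that \<epsilon>(4) by (simp add: dist_commute)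
    then show ?thesis using \<epsilon>1(2) interior_subset by blast
  qed
  have "\<epsilon> / 2 > 0" using \<epsilon>(1) by simp
  have "\<exists>B1>c / 3. \<forall>x y z. near_equilateral \<epsilon> x y z \<longrightarrow> dist x y < B1 \<longrightarrow> dist y z < B1 \<longrightarrow> dist x z < B1 \<longrightarrow>
      near_equilateral (\<epsilon> / 2) x y z"
  proof (rule near_equilateral_gap[of C \<epsilon> "\<epsilon> / 2"])
    show "w \<in> C" if "dist w (A t) \<le> \<epsilon>" for w t using that by (rule inC)
    show "near_equilateral 0 x y z" if "near_equilateral \<epsilon> x y z" "dist x y \<le> c / 3" "dist y z \<le> c / 3" "dist x z \<le> c / 3" for x y z
      using that by (rule rigid)
  qed (use C(1) \<open>\<epsilon> / 2 > 0\<close> in blast)+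
  then obtain B1 where B1: "B1 > c / 3"
    "\<And>x y z. near_equilateral \<epsilon> x y z \<Longrightarrow> dist x y < B1 \<Longrightarrow> dist y z < B1 \<Longrightarrow> dist x z < B1 \<Longrightarrow> near_equilateral (\<epsilon> / 2) x y z"
    by blast
  interpret T: oriented_triangles "near_equilateral \<epsilon>"
  proof
    show "near_equilateral \<epsilon> y z x" if "near_equilateral \<epsilon> x y z" for x y z
      using that by (rule near_equilateral_rotate)
    show "\<not> near_equilateral \<epsilon> x z y" if "near_equilateral \<epsilon> x y z" for x y z
      using that by (rule near_equilateral_oriented) (use \<epsilon>(2) c_pos in linarith)
  qed
  have loops: "is_loop (\<beta> i) \<and> curve_length (\<beta> i) \<le> ereal c \<and> path_image (\<beta> i) \<noteq> range A" if "i \<in> {1..k}" for i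
    using assms(7) that unfolding img len by blast
  obtain b where b: "b \<in> singular_gchains 2 (euclidean :: 'a topology)"
    "singular_gboundary 2 b = Poly_Mapping.single (path_simplex \<alpha>) one_G - (\<Sum>i\<in>{1..k}. Poly_Mapping.single (path_simplex (\<beta> i)) (g i))"
    by (rule loop_class_eq_finprod[OF loop _ _ assms(9)]) (use loops in auto)
  have "\<exists>r\<in>triangle_span skew. simplicial_boundary (triangle_chain one_G (A 0) (A (1/3)) (A (2/3)) + r) = 0"
  proof (rule ex_cycle[OF path _ _ _ _ b])
    show "\<alpha> t = A t" if "t \<in> {0..1}" for t using that by (rule \<alpha>A)
    show "m \<in> range A" if "x \<in> range A" "y \<in> range A" "dist x m + dist m y = dist x y" for x y m
      using that by (rule between)
  qed (use loops in auto)
  then obtain r where r: "r \<in> triangle_span skew"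
    "simplicial_boundary (triangle_chain one_G (A 0) (A (1/3)) (A (2/3)) + r) = 0"
    by blast
  \<comment> \<open>One cycle serves all scales: its triangles have sides at most \<open>c / 3\<close>.\<close>
  define z where "z = triangle_chain one_G (A 0) (A (1/3)) (A (2/3)) + r"
  have equilateral: "near_equilateral 0 (A 0) (A (1/3)) (A (2/3))"
    unfolding near_equilateral_def by (intro exI[of _ 0]) simp
  have count_z: "T.count_good z = one_G"
  proof -
    have "T.count_good r = 0"
    proof (rule additive_triangle_span_eq_0[OF T.additive_count_good _ r(1)])
      fix h :: 'g and x y z assume "skew x y z"
      then show "T.count_good (triangle_chain h x y z) = 0"
        using rigid[of x y z] rigid[of x z y]
        by (intro T.count_good_triangle_0) (auto simp: skew_def dist_commute)
    qed
    moreover have "near_equilateral \<epsilon> (A 0) (A (1/3)) (A (2/3))"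
      using near_equilateral_mono[OF equilateral] \<epsilon>(1) by simp
    ultimately show ?thesis
      unfolding z_def T.count_good_add by (simp add: T.count_good_triangle)
  qed
  define K where "K a b = sRips (UNIV :: 'a set) a 2 b" for a b
  have z_chain: "z \<in> simplicial_chains 2 (K a b)" if "a > c / 3" "b > 0" for a b
    unfolding z_def
  proof (rule simplicial_chains_add)
    have in_K: "{x, y, z} \<in> K a b" if "dist x y \<le> c / 3" "dist y z \<le> c / 3" "dist x z \<le> c / 3" for x y z
      unfolding K_def using that \<open>a > c / 3\<close> \<open>b > 0\<close> by (intro triangle_in_sRips) auto
    show "triangle_chain one_G (A 0) (A (1/3)) (A (2/3)) \<in> simplicial_chains 2 (K a b)"
      using near_equilateral_0D[OF equilateral]
      by (intro triangle_chain_in_simplicial_chains in_K) linarith+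
    show "r \<in> simplicial_chains 2 (K a b)"
      by (rule triangle_span_simplicial_chains[OF _ r(1)]) (auto intro: in_K simp: skew_def)
  qed
  \<comment> \<open>The gap property leaves a margin of \<open>\<epsilon> / 2\<close>, within which a vertex can be exchanged for a close one.\<close>
  have count_boundary: "T.count_good d = 0"
    if d: "d \<in> simplicial_boundaries 2 (K a b)" and ab: "a < B1" "b < \<epsilon> / 2" for d :: "('a, 'g) simplicial_chain" and a b
  proof -
    obtain e where e: "e \<in> simplicial_chains 3 (K a b)" "d = simplicial_boundary e"
      using d unfolding simplicial_boundaries_2 by blast
    show ?thesis
      unfolding e(2)
    proof (rule T.count_good_boundary[OF e(1), where close = "\<lambda>x y. dist x y < b"])
      show "\<not> dist x y < b" if "near_equilateral \<epsilon> x y z" for x y z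
        using near_equilateral_dist[OF that] \<epsilon>(1,2) ab(2) c_pos by linarith
      show "\<exists>p\<in>{v, x, y, z}. \<exists>q\<in>{v, x, y, z}. p \<noteq> q \<and> dist p q < b"
        if "{v, x, y, z} \<in> K a b" "distinct [v, x, y, z]" for v x y z
        using sRips_close_pair that unfolding K_def by blast
      show "near_equilateral \<epsilon> v y z"
        if "{v, x, y, z} \<in> K a b" "near_equilateral \<epsilon> x y z" "dist v x < b" for v x y z
      proof -
        have "dist p q < B1" if "p \<in> {v, x, y, z}" "q \<in> {v, x, y, z}" for p q
          using sRips_dist_less[OF \<open>{v, x, y, z} \<in> K a b\<close>[unfolded K_def] that] ab(1) by linarith
        then have "near_equilateral (\<epsilon> / 2) x y z"
          using that(2) by (intro B1(2)) auto
        from near_equilateral_perturb[OF this, of v "\<epsilon> / 2"] show ?thesis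
          using that(3) ab(2) by simp
      qed
    qed (simp add: dist_commute)
  qed
  \<comment> \<open>By rigidity, nearly equilateral triangles of diameter less than \<open>c / 3\<close> do not exist.\<close>
  have count_small: "T.count_good d = 0" if d: "d \<in> simplicial_chains 2 (K a b)" and a: "a \<le> c / 3"
    for d :: "('a, 'g) simplicial_chain" and a b
  proof (rule T.count_good_eq_0)
    fix x y z assume "[x, y, z] \<in> Poly_Mapping.keys d"
    then have "{x, y, z} \<in> K a b" using d by (force simp: simplicial_chains_def)
    then have less: "dist p q < c / 3" if "p \<in> {x, y, z}" "q \<in> {x, y, z}" for p q
      using sRips_dist_less[OF _ that] a unfolding K_def by fastforce
    show "\<not> near_equilateral \<epsilon> x y z"
    proof
      assume "near_equilateral \<epsilon> x y z"
      then have "near_equilateral 0 x y z"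
        using less[of x y] less[of y z] less[of x z] by (intro rigid) auto
      then show False using near_equilateral_0D less[of x y] by force
    qed
  qed
  show ?thesis
  proof (rule exI[of _ B1], rule exI[of _ "\<epsilon> / 2"], intro conjI allI impI)
    show "curve_length \<alpha> / 3 < ereal B1" unfolding third using B1(1) by simp
    show "\<epsilon> / 2 > 0" by fact
    fix a b :: "real \<Rightarrow> real"
    assume ab: "bij_betw a {0<..} {0<..} \<and> strict_mono_on {0<..} a \<and>
       bij_betw b {0<..} {0<..} \<and> strict_mono_on {0<..} b \<and> (\<forall>r>0. a r \<ge> b r)"
    have b_pos: "b r > 0" if "r > 0" for r
      using ab that bij_betwE by fastforce
    define L where "L r = K (a r) (b r)" for r
    define Q where "Q r = simplicial_class 2 (L r) z" for r
    define R where "R = {r. r > 0 \<and> B1 > a r \<and> a r > c / 3 \<and> \<epsilon> / 2 > b r}"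
    have count_class: "T.count_good w = one_G" if "r \<in> R" "w \<in> Q r" for r w
      using that count_boundary[of _ "a r" "b r"] count_z
      by (auto simp: Q_def L_def R_def simplicial_class_eq T.count_good_add)
    have Q_carrier: "Q r \<in> carrier (simplicial_homology 2 (L r))" if "r \<in> R" for r
      unfolding carrier_simplicial_homology Q_def L_def
      using that r(2) z_chain[of "a r" "b r"] b_pos[of r] by (intro imageI) (simp add: R_def z_def)
    have Q_one: "Q r \<noteq> \<one>\<^bsub>simplicial_homology 2 (L r)\<^esub>" if r: "r \<in> R" for r
    proof
      assume "Q r = \<one>\<^bsub>simplicial_homology 2 (L r)\<^esub>"
      then have "0 \<in> Q r" by (simp add: one_simplicial_homology zero_in_simplicial_boundaries)
      then have "T.count_good (0 :: ('a, 'g) simplicial_chain) = one_G" using count_class r by blast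
      then show False
        using assms(4) Modules.additive.zero[OF T.additive_count_good] by metis
    qed
    have Q_induced: "inclusion_induced 2 (L r2) (Q r1) = Q r2" if "r1 \<in> R" "r2 \<in> R" "r1 < r2" for r1 r2
    proof -
      have pos: "r1 \<in> {0<..}" "r2 \<in> {0<..}" using that(1,2) by (auto simp: R_def)
      have "a r1 < a r2" "b r1 < b r2"
        using ab by (auto intro: strict_mono_onD[OF _ pos that(3)])
      then have "a r1 \<le> a r2" "b r1 \<le> b r2" by simp_all
      then show ?thesis
        unfolding Q_def L_def K_def by (intro inclusion_induced_class sRips_mono)
    qed
    have Q_born: "\<not> (\<exists>Q'\<in>carrier (simplicial_homology 2 (L q)). inclusion_induced 2 (L r) Q' = Q r)"
      if q: "a q \<le> c / 3" and r: "r \<in> R" for q r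
    proof
      assume "\<exists>Q'\<in>carrier (simplicial_homology 2 (L q)). inclusion_induced 2 (L r) Q' = Q r"
      then obtain w where w: "w \<in> simplicial_chains 2 (L q)"
        "inclusion_induced 2 (L r) (simplicial_class 2 (L q) w) = Q r"
        unfolding carrier_simplicial_homology by blast
      have "w \<in> Q r"
        unfolding w(2)[symmetric] inclusion_induced_def using simplicial_class_self by blast
      then have "T.count_good w = one_G" using count_class r by blast
      moreover have "T.count_good w = 0" using count_small[of w "a q" "b q"] w(1) q by (simp add: L_def)
      ultimately show False using assms(4) by simp
    qed
    show "let K = \<lambda>r. sRips (UNIV :: 'a set) (a r) 2 (b r);
            H = \<lambda>r. simplicial_homology 2 (K r) :: ('a, 'g) simplicial_chain set monoid;
            R = {r. r > 0 \<and> B1 > a r \<and> ereal (a r) > curve_length \<alpha> / 3 \<and> \<epsilon> / 2 > b r}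
        in \<exists>Q. (\<forall>r\<in>R. Q r \<in> carrier (H r) \<and> Q r \<noteq> \<one>\<^bsub>H r\<^esub>) \<and>
               (\<forall>r1\<in>R. \<forall>r2\<in>R. r1 < r2 \<longrightarrow> inclusion_induced 2 (K r2) (Q r1) = Q r2) \<and>
               (\<forall>q>0. ereal (a q) \<le> curve_length \<alpha> / 3 \<longrightarrow>
                  (\<forall>r\<in>R. \<not> (\<exists>Q'\<in>carrier (H q). inclusion_induced 2 (K r) Q' = Q r)))"
      unfolding Let_def third ereal_less_eq less_ereal.simps
      using Q_carrier Q_one Q_induced Q_born unfolding L_def K_def R_def
      by (intro exI[of _ Q] conjI ballI allI impI)
  qed
qed

end
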